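(* Let $n\ge 3$. Let $\Gamma\subset\mathbb R^n$ be an open convex cone with its vertex at the origin, symmetric in the $\lambda_i$, such that $\Gamma_n\subset\Gamma\subset\Gamma_k$ for some integer $k$ with $\frac{n+1}{2}<k\le n$. Let $f\in C^2(\Gamma)\cap C^0(\overline\Gamma)$ be a real-valued function that is concave and symmetric in the $\lambda_i$, and satisfies $$f=0\ \text{ on }\partial\Gamma;\qquad f_{\lambda_i}>0\ \text{ on }\Gamma\ \text{ for all }1\le i\le n;\qquad \lim_{s\to\infty}f(s\lambda)=\infty\ \text{ for all }\lambda\in\Gamma.$$ Let $\bar b>0$ be the unique positive number with $f(\bar b e)=1$, where $e=(1,\dots,1)$. Let $u\in C^4(\mathbb R^n)$ be a positive solution of $$f(\lambda(A^u))=1,\quad\lambda(A^u)\in\Gamma,\quad\text{on }\mathbb R^n.$$ Then there exist $\bar x\in\mathbb R^n$ and a positive constant $a$ such that $$u(x)=\left(\frac{a}{1+\frac12a^2\bar b|x-\bar x|^2}\right)^{\frac{n-2}{2}}\qquad\text{for all }x\in\mathbb R^n.$$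
   Context: For $1\le k\le n$ and $\lambda\in\mathbb R^n$, $\sigma_k(\lambda)=\sum_{1\le i_1<\cdots<i_k\le n}\lambda_{i_1}\cdots\lambda_{i_k}$, and $\Gamma_k$ is the connected component of $\{\lambda\in\mathbb R^n\mid\sigma_k(\lambda)>0\}$ containing the positive cone $\Gamma_n=\{\lambda\mid\lambda_1,\dots,\lambda_n>0\}$; equivalently $\Gamma_k=\{\lambda\mid\sigma_1(\lambda)>0,\dots,\sigma_k(\lambda)>0\}$. For a positive $C^2$ function $u$, $$A^u:=-\frac{2}{n-2}u^{-\frac{n+2}{n-2}}\nabla^2u+\frac{2n}{(n-2)^2}u^{-\frac{2n}{n-2}}\nabla u\otimes\nabla u-\frac{2}{(n-2)^2}u^{-\frac{2n}{n-2}}|\nabla u|^2I,$$ with $I$ the $n\times n$ identity matrix; $\lambda(A^u)$ denotes the eigenvalues of $A^u$. "Symmetric in the $\lambda_i$" means invariant under permutations of the coordinates, and $f_{\lambda_i}=\partial f/\partial\lambda_i$. The existence and uniqueness of $\bar b$ follow from the assumptions on $f$. *)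

theory Defs
  imports "HOL-Analysis.Analysis"
begin

definition sigma :: "nat \<Rightarrow> real ^ 'n \<Rightarrow> real" where
  "sigma k l = (\<Sum>S | S \<subseteq> UNIV \<and> card S = k. \<Prod>i\<in>S. l $ i)"

definition pos_cone :: "(real ^ 'n) set" where
  "pos_cone = {l. \<forall>i. l $ i > 0}"

text \<open>The vector \<open>1\<close> is \<open>(1, \<dots>, 1)\<close>. It lies in the connected set \<^const>\<open>pos_cone\<close>, so its
  component is the one that contains \<^const>\<open>pos_cone\<close>; see \<open>Gamma_cone_unique\<close> below.\<close>

definition Gamma_cone :: "nat \<Rightarrow> (real ^ 'n) set" where
  "Gamma_cone k = connected_component_set {l. sigma k l > 0} 1"

definition partial_deriv :: "'n \<Rightarrow> (real ^ 'n \<Rightarrow> real) \<Rightarrow> real ^ 'n \<Rightarrow> real" where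
  "partial_deriv i f x = frechet_derivative f (at x) (axis i 1)"

text \<open>\<open>Ck_on k S f\<close> means \<open>f \<in> C\<^sup>k(S)\<close> and is meant for open \<open>S\<close> only: there all partial
  derivatives up to order \<open>k\<close> exist and are continuous, and they do not depend on the
  values of \<open>f\<close> outside \<open>S\<close>.\<close>

primrec Ck_on :: "nat \<Rightarrow> (real ^ 'n) set \<Rightarrow> (real ^ 'n \<Rightarrow> real) \<Rightarrow> bool" where
  "Ck_on 0 S f \<longleftrightarrow> continuous_on S f"
| "Ck_on (Suc k) S f \<longleftrightarrow> f differentiable_on S \<and> (\<forall>i. Ck_on k S (partial_deriv i f))"

definition grad :: "(real ^ 'n \<Rightarrow> real) \<Rightarrow> real ^ 'n \<Rightarrow> real ^ 'n" where
  "grad u x = (\<chi> i. partial_deriv i u x)"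

definition hess :: "(real ^ 'n \<Rightarrow> real) \<Rightarrow> real ^ 'n \<Rightarrow> real ^ 'n ^ 'n" where
  "hess u x = (\<chi> i j. partial_deriv i (partial_deriv j u) x)"

definition outer :: "real ^ 'n \<Rightarrow> real ^ 'n \<Rightarrow> real ^ 'n ^ 'n" where
  "outer v w = (\<chi> i j. v $ i * w $ j)"

definition conf_hess :: "(real ^ 'n \<Rightarrow> real) \<Rightarrow> real ^ 'n \<Rightarrow> real ^ 'n ^ 'n" where
  "conf_hess u x = (let n = real CARD('n) in
      - (2 / (n - 2) * u x powr (- (n + 2) / (n - 2))) *\<^sub>R hess u x
      + (2 * n / (n - 2)\<^sup>2 * u x powr (- 2 * n / (n - 2))) *\<^sub>R outer (grad u x) (grad u x)
      - (2 / (n - 2)\<^sup>2 * u x powr (- 2 * n / (n - 2)) * (norm (grad u x))\<^sup>2) *\<^sub>R mat 1)"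

text \<open>\<open>l\<close> lists the eigenvalues of \<open>A\<close> with multiplicity, that is, the roots of the
  characteristic polynomial. For symmetric \<open>A\<close> such an \<open>l\<close> exists and is unique up to a
  permutation of its coordinates.\<close>

definition eigenvalues_of :: "real ^ 'n ^ 'n \<Rightarrow> real ^ 'n \<Rightarrow> bool" where
  "eigenvalues_of A l \<longleftrightarrow> (\<forall>t. det (mat t - A) = (\<Prod>i\<in>UNIV. t - l $ i))"

definition permute_coords :: "('n \<Rightarrow> 'n) \<Rightarrow> real ^ 'n \<Rightarrow> real ^ 'n" where
  "permute_coords p l = (\<chi> i. l $ p i)"

definition symmetric_set :: "(real ^ 'n) set \<Rightarrow> bool" where
  "symmetric_set S \<longleftrightarrow> (\<forall>p l. p permutes UNIV \<longrightarrow> l \<in> S \<longrightarrow> permute_coords p l \<in> S)"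

definition symmetric_fun_on :: "(real ^ 'n) set \<Rightarrow> (real ^ 'n \<Rightarrow> real) \<Rightarrow> bool" where
  "symmetric_fun_on S f \<longleftrightarrow>
     (\<forall>p l. p permutes UNIV \<longrightarrow> l \<in> S \<longrightarrow> f (permute_coords p l) = f l)"

text \<open>Only scaling by positive factors is required: \<^const>\<open>conic\<close> would put the vertex \<open>0\<close> into
  the cone, and the only open such set is the whole space.\<close>

definition open_convex_cone :: "(real ^ 'n) set \<Rightarrow> bool" where
  "open_convex_cone S \<longleftrightarrow> open S \<and> convex S \<and> (\<forall>l\<in>S. \<forall>s>0. s *\<^sub>R l \<in> S)"

lemma sigma_pos:
  fixes l :: "real ^ 'n"
  assumes "l \<in> pos_cone" and "k \<le> CARD('n)"
  shows "sigma k l > 0"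
proof -
  obtain S :: "'n set" where "card S = k"
    using obtain_subset_with_card_n[OF assms(2)] by blast
  then have "{S :: 'n set. S \<subseteq> UNIV \<and> card S = k} \<noteq> {}"
    by auto
  then show ?thesis
    unfolding sigma_def using assms(1)
    by (intro sum_pos) (auto simp: pos_cone_def intro!: prod_pos)
qed

lemma convex_pos_cone: "convex (pos_cone :: (real ^ 'n) set)"
  unfolding convex_alt pos_cone_def
proof clarsimp
  fix x y :: "real ^ 'n" and t :: real and i
  assume x: "\<forall>i. 0 < x $ i" and y: "\<forall>i. 0 < y $ i" and t: "0 \<le> t" "t \<le> 1"
  show "0 < (1 - t) * x $ i + t * y $ i"
  proof (cases "t = 0")
    case False
    then show ?thesis
      using x y t by (intro add_nonneg_pos mult_nonneg_nonneg mult_pos_pos) (auto simp: less_imp_le)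
  qed (use x in simp)
qed

lemma pos_cone_subset_Gamma_cone:
  assumes "k \<le> CARD('n)"
  shows "(pos_cone :: (real ^ 'n) set) \<subseteq> Gamma_cone k"
  unfolding Gamma_cone_def
  by (rule connected_component_maximal)
    (use assms sigma_pos convex_connected[OF convex_pos_cone] in \<open>auto simp: pos_cone_def\<close>)

lemma Gamma_cone_unique:
  fixes C :: "(real ^ 'n) set"
  assumes "k \<le> CARD('n)"
  shows "C \<in> components {l. sigma k l > 0} \<and> pos_cone \<subseteq> C \<longleftrightarrow> C = Gamma_cone k"
proof -
  have one: "(1 :: real ^ 'n) \<in> pos_cone"
    by (simp add: pos_cone_def)
  then have Gamma_cone: "(Gamma_cone k :: (real ^ 'n) set) \<in> components {l. sigma k l > 0}"
    unfolding Gamma_cone_def using sigma_pos[OF one assms] by (auto simp: components_def)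
  have "(1 :: real ^ 'n) \<in> Gamma_cone k"
    using one pos_cone_subset_Gamma_cone[OF assms] by auto
  then show ?thesis
    using Gamma_cone one pos_cone_subset_Gamma_cone[OF assms] components_eq[OF _ Gamma_cone] by blast
qed

end

theory Submission
  imports Defs
begin

text \<open>
  The proof is by moving spheres. In terms of \<open>w = u^(-2/(n-2))\<close> the matrix \<open>A\<^sup>u\<close> is
  \<open>w D\<^sup>2w - |\<nabla>w|\<^sup>2/2 I\<close>, and replacing \<open>w\<close> by its Kelvin transform \<open>|y|\<^sup>2/\<mu>\<^sup>2 w(\<mu>\<^sup>2y/|y|\<^sup>2)\<close> conjugates
  this matrix by a reflection, so the equation is preserved. The equation enters through local
  uniform ellipticity and \<open>tr A\<^sup>u > 0\<close>. The first gives the strong maximum principle and the Hopf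
  lemma for pairs of solutions, hence for every centre \<open>a\<close> either \<open>w\<close> lies below its Kelvin transform
  for all radii \<open>\<mu>\<close>, or there is a critical radius at which the two touch at infinity. All radii for all
  centres would make \<open>w\<close> constant, contradicting \<open>tr A\<^sup>u > 0\<close>; so the critical radii are finite, and
  \<open>\<mu>\<^sup>2 = w(a)/\<alpha>\<close> where \<open>\<alpha> = limsup w(y)/|y|\<^sup>2\<close>. After inversion at the origin this yields for every \<open>a\<close>
  a smooth function that touches a positive superharmonic function on a punctured ball at the puncture, and two such
  functions have the same gradient there. As the gradient is a multiple of \<open>\<nabla>w(a) - 2\<alpha>a\<close>, the function \<open>w\<close>
  is a quadratic polynomial.
\<close>

section \<open>Eigenvalues of symmetric matrices\<close>

text \<open>Beyond the level set itself, the equation is seen only through a set \<open>E\<close> of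
  matrices. Its ellipticity says that a \<open>B\<close> in \<open>E\<close> cannot exceed an
  \<open>A\<close> in \<open>E\<close> in one direction unless it may fall below \<open>A\<close> by
  a comparable amount. This replaces the linearised operator: at a touching point two solutions are
  compared through their matrices alone, and \<open>B\<close> need not be near \<open>A\<close>.

  Passing from \<open>u\<close> to \<open>w\<close> reverses order: \<open>w\<close> below its
  Kelvin transform means \<open>u\<close> above its own.

  The obstacle is infinity. After inversion a solution lives on a punctured ball and nothing is
  known about its regularity at the puncture. What survives there is positivity and superharmonicity
  of the power \<open>-(n-2)/2\<close> of the inverted \<open>w\<close>, that is of the Kelvin
  transform of \<open>u\<close>, and comparison with the fundamental solution makes the puncture
  harmless. Two affine functions with a common value and different slopes, both below this function
  up to \<open>o(|z|)\<close>, would force it strictly above that value near the puncture; but the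
  tail of \<open>w\<close> brings it arbitrarily close to the value or below.\<close>

definition eigenframe :: "real^'n^'n \<Rightarrow> real^'n \<Rightarrow> ('n \<Rightarrow> real^'n) \<Rightarrow> bool" where
  "eigenframe A l v \<longleftrightarrow> (\<forall>i j. v i \<bullet> v j = (if i = j then 1 else 0)) \<and> (\<forall>i. A *v v i = l $ i *\<^sub>R v i)"

lemma symmetric_matrix_inner:
  fixes A :: "real^'n^'n"
  assumes "transpose A = A"
  shows "(A *v x) \<bullet> y = x \<bullet> (A *v y)"
  using dot_lmul_matrix[of x "transpose A" y, unfolded vector_transpose_matrix] assms by simp

lemma eigenframe_independent:
  assumes "eigenframe A l v"
  shows "inj v" "independent (v ` J)"
proof -
  have vv: "v i \<bullet> v j = (if i = j then 1 else 0)" for i j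
    using assms by (simp add: eigenframe_def)
  show "inj v"
    by (rule injI) (metis vv zero_neq_one)
  show "independent (v ` J)"
  proof (rule pairwise_orthogonal_independent)
    show "pairwise orthogonal (v ` J)"
      by (auto simp: pairwise_def orthogonal_def vv)
    show "0 \<notin> v ` J"
      using vv by (metis image_iff inner_zero_left zero_neq_one)
  qed
qed

lemma eigenframe_expand:
  fixes x :: "real^'n"
  assumes "eigenframe A l v"
  shows "x = (\<Sum>i\<in>UNIV. (v i \<bullet> x) *\<^sub>R v i)"
proof -
  have vv: "v i \<bullet> v j = (if i = j then 1 else 0)" for i j
    using assms by (simp add: eigenframe_def)
  define y where "y = x - (\<Sum>i\<in>UNIV. (v i \<bullet> x) *\<^sub>R v i)"
  have "v j \<bullet> y = 0" for j
    by (simp add: y_def inner_diff_right inner_sum_right vv if_distrib cong: if_cong)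
  then have orth: "orthogonal y z" if "z \<in> range v" for z
    using that by (auto simp: orthogonal_def inner_commute)
  have "card (range v) = CARD('n)"
    using eigenframe_independent(1)[OF assms] by (simp add: card_image)
  then have "span (range v) = UNIV"
    using eigenframe_independent(2)[OF assms, of UNIV]
    by (metis card_eq_dim dim_eq_full DIM_cart DIM_real dim_span_eq_card_independent mult.right_neutral span_span)
  then have "orthogonal y y"
    using orthogonal_to_span[of y "range v" y] orth by auto
  then show ?thesis by (simp add: y_def orthogonal_self)
qed

lemma eigenframe_quadratic_form:
  assumes "eigenframe A l v"
  shows "x \<bullet> (A *v x) = (\<Sum>i\<in>UNIV. l $ i * (v i \<bullet> x)\<^sup>2)" "x \<bullet> x = (\<Sum>i\<in>UNIV. (v i \<bullet> x)\<^sup>2)"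
proof -
  have "A *v x = A *v (\<Sum>i\<in>UNIV. (v i \<bullet> x) *\<^sub>R v i)"
    using eigenframe_expand[OF assms, of x] by simp
  also have "\<dots> = (\<Sum>i\<in>UNIV. (v i \<bullet> x) *\<^sub>R (l $ i *\<^sub>R v i))"
    using assms by (simp add: eigenframe_def linear_sum[OF matrix_vector_mul_linear] matrix_vector_mult_scaleR)
  finally have "x \<bullet> (A *v x) = x \<bullet> \<dots>" by simp
  then show "x \<bullet> (A *v x) = (\<Sum>i\<in>UNIV. l $ i * (v i \<bullet> x)\<^sup>2)"
    by (simp add: inner_sum_right power2_eq_square inner_commute mult.commute mult.left_commute)
  have "x \<bullet> x = x \<bullet> (\<Sum>i\<in>UNIV. (v i \<bullet> x) *\<^sub>R v i)"
    using eigenframe_expand[OF assms, of x] by simp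
  then show "x \<bullet> x = (\<Sum>i\<in>UNIV. (v i \<bullet> x)\<^sup>2)"
    by (simp add: inner_sum_right power2_eq_square inner_commute)
qed

text \<open>Orthonormal eigenvectors are found one at a time: on the orthogonal complement of those
  already present, which \<open>A\<close> preserves by symmetry, a unit vector maximising the
  Rayleigh quotient is an eigenvector.\<close>

lemma exists_eigenframe:
  fixes A :: "real^'n^'n"
  assumes sym: "transpose A = A"
  shows "\<exists>l v. eigenframe A l v"
proof -
  have "\<exists>B. finite B \<and> card B = k \<and> (\<forall>b\<in>B. norm b = 1 \<and> (\<exists>c. A *v b = c *\<^sub>R b)) \<and> pairwise orthogonal B"
    if "k \<le> CARD('n)" for k
    using that
  proof (induction k)
    case 0
    show ?case by (rule exI[of _ "{}"]) auto
  next
    case (Suc k)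
    then obtain B where B: "finite B" "card B = k" "\<And>b. b \<in> B \<Longrightarrow> norm b = 1" "\<And>b. b \<in> B \<Longrightarrow> \<exists>c. A *v b = c *\<^sub>R b"
      "pairwise orthogonal B" by auto
    define S where "S = {x. \<forall>b\<in>B. b \<bullet> x = 0}"
    have "dim (span B) < DIM(real^'n)"
      using dim_le_card'[OF B(1)] Suc.prems B(2) by simp
    then obtain x0 where x0: "x0 \<noteq> 0" "\<And>y. y \<in> span (span B) \<Longrightarrow> orthogonal x0 y"
      using orthogonal_to_subspace_exists[of "span B"] by (metis dim_span)
    have x0S: "x0 /\<^sub>R norm x0 \<in> S"
      using x0(2) by (auto simp: S_def orthogonal_def span_base inner_commute)
    have subS: "subspace S"
      by (auto simp: S_def subspace_def inner_add_right)
    have "closed S"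
      using closed_subspace[OF subS] .
    then have "compact (S \<inter> sphere 0 1)" by (intro closed_Int_compact) auto
    moreover have "S \<inter> sphere 0 1 \<noteq> {}"
      using x0S x0(1) by auto
    moreover have "continuous_on (S \<inter> sphere 0 1) (\<lambda>x. x \<bullet> (A *v x))"
      by (intro continuous_intros linear_continuous_on_compose[OF continuous_on_id matrix_vector_mul_linear])
    ultimately obtain x where "x \<in> S \<inter> sphere 0 1"
      and xmax': "\<forall>z \<in> S \<inter> sphere 0 1. z \<bullet> (A *v z) \<le> x \<bullet> (A *v x)"
      using continuous_attains_sup[of "S \<inter> sphere 0 1" "\<lambda>x. x \<bullet> (A *v x)"] by blast
    then have x: "x \<in> S" "norm x = 1" by auto
    have xmax: "z \<bullet> (A *v z) \<le> x \<bullet> (A *v x)" if "z \<in> S" "norm z = 1" for z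
      using xmax' that by auto
    define c where "c = x \<bullet> (A *v x)"
    have form: "z \<bullet> (A *v z) \<le> c * (z \<bullet> z)" if "z \<in> S" for z
    proof (cases "z = 0")
      case False
      have "z /\<^sub>R norm z \<in> S" using subS that by (auto simp: subspace_def)
      from xmax[OF this] False have "(z \<bullet> (A *v z)) / (norm z)\<^sup>2 \<le> c"
        by (simp add: c_def matrix_vector_mult_scaleR power2_eq_square divide_simps)
      then show ?thesis using False by (simp add: divide_simps power2_norm_eq_inner split: if_splits)
    qed simp
    define y where "y = A *v x - c *\<^sub>R x"
    have AS: "A *v z \<in> S" if "z \<in> S" for z
      unfolding S_def
    proof safe
      fix b assume b: "b \<in> B"
      obtain d where "A *v b = d *\<^sub>R b" using B(4)[OF b] by auto
      then show "b \<bullet> (A *v z) = 0"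
        using symmetric_matrix_inner[OF sym, of b z] that b by (auto simp: S_def)
    qed
    have yS: "y \<in> S" unfolding y_def using x AS subS
      by (intro subspace_diff subspace_scale)
    \<comment> \<open>Maximality of \<open>x\<close> tested along \<open>x + t y\<close>, where
      \<open>y\<close> is the residual \<open>A x - c x\<close>. The linear term is
      \<open>-2 t |y|^2\<close>, so a small positive \<open>t\<close> forces
      \<open>y = 0\<close>.\<close>
    have quad: "0 \<le> - 2 * t * (y \<bullet> y) + t\<^sup>2 * (c * (y \<bullet> y) - y \<bullet> (A *v y))" for t
    proof -
      have "x + t *\<^sub>R y \<in> S" using x yS subS by (intro subspace_add subspace_scale)
      note form[OF this]
      moreover have "x \<bullet> (A *v y) = y \<bullet> (A *v x)"
        using symmetric_matrix_inner[OF sym, of x y] by (simp add: inner_commute)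
      moreover have "x \<bullet> x = 1" using x(2) by (simp add: norm_eq_1)
      moreover have "y \<bullet> (A *v x) = y \<bullet> y + c * (x \<bullet> y)"
        unfolding y_def by (simp add: inner_simps algebra_simps inner_commute)
      ultimately show ?thesis
        using c_def by (simp add: matrix_vector_right_distrib matrix_vector_mult_scaleR inner_simps
            algebra_simps power2_eq_square inner_commute)
    qed
    have "y \<bullet> y = 0"
    proof (rule ccontr)
      assume "y \<bullet> y \<noteq> 0"
      then have p: "y \<bullet> y > 0" by (simp add: order_less_le)
      define e where "e = c * (y \<bullet> y) - y \<bullet> (A *v y)"
      define t where "t = (y \<bullet> y) / (\<bar>e\<bar> + 1)"
      have t: "t > 0" using p by (simp add: t_def)
      have "t * e \<le> t * (\<bar>e\<bar> + 1)" using t by (intro mult_left_mono) auto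
      also have "\<dots> = y \<bullet> y" by (simp add: t_def)
      finally have "t * (t * e) \<le> t * (y \<bullet> y)" using t by (intro mult_left_mono) auto
      with quad[of t] have "t * (y \<bullet> y) \<le> 0"
        by (simp add: e_def power2_eq_square algebra_simps)
      then show False using t p by (simp add: mult_le_0_iff)
    qed
    then have eig: "A *v x = c *\<^sub>R x" by (simp add: y_def)
    have "x \<notin> B" using x B(3) by (auto simp: S_def norm_eq_1)
    then show ?case
      using B x eig
      by (intro exI[of _ "insert x B"])
        (auto simp: pairwise_insert S_def orthogonal_def[abs_def] inner_commute)
  qed
  from this[of "CARD('n)"] obtain B where B: "finite B" "card B = CARD('n)" "\<And>b. b \<in> B \<Longrightarrow> norm b = 1"
     "\<And>b. b \<in> B \<Longrightarrow> \<exists>c. A *v b = c *\<^sub>R b" "pairwise orthogonal B" by auto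
  then obtain v where v: "bij_betw v (UNIV :: 'n set) B"
    using finite_same_card_bij[of "UNIV :: 'n set" B] by auto
  have vB: "v i \<in> B" for i using v by (auto simp: bij_betw_def)
  obtain l where l: "\<And>i. A *v v i = l i *\<^sub>R v i" using B(4)[OF vB] by metis
  have "v i \<bullet> v j = (if i = j then 1 else 0)" for i j
  proof (cases "i = j")
    case False
    then have "v i \<noteq> v j" using v by (auto simp: bij_betw_def inj_def)
    then show ?thesis using False B(5) vB by (auto simp: pairwise_def orthogonal_def)
  qed (use B(3)[OF vB] in \<open>simp add: norm_eq_1\<close>)
  then have "eigenframe A (\<chi> i. l i) v" using l by (simp add: eigenframe_def)
  then show ?thesis by blast
qed

lemma eigenframe_diagonalize:
  fixes A :: "real^'n^'n"
  assumes "eigenframe A l v"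
  shows "\<exists>U. orthogonal_matrix U \<and> A ** U = U ** (\<chi> i j. if i = j then l $ i else 0)"
proof (intro exI conjI)
  let ?U = "(\<chi> i j. v j $ i) :: real^'n^'n"
  have vv: "v i \<bullet> v j = (if i = j then 1 else 0)" for i j
    using assms by (simp add: eigenframe_def)
  show "orthogonal_matrix ?U"
    unfolding orthogonal_matrix using vv
    by (simp add: matrix_matrix_mult_def transpose_def mat_def inner_vec_def vec_eq_iff)
  have "(A *v v j) $ i = l $ j * v j $ i" for i j
    using assms by (simp add: eigenframe_def)
  then show "A ** ?U = ?U ** (\<chi> i j. if i = j then l $ i else 0)"
    by (simp add: matrix_matrix_mult_def matrix_vector_mult_def vec_eq_iff if_distrib mult.commute cong: if_cong)
qed

lemma eigenframe_trace:
  fixes A :: "real^'n^'n"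
  assumes "eigenframe A l v"
  shows "trace A = (\<Sum>i\<in>UNIV. l $ i)"
proof -
  obtain U where U: "orthogonal_matrix U" "A ** U = U ** (\<chi> i j. if i = j then l $ i else 0)"
    using eigenframe_diagonalize[OF assms] by blast
  have "A = (U ** (\<chi> i j. if i = j then l $ i else 0)) ** transpose U"
    using U by (metis matrix_mul_assoc matrix_mul_rid orthogonal_matrix_def)
  then have "trace A = trace (transpose U ** (U ** (\<chi> i j. if i = j then l $ i else 0)))"
    using trace_mul_sym[of "U ** (\<chi> i j. if i = j then l $ i else 0)" "transpose U"] by simp
  also have "\<dots> = trace ((\<chi> i j. if i = j then l $ i else 0) :: real^'n^'n)"
    using U(1) by (simp add: matrix_mul_assoc orthogonal_matrix_def)
  finally show ?thesis by (simp add: trace_def)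
qed

lemma eigenframe_eigenvalues_of:
  fixes A :: "real^'n^'n"
  assumes "eigenframe A l v"
  shows "eigenvalues_of A l"
  unfolding eigenvalues_of_def
proof
  fix t
  let ?D = "(\<chi> i j. if i = j then l $ i else 0) :: real^'n^'n"
  obtain U where U: "orthogonal_matrix U" "A ** U = U ** ?D"
    using eigenframe_diagonalize[OF assms] by blast
  have "(mat t - A) ** U = U ** (mat t - ?D)"
  proof -
    have "mat t ** U = U ** mat t"
      by (simp add: matrix_matrix_mult_def mat_def vec_eq_iff if_distrib if_distribR mult.commute cong: if_cong)
    then show ?thesis using U(2)
      by (simp add: matrix_matrix_mult_def vec_eq_iff algebra_simps sum_subtractf)
  qed
  then have "det (mat t - A) * det U = det U * det (mat t - ?D)"
    using det_mul[of "mat t - A" U] det_mul[of U "mat t - ?D"] by auto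
  moreover have "det U \<noteq> 0" using det_orthogonal_matrix[OF U(1)] by auto
  ultimately have "det (mat t - A) = det (mat t - ?D)" by simp
  also have "\<dots> = (\<Prod>i\<in>UNIV. t - l $ i)"
    by (subst det_diagonal) (auto simp: mat_def)
  finally show "det (mat t - A) = (\<Prod>i\<in>UNIV. t - l $ i)" .
qed

text \<open>Both lists are the root multiset of the same monic polynomial, and equal multisets
  indexed by the same finite type differ by a permutation of the indices.\<close>

lemma eigenvalues_of_unique:
  fixes A :: "real^'n^'n"
  assumes "eigenvalues_of A l" "eigenvalues_of A m"
  shows "\<exists>p. p permutes UNIV \<and> m = permute_coords p l"
proof -
  let ?P = "\<lambda>l :: real^'n. (\<Prod>i\<in>UNIV. [:- (l $ i), 1:])"
  have roots: "proots (?P l) = image_mset (\<lambda>i. l $ i) (mset_set UNIV)" for l :: "real^'n"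
  proof -
    have "proots (?P l) = (\<Sum>i\<in>UNIV. {#l $ i#})"
      by (subst proots_prod) auto
    also have "\<dots> = image_mset (\<lambda>i. l $ i) (mset_set UNIV)"
      by (simp add: sum_unfold_sum_mset)
    finally show ?thesis .
  qed
  have "poly (?P l) = poly (?P m)"
    using assms by (auto simp: eigenvalues_of_def poly_prod fun_eq_iff)
  then have "?P l = ?P m" by (simp add: poly_eq_poly_eq_iff)
  then have "image_mset (\<lambda>i. m $ i) (mset_set UNIV) = image_mset (\<lambda>i. l $ i) (mset_set UNIV)"
    by (metis roots)
  then obtain p where "p permutes (UNIV :: 'n set)" "\<forall>x\<in>UNIV. m $ x = l $ p x"
    using image_mset_eq_implies_permutes[OF finite] by metis
  then show ?thesis
    by (intro exI[of _ p]) (auto simp: permute_coords_def vec_eq_iff)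
qed

lemma eigenframe_permute:
  assumes "eigenframe A l v" "p permutes UNIV"
  shows "eigenframe A (permute_coords p l) (v \<circ> p)"
  using assms permutes_inj[OF assms(2)] by (auto simp: eigenframe_def permute_coords_def inj_def)

text \<open>The index type carries no order, so \<open>to_nat\<close> supplies an arbitrary one.
  Eigenvalues of different matrices become comparable index by index once all are sorted along
  it.\<close>

definition decreasing :: "real^'n \<Rightarrow> bool" where
  "decreasing l \<longleftrightarrow> (\<forall>i j. to_nat i \<le> to_nat j \<longrightarrow> l $ j \<le> l $ i)"

text \<open>A permutation minimising the sum of rank times entry has no inversion, since swapping an
  inverted pair lowers the sum (rearrangement inequality).\<close>

lemma exists_decreasing_permutation:
  fixes l :: "real^'n"
  shows "\<exists>p. p permutes UNIV \<and> decreasing (permute_coords p l)"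
proof -
  let ?S = "\<lambda>p. \<Sum>i\<in>UNIV. real (to_nat i) * l $ p i"
  have fin: "finite (?S ` {p. p permutes (UNIV :: 'n set)})"
    by (intro finite_imageI finite_permutations) auto
  have ne: "?S ` {p. p permutes (UNIV :: 'n set)} \<noteq> {}"
    using permutes_id by blast
  obtain p where p: "p permutes UNIV" "\<And>q. q permutes UNIV \<Longrightarrow> ?S p \<le> ?S q"
  proof -
    obtain p where p: "p permutes UNIV" "Min (?S ` {p. p permutes UNIV}) = ?S p"
      using Min_in[OF fin ne] by blast
    have "?S p \<le> ?S q" if "q permutes UNIV" for q
      using Min_le[OF fin, of "?S q"] that p(2) by auto
    then show thesis using that p(1) by blast
  qed
  have "l $ p j \<le> l $ p i" if ij: "to_nat i \<le> to_nat j" for i j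
  proof (rule ccontr)
    assume less: "\<not> l $ p j \<le> l $ p i"
    then have ne: "i \<noteq> j" by auto
    then have lt: "to_nat i < to_nat j" using ij by (metis injD inj_to_nat order_less_le)
    let ?q = "p \<circ> Transposition.transpose i j"
    have "?q permutes UNIV"
      by (intro permutes_compose permutes_swap_id p) auto
    then have le: "?S p \<le> ?S ?q" by (rule p(2))
    have split: "?S r = (\<Sum>k\<in>UNIV - {i, j}. real (to_nat k) * l $ r k) + real (to_nat i) * l $ r i + real (to_nat j) * l $ r j" for r
      using ne sum.subset_diff[of "{i, j}" UNIV "\<lambda>k. real (to_nat k) * l $ r k"] by simp
    have "(\<Sum>k\<in>UNIV - {i, j}. real (to_nat k) * l $ ?q k) = (\<Sum>k\<in>UNIV - {i, j}. real (to_nat k) * l $ p k)"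
      by (intro sum.cong) (auto simp: transpose_def)
    then have "?S ?q - ?S p = (real (to_nat i) - real (to_nat j)) * (l $ p j - l $ p i)"
      unfolding split by (simp add: algebra_simps)
    moreover have "\<dots> < 0" using lt less by (intro mult_neg_pos) auto
    ultimately show False using le by simp
  qed
  then show ?thesis using p(1) by (auto simp: decreasing_def permute_coords_def)
qed

lemma eigenvalues_of_decreasing_eigenframe:
  fixes A :: "real^'n^'n"
  assumes "transpose A = A" "eigenvalues_of A l"
  shows "\<exists>p v. p permutes UNIV \<and> eigenframe A (permute_coords p l) v \<and> decreasing (permute_coords p l)"
proof -
  obtain m v where v: "eigenframe A m v" using exists_eigenframe[OF assms(1)] by blast
  obtain p where p: "p permutes UNIV" "m = permute_coords p l"
    using eigenvalues_of_unique[OF assms(2) eigenframe_eigenvalues_of[OF v]] by blast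
  obtain q where q: "q permutes UNIV" "decreasing (permute_coords q m)"
    using exists_decreasing_permutation by blast
  have "permute_coords q m = permute_coords (p \<circ> q) l"
    using p by (simp add: permute_coords_def)
  with eigenframe_permute[OF v q(1)] q p permutes_compose[OF q(1) p(1)] show ?thesis
    by (intro exI[of _ "p \<circ> q"] exI[of _ "v \<circ> q"]) auto
qed

section \<open>Weyl's comparison of ordered eigenvalues\<close>

lemma eigenframe_form_span:
  assumes "eigenframe A l v" "x \<in> span (v ` J)"
  shows "(\<And>j. j \<in> J \<Longrightarrow> c \<le> l $ j) \<Longrightarrow> c * (x \<bullet> x) \<le> x \<bullet> (A *v x)"
    and "(\<And>j. j \<in> J \<Longrightarrow> l $ j \<le> c) \<Longrightarrow> x \<bullet> (A *v x) \<le> c * (x \<bullet> x)"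
proof -
  have vv: "v i \<bullet> v j = (if i = j then 1 else 0)" for i j
    using assms(1) by (simp add: eigenframe_def)
  have zero: "v i \<bullet> x = 0" if "i \<notin> J" for i
  proof -
    have "orthogonal (v i) y" if "y \<in> v ` J" for y
      using that vv \<open>i \<notin> J\<close> by (auto simp: orthogonal_def)
    then have "orthogonal (v i) x"
      using orthogonal_to_span[OF assms(2)] by blast
    then show ?thesis by (simp add: orthogonal_def)
  qed
  show "c * (x \<bullet> x) \<le> x \<bullet> (A *v x)" if "\<And>j. j \<in> J \<Longrightarrow> c \<le> l $ j"
    unfolding eigenframe_quadratic_form[OF assms(1)] sum_distrib_left
  proof (rule sum_mono)
    fix i show "c * (v i \<bullet> x)\<^sup>2 \<le> l $ i * (v i \<bullet> x)\<^sup>2" using that[of i] zero[of i] by (cases "i \<in> J") (auto intro: mult_right_mono)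
  qed
  show "x \<bullet> (A *v x) \<le> c * (x \<bullet> x)" if "\<And>j. j \<in> J \<Longrightarrow> l $ j \<le> c"
    unfolding eigenframe_quadratic_form[OF assms(1)] sum_distrib_left
  proof (rule sum_mono)
    fix i show "l $ i * (v i \<bullet> x)\<^sup>2 \<le> c * (v i \<bullet> x)\<^sup>2" using that[of i] zero[of i] by (cases "i \<in> J") (auto intro: mult_right_mono)
  qed
qed

text \<open>Courant-Fischer by a dimension count: the eigenvectors of \<open>A\<close> up to rank
  \<open>i\<close> and those of \<open>B\<close> from rank \<open>i\<close> on span subspaces of
  total dimension \<open>n + 1\<close>, as rank \<open>i\<close> is counted twice. A common nonzero
  vector has Rayleigh quotient at least \<open>l $ i\<close> for \<open>A\<close> and at most
  \<open>m $ i\<close> for \<open>B\<close>.\<close>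

lemma weyl_monotonicity:
  fixes A B :: "real^'n^'n"
  assumes A: "eigenframe A l v" "decreasing l" and B: "eigenframe B m w" "decreasing m"
    and le: "\<And>x. x \<bullet> (A *v x) \<le> x \<bullet> (B *v x) + t * (x \<bullet> x)"
  shows "l $ i \<le> m $ i + t"
proof -
  let ?J = "{j :: 'n. to_nat j \<le> to_nat i}" and ?K = "{j :: 'n. to_nat i \<le> to_nat j}"
  let ?V = "span (v ` ?J)" and ?W = "span (w ` ?K)"
  have dim: "dim (span (v ` J)) = card J" if "eigenframe A l v" for A and l :: "real^'n" and v J
    by (rule trans[OF dim_span_eq_card_independent[OF eigenframe_independent(2)[OF that]]
          card_image[OF inj_on_subset[OF eigenframe_independent(1)[OF that] subset_UNIV]]])
  have "dim ?V = card ?J" "dim ?W = card ?K"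
    using dim[OF A(1)] dim[OF B(1)] by blast+
  moreover have "card ?J + card ?K = CARD('n) + 1"
  proof -
    have "?J \<union> ?K = UNIV" "?J \<inter> ?K = {i}"
      using inj_to_nat[where ?'a='n] by (auto simp: inj_def)
    then show ?thesis using card_Un_Int[of ?J ?K] by simp
  qed
  moreover have "dim {x + y |x y. x \<in> ?V \<and> y \<in> ?W} \<le> CARD('n)"
    using dim_subset_UNIV[of "{x + y |x y. x \<in> ?V \<and> y \<in> ?W}"] by simp
  ultimately have "dim (?V \<inter> ?W) > 0"
    using dim_sums_Int[of ?V ?W] by simp
  then have "\<not> ?V \<inter> ?W \<subseteq> {0}"
    unfolding dim_eq_0[symmetric] by linarith
  then obtain x where x: "x \<in> ?V" "x \<in> ?W" "x \<noteq> 0"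
    by blast
  have "l $ i * (x \<bullet> x) \<le> x \<bullet> (A *v x)"
    using A(2) by (intro eigenframe_form_span(1)[OF A(1) x(1)]) (auto simp: decreasing_def)
  moreover have "x \<bullet> (B *v x) \<le> m $ i * (x \<bullet> x)"
    using B(2) by (intro eigenframe_form_span(2)[OF B(1) x(2)]) (auto simp: decreasing_def)
  ultimately have "l $ i * (x \<bullet> x) \<le> (m $ i + t) * (x \<bullet> x)"
    using le[of x] by (simp add: algebra_simps)
  then show ?thesis using x(3) by simp
qed

section \<open>Level sets of functions of the eigenvalues\<close>

lemma linear_eq_inner_axis:
  fixes L :: "real^'n \<Rightarrow> real"
  assumes "linear L"
  shows "L v = (\<chi> i. L (axis i 1)) \<bullet> v"
proof -
  have "L v = L (\<Sum>i\<in>UNIV. v $ i *\<^sub>R axis i 1)"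
    using basis_expansion[of v] by (simp add: scalar_mult_eq_scaleR)
  also have "\<dots> = (\<Sum>i\<in>UNIV. v $ i * L (axis i 1))"
    by (simp add: linear_sum[OF assms] linear_scale[OF assms])
  finally show ?thesis by (simp add: inner_vec_def mult.commute)
qed

lemma has_derivative_grad:
  assumes "f differentiable (at x)"
  shows "(f has_derivative (\<lambda>v. grad f x \<bullet> v)) (at x)"
proof -
  let ?L = "frechet_derivative f (at x)"
  have d: "(f has_derivative ?L) (at x)"
    using assms by (simp add: frechet_derivative_works)
  have "?L v = grad f x \<bullet> v" for v
    using linear_eq_inner_axis[OF linear_frechet_derivative[OF assms], of v]
    by (simp add: grad_def partial_deriv_def)
  then have "?L = (\<lambda>v. grad f x \<bullet> v)" by auto
  with d show ?thesis by simp
qed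

lemma mean_value_grad:
  fixes f :: "real^'n \<Rightarrow> real"
  assumes "convex S" and d: "\<And>x. x \<in> S \<Longrightarrow> (f has_derivative (\<lambda>v. G x \<bullet> v)) (at x)"
    and "l \<in> S" "m \<in> S"
  shows "\<exists>\<xi> \<in> closed_segment l m. f m - f l = G \<xi> \<bullet> (m - l)"
proof -
  have mem: "l + t *\<^sub>R (m - l) \<in> closed_segment l m" if "0 \<le> t" "t \<le> 1" for t
    using that by (auto simp: in_segment algebra_simps intro!: exI[of _ t])
  have "closed_segment l m \<subseteq> S"
    using assms by (simp add: closed_segment_subset)
  then have "((\<lambda>t. f (l + t *\<^sub>R (m - l))) has_derivative (\<lambda>h. G (l + t *\<^sub>R (m - l)) \<bullet> (h *\<^sub>R (m - l)))) (at t within {0..1})"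
    if "0 \<le> t" "t \<le> 1" for t
    using mem[OF that]
    by (intro has_derivative_compose[OF _ d]) (auto intro!: derivative_eq_intros)
  then obtain t where "t \<in> {0<..<1}" "f (l + 1 *\<^sub>R (m - l)) - f (l + 0 *\<^sub>R (m - l)) = G (l + t *\<^sub>R (m - l)) \<bullet> ((1 - 0) *\<^sub>R (m - l))"
    using mvt_simple[of 0 1 "\<lambda>t. f (l + t *\<^sub>R (m - l))" "\<lambda>t h. G (l + t *\<^sub>R (m - l)) \<bullet> (h *\<^sub>R (m - l))"]
    by auto
  then show ?thesis
    using mem[of t] by (intro bexI[of _ "l + t *\<^sub>R (m - l)"]) auto
qed

text \<open>Averaging over all permutations gives a constant vector \<open>a\<close> in
  \<open>S\<close> with the same coordinate sum. If that sum were not positive, \<open>a\<close>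
  would be \<open>0\<close>, or \<open>0\<close> would be the midpoint of \<open>a\<close> and the
  positive vector \<open>-a\<close>. This is the source of the positive trace on the level
  set.\<close>

lemma sum_coords_pos:
  fixes S :: "(real^'n) set"
  assumes "convex S" "symmetric_set S" "pos_cone \<subseteq> S" "0 \<notin> S" "l \<in> S"
  shows "(\<Sum>i\<in>UNIV. l $ i) > 0"
proof (rule ccontr)
  assume neg: "\<not> ?thesis"
  let ?P = "{p. p permutes (UNIV :: 'n set)}"
  define N where "N = real (card ?P)"
  have fin: "finite ?P" by (intro finite_permutations) auto
  have "id \<in> ?P" by (simp add: permutes_id)
  then have "card ?P > 0" using fin card_gt_0_iff by blast
  then have N: "N > 0" by (simp add: N_def)
  define a where "a = (\<Sum>p\<in>?P. (1 / N) *\<^sub>R permute_coords p l)"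
  have "a \<in> S"
    unfolding a_def
  proof (rule convex_sum[OF fin assms(1)])
    show "(\<Sum>p\<in>?P. 1 / N) = 1" using N by (simp flip: N_def)
  qed (use N assms(2,5) in \<open>auto simp: symmetric_set_def\<close>)
  \<comment> \<open>\<open>undefined\<close> stands for one arbitrary coordinate; by
    \<open>const\<close> the choice does not matter.\<close>
  define c where "c = (\<Sum>p\<in>?P. l $ p undefined) / N"
  have const: "(\<Sum>p\<in>?P. l $ p i) = (\<Sum>p\<in>?P. l $ p undefined)" for i
    using sum_permutations_compose_right[OF permutes_swap_id[of i UNIV undefined], of "\<lambda>p. l $ p i"]
    by simp
  then have a: "a $ i = c" for i
    by (simp add: a_def c_def permute_coords_def sum_divide_distrib[symmetric])
  have "real CARD('n) * c = (\<Sum>i\<in>UNIV. a $ i)"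
    by (simp add: a)
  also have "\<dots> = (\<Sum>p\<in>?P. (1 / N) * (\<Sum>i\<in>UNIV. l $ p i))"
    unfolding a_def by (simp add: permute_coords_def sum_distrib_left) (rule sum.swap)
  also have "\<dots> = (\<Sum>p\<in>?P. (1 / N) * (\<Sum>i\<in>UNIV. l $ i))"
    by (intro sum.cong) (auto simp: sum.permute[symmetric, unfolded o_def])
  also have "\<dots> \<le> 0" using neg N by (simp add: N_def mult_le_0_iff divide_le_0_iff)
  finally have "c \<le> 0" by (simp add: mult_le_0_iff)
  show False
  proof (cases "c = 0")
    case True
    then have "a = 0" using a by (simp add: vec_eq_iff)
    then show False using \<open>a \<in> S\<close> assms(4) by simp
  next
    case False
    then have "- a \<in> S" using a \<open>c \<le> 0\<close> assms(3) by (auto simp: pos_cone_def)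
    then have "(1/2) *\<^sub>R a + (1/2) *\<^sub>R (- a) \<in> S"
      using \<open>a \<in> S\<close> assms(1) by (intro convexD) auto
    then show False using assms(4) by simp
  qed
qed

lemma zero_notin_Gamma_cone:
  assumes "k \<noteq> 0"
  shows "(0 :: real^'n) \<notin> Gamma_cone k"
proof -
  have "sigma k (0 :: real^'n) = 0"
    unfolding sigma_def using assms
    by (intro sum.neutral) (auto intro!: prod_zero simp: card_gt_0_iff[symmetric] elim!: card_ge_0_finite)
  then show ?thesis
    unfolding Gamma_cone_def by (auto dest: connected_component_in)
qed

lemma eigenvalues_of_orthogonal_conjugate:
  fixes A R :: "real^'n^'n"
  assumes "orthogonal_matrix R" "eigenvalues_of A l"
  shows "eigenvalues_of (transpose R ** A ** R) l"
  unfolding eigenvalues_of_def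
proof
  fix t
  have diff: "X ** (Y - Z) = X ** Y - X ** Z" "(Y - Z) ** X = Y ** X - Z ** X" for X Y Z :: "real^'n^'n"
    by (simp_all add: matrix_matrix_mult_def vec_eq_iff algebra_simps sum_subtractf)
  have "transpose R ** mat t = t *\<^sub>R transpose R"
    by (simp add: matrix_matrix_mult_def mat_def vec_eq_iff if_distrib mult.commute cong: if_cong)
  moreover have "(t *\<^sub>R transpose R) ** R = t *\<^sub>R (transpose R ** R)"
    by (simp add: matrix_matrix_mult_def vec_eq_iff sum_distrib_left mult.assoc)
  moreover have "t *\<^sub>R (mat 1 :: real^'n^'n) = mat t" by (simp add: mat_def vec_eq_iff)
  ultimately have "transpose R ** mat t ** R = mat t"
    using assms(1) by (simp add: orthogonal_matrix_def)
  then have "mat t - transpose R ** A ** R = transpose R ** (mat t - A) ** R"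
    by (simp add: diff)
  then have "det (mat t - transpose R ** A ** R) = (det R * det R) * det (mat t - A)"
    by (simp add: det_mul det_transpose)
  moreover have "det R * det R = 1"
    using det_orthogonal_matrix[OF assms(1)] by auto
  ultimately show "det (mat t - transpose R ** A ** R) = (\<Prod>i\<in>UNIV. t - l $ i)"
    using assms(2) by (simp add: eigenvalues_of_def)
qed

lemma eigenvalues_of_scalar_matrix:
  assumes "eigenvalues_of (c *\<^sub>R mat 1 :: real^'n^'n) l"
  shows "l = c *\<^sub>R 1"
proof -
  have "l $ i = c" for i
  proof -
    have "det (mat (l $ i) - c *\<^sub>R mat 1 :: real^'n^'n) = 0"
      using assms unfolding eigenvalues_of_def by (auto intro: prod_zero)
    moreover have "det (mat (l $ i) - c *\<^sub>R mat 1 :: real^'n^'n) = (l $ i - c) ^ CARD('n)"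
      by (subst det_diagonal) (auto simp: mat_def)
    ultimately show ?thesis by simp
  qed
  then show ?thesis by (simp add: vec_eq_iff)
qed

section \<open>The level set as a set of symmetric matrices, and its ellipticity\<close>

definition level_matrices :: "(real^'n) set \<Rightarrow> (real^'n \<Rightarrow> real) \<Rightarrow> (real^'n^'n) set" where
  "level_matrices \<Gamma> f = {A. transpose A = A \<and> (\<exists>l. eigenvalues_of A l \<and> l \<in> \<Gamma> \<and> f l = 1)}"

lemma level_matrices_eigenframe:
  assumes "symmetric_set \<Gamma>" "symmetric_fun_on \<Gamma> f" "A \<in> level_matrices \<Gamma> f"
  obtains l v where "eigenframe A l v" "decreasing l" "l \<in> \<Gamma>" "f l = 1"
proof -
  obtain l where l: "transpose A = A" "eigenvalues_of A l" "l \<in> \<Gamma>" "f l = 1"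
    using assms(3) by (auto simp: level_matrices_def)
  obtain p v where p: "p permutes UNIV" "eigenframe A (permute_coords p l) v" "decreasing (permute_coords p l)"
    using eigenvalues_of_decreasing_eigenframe[OF l(1,2)] by blast
  show thesis
    by (rule that[OF p(2,3)])
      (use assms(1,2) p(1) l(3,4) in \<open>auto simp: symmetric_set_def symmetric_fun_on_def\<close>)
qed

lemma exists_decreasing_eigenframe:
  assumes "transpose A = A"
  obtains l v where "eigenframe A l v" "decreasing l"
proof -
  obtain m w where "eigenframe A m w" using exists_eigenframe[OF assms] by blast
  then show thesis
    using eigenvalues_of_decreasing_eigenframe[OF assms eigenframe_eigenvalues_of] that by metis
qed

text \<open>\<open>E_elliptic\<close> is a derivative-free form of local uniform ellipticity: only
  \<open>A\<close> has to be near \<open>A0\<close>, while \<open>B\<close> is arbitrary in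
  \<open>E\<close>. A gain \<open>t\<close> in one direction \<open>\<nu>\<close>, up to an error
  \<open>s\<close> in all directions, must satisfy \<open>t \<le> K * s\<close>. This is the shape
  of inequality that an exponential barrier produces at a touching point.\<close>

locale elliptic_matrices =
  fixes E :: "(real^'n^'n) set"
  assumes E_trace: "A \<in> E \<Longrightarrow> trace A > 0"
    and E_conjugate: "A \<in> E \<Longrightarrow> orthogonal_matrix R \<Longrightarrow> transpose R ** A ** R \<in> E"
    and E_elliptic: "A0 \<in> E \<Longrightarrow> \<exists>\<delta>>0. \<exists>K>0. \<forall>A\<in>E. \<forall>B\<in>E. \<forall>s t \<nu>.
      (\<forall>x. \<bar>x \<bullet> ((A - A0) *v x)\<bar> \<le> \<delta> * (x \<bullet> x)) \<longrightarrow>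
      0 \<le> s \<and> s \<le> \<delta> \<and> 0 \<le> t \<and> t \<le> \<delta> \<and> norm \<nu> = 1 \<longrightarrow>
      (\<forall>x. x \<bullet> (A *v x) + t * (\<nu> \<bullet> x)\<^sup>2 - s * (x \<bullet> x) \<le> x \<bullet> (B *v x)) \<longrightarrow> t \<le> K * s"

lemma outer_mult_vector: "outer v w *v x = (w \<bullet> x) *\<^sub>R v"
  by (simp add: outer_def matrix_vector_mult_def vec_eq_iff inner_vec_def mult.commute mult.left_commute
      sum_distrib_left[symmetric])

lemma inner_scaleR_one: "g \<bullet> (s *\<^sub>R (1 :: real^'n)) = s * (\<Sum>i\<in>UNIV. g $ i)"
  by (simp add: inner_vec_def sum_distrib_left mult.commute)

lemma inner_le_sum_coords:
  fixes g d :: "real^'n"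
  assumes "\<And>i. c \<le> g $ i" "\<And>i. 0 \<le> d $ i"
  shows "c * (\<Sum>i\<in>UNIV. d $ i) \<le> g \<bullet> d"
  unfolding inner_vec_def sum_distrib_left by (intro sum_mono) (simp add: mult_right_mono assms)

text \<open>Weyl's comparison keeps the eigenvalues \<open>m\<close> of
  \<open>P = A + t \<nu>\<nu>^T - s I\<close> near those of \<open>A0\<close> and below those of
  \<open>B\<close>, so \<open>f m \<le> 1\<close> by monotonicity of \<open>f\<close>. Near
  \<open>l0\<close> the partial derivatives lie between \<open>c\<close> and \<open>C\<close>, and
  the trace of \<open>P - A\<close> is \<open>t - n s\<close>; hence \<open>c t\<close> cannot
  exceed \<open>n C s\<close>.\<close>

lemma elliptic_level_matrices:
  fixes \<Gamma> :: "(real^'n) set"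
  assumes "open \<Gamma>" "convex \<Gamma>" "symmetric_set \<Gamma>" "pos_cone \<subseteq> \<Gamma>" "0 \<notin> \<Gamma>"
    and fsym: "symmetric_fun_on \<Gamma> f"
    and fdiff: "f differentiable_on \<Gamma>" and fcont: "\<And>i. continuous_on \<Gamma> (partial_deriv i f)"
    and fpos: "\<And>i l. l \<in> \<Gamma> \<Longrightarrow> partial_deriv i f l > 0"
  shows "elliptic_matrices (level_matrices \<Gamma> f)"
proof
  have der: "(f has_derivative (\<lambda>v. grad f l \<bullet> v)) (at l)" if "l \<in> \<Gamma>" for l
    using has_derivative_grad fdiff that assms(1) by (metis at_within_open differentiable_on_def)
  note frame = level_matrices_eigenframe[OF assms(3) fsym]
  show "trace A > 0" if A: "A \<in> level_matrices \<Gamma> f" for A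
    by (rule frame[OF A]) (use sum_coords_pos[OF assms(2-5)] eigenframe_trace in metis)
  show "transpose R ** A ** R \<in> level_matrices \<Gamma> f"
    if "A \<in> level_matrices \<Gamma> f" "orthogonal_matrix R" for A R
    using that eigenvalues_of_orthogonal_conjugate
    by (auto simp: level_matrices_def matrix_transpose_mul matrix_mul_assoc)
  fix A0 assume A0: "A0 \<in> level_matrices \<Gamma> f"
  obtain l0 v0 where l0: "eigenframe A0 l0 v0" "decreasing l0" "l0 \<in> \<Gamma>" "f l0 = 1"
    by (rule frame[OF A0])
  define c where "c = Min (range (\<lambda>i. partial_deriv i f l0)) / 2"
  define C where "C = Max (range (\<lambda>i. partial_deriv i f l0)) + 1"
  have c: "c > 0" unfolding c_def using fpos[OF l0(3)] by auto
  have "\<forall>\<^sub>F l in nhds l0. c < partial_deriv i f l \<and> partial_deriv i f l < C" for i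
  proof -
    have "Min (range (\<lambda>i. partial_deriv i f l0)) \<le> partial_deriv i f l0"
      "partial_deriv i f l0 \<le> Max (range (\<lambda>i. partial_deriv i f l0))" by auto
    then have "c < partial_deriv i f l0" "partial_deriv i f l0 < C"
      using c unfolding c_def C_def by linarith+
    moreover have "(partial_deriv i f \<longlongrightarrow> partial_deriv i f l0) (nhds l0)"
      using fcont[of i] l0(3) assms(1)
      by (simp add: continuous_on_eq_continuous_at isCont_def tendsto_at_iff_tendsto_nhds)
    ultimately show ?thesis by (intro eventually_conj order_tendstoD)
  qed
  then have "\<forall>\<^sub>F l in nhds l0. \<forall>i. c < partial_deriv i f l \<and> partial_deriv i f l < C"
    by (simp add: eventually_all_finite)
  moreover have "\<forall>\<^sub>F l in nhds l0. l \<in> \<Gamma>"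
    using assms(1) l0(3) by (rule eventually_nhds_in_open)
  ultimately have "\<forall>\<^sub>F l in nhds l0. (\<forall>i. c < partial_deriv i f l \<and> partial_deriv i f l < C) \<and> l \<in> \<Gamma>"
    by (rule eventually_conj)
  then obtain r where r': "r > 0"
    "\<forall>l. dist l l0 < r \<longrightarrow> (\<forall>i. c < partial_deriv i f l \<and> partial_deriv i f l < C) \<and> l \<in> \<Gamma>"
    unfolding eventually_nhds_metric by blast
  then have r: "r > 0" "\<And>l. dist l l0 < r \<Longrightarrow> l \<in> \<Gamma> \<and> (\<forall>i. c < partial_deriv i f l \<and> partial_deriv i f l < C)"
    by blast+
  have "c < partial_deriv undefined f l0 \<and> partial_deriv undefined f l0 < C"
    using r(2)[of l0] r(1) by simp
  then have C: "C > 0" using c by linarith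
  \<comment> \<open>Half-side of a cube around \<open>l0\<close> that fits into the ball of radius
    \<open>r\<close>; the \<open>+ 1\<close> makes the inclusion strict.\<close>
  define \<eta> where "\<eta> = r / (real CARD('n) + 1)"
  have \<eta>: "\<eta> > 0" using r by (simp add: \<eta>_def add_nonneg_pos)
  have cube: "l \<in> ball l0 r" if "\<And>i. \<bar>l $ i - l0 $ i\<bar> \<le> \<eta>" for l
  proof -
    have "norm (l - l0) \<le> (\<Sum>i\<in>UNIV. \<bar>(l - l0) $ i\<bar>)" by (rule norm_le_l1_cart)
    also have "\<dots> \<le> (\<Sum>i\<in>(UNIV :: 'n set). \<eta>)" using that by (intro sum_mono) auto
    also have "\<dots> < r" using r(1) by (simp add: \<eta>_def divide_simps)
    finally show ?thesis by (simp add: dist_norm norm_minus_commute)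
  qed
  show "\<exists>\<delta>>0. \<exists>K>0. \<forall>A\<in>level_matrices \<Gamma> f. \<forall>B\<in>level_matrices \<Gamma> f. \<forall>s t \<nu>.
      (\<forall>x. \<bar>x \<bullet> ((A - A0) *v x)\<bar> \<le> \<delta> * (x \<bullet> x)) \<longrightarrow>
      0 \<le> s \<and> s \<le> \<delta> \<and> 0 \<le> t \<and> t \<le> \<delta> \<and> norm \<nu> = 1 \<longrightarrow>
      (\<forall>x. x \<bullet> (A *v x) + t * (\<nu> \<bullet> x)\<^sup>2 - s * (x \<bullet> x) \<le> x \<bullet> (B *v x)) \<longrightarrow> t \<le> K * s"
  \<comment> \<open>Half of \<open>\<eta>\<close> is spent on the distance from \<open>A\<close> to
    \<open>A0\<close>, the other half on the perturbation by \<open>s\<close> and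
    \<open>t\<close>.\<close>
  proof (rule exI[of _ "\<eta>/2"], rule conjI, goal_cases)
    case 2
    show ?case
    proof (rule exI[of _ "real CARD('n) * C / c"], intro conjI ballI allI impI; (elim conjE)?)
    show "real CARD('n) * C / c > 0" using C c by simp
    fix A B s t \<nu>
    assume A: "A \<in> level_matrices \<Gamma> f" and B: "B \<in> level_matrices \<Gamma> f"
      and near: "\<forall>x. \<bar>x \<bullet> ((A - A0) *v x)\<bar> \<le> \<eta>/2 * (x \<bullet> x)"
      and st: "0 \<le> s" "s \<le> \<eta>/2" "0 \<le> t" "t \<le> \<eta>/2" and \<nu>: "norm \<nu> = 1"
      and le: "\<forall>x. x \<bullet> (A *v x) + t * (\<nu> \<bullet> x)\<^sup>2 - s * (x \<bullet> x) \<le> x \<bullet> (B *v x)"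
    obtain l v where l: "eigenframe A l v" "decreasing l" "l \<in> \<Gamma>" "f l = 1" by (rule frame[OF A])
    obtain k w where k: "eigenframe B k w" "decreasing k" "k \<in> \<Gamma>" "f k = 1" by (rule frame[OF B])
    define P where "P = A + t *\<^sub>R outer \<nu> \<nu> - s *\<^sub>R mat 1"
    have Px: "x \<bullet> (P *v x) = x \<bullet> (A *v x) + t * (\<nu> \<bullet> x)\<^sup>2 - s * (x \<bullet> x)" for x
      unfolding P_def
      by (simp add: matrix_vector_mult_add_rdistrib matrix_vector_mult_diff_rdistrib scaleR_matrix_vector_assoc[symmetric]
          outer_mult_vector inner_simps power2_eq_square inner_commute)
    have "transpose A = A" using A by (simp add: level_matrices_def)
    then have "transpose P = P"
      by (simp add: P_def transpose_def outer_def mat_def vec_eq_iff mult.commute)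
    then obtain m z where m: "eigenframe P m z" "decreasing m"
      by (rule exists_decreasing_eigenframe)
    have nx: "(\<nu> \<bullet> x)\<^sup>2 \<le> x \<bullet> x" for x
      using Cauchy_Schwarz_ineq[of \<nu> x] \<nu> by (simp add: norm_eq_1)
    have form: "\<bar>x \<bullet> (A *v x) - x \<bullet> (A0 *v x)\<bar> \<le> \<eta>/2 * (x \<bullet> x)" for x
      using near by (simp add: matrix_vector_mult_diff_rdistrib inner_diff_right)
    have l_l0: "\<bar>l $ i - l0 $ i\<bar> \<le> \<eta>/2" for i
    proof -
      have "x \<bullet> (A *v x) \<le> x \<bullet> (A0 *v x) + \<eta>/2 * (x \<bullet> x)"
        "x \<bullet> (A0 *v x) \<le> x \<bullet> (A *v x) + \<eta>/2 * (x \<bullet> x)" for x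
        using form[of x] by linarith+
      from weyl_monotonicity[OF l(1,2) l0(1,2) this(1), of i] weyl_monotonicity[OF l0(1,2) l(1,2) this(2), of i]
      show ?thesis by linarith
    qed
    have l_m: "l $ i \<le> m $ i + s" for i
      using weyl_monotonicity[OF l(1,2) m, of s i] Px st(3) by (simp add: mult_nonneg_nonneg)
    have m_l: "m $ i \<le> l $ i + t" for i
    proof (rule weyl_monotonicity[OF m l(1,2)])
      fix x
      have "0 \<le> s * (x \<bullet> x)" "t * (\<nu> \<bullet> x)\<^sup>2 \<le> t * (x \<bullet> x)" using st nx by (auto intro: mult_left_mono)
      then show "x \<bullet> (P *v x) \<le> x \<bullet> (A *v x) + t * (x \<bullet> x)" unfolding Px by linarith
    qed
    have m_k: "m $ i \<le> k $ i" for i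
      using weyl_monotonicity[OF m k(1,2), of 0 i] Px le by simp
    have sum_m: "(\<Sum>i\<in>UNIV. m $ i) = (\<Sum>i\<in>UNIV. l $ i) + t - real CARD('n) * s"
    proof -
      have "trace (outer \<nu> \<nu>) = \<nu> \<bullet> \<nu>" by (simp add: trace_def outer_def inner_vec_def)
      then have "trace P = trace A + t - real CARD('n) * s"
        using \<nu> by (simp add: P_def norm_eq_1 trace_def sum.distrib sum_subtractf sum_distrib_left[symmetric] mat_def)
      then show ?thesis using eigenframe_trace[OF m(1)] eigenframe_trace[OF l(1)] by simp
    qed
    have "\<bar>l $ i - l0 $ i\<bar> \<le> \<eta>" for i using l_l0[of i] \<eta> by linarith
    then have "l \<in> ball l0 r" by (rule cube)
    moreover have "\<bar>m $ i - l0 $ i\<bar> \<le> \<eta>" for i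
      using l_l0[of i] l_m[of i] m_l[of i] st by linarith
    then have "m \<in> ball l0 r" by (rule cube)
    ultimately have seg: "closed_segment l m \<subseteq> ball l0 r"
      by (simp add: closed_segment_subset)
    have m\<Gamma>: "m \<in> \<Gamma>" using \<open>m \<in> ball l0 r\<close> r(2) by (simp add: dist_commute)
    obtain \<xi> where \<xi>: "\<xi> \<in> closed_segment m k" "f k - f m = grad f \<xi> \<bullet> (k - m)"
      using mean_value_grad[OF assms(2) der m\<Gamma> k(3)] by auto
    have "\<xi> \<in> \<Gamma>" using \<xi>(1) m\<Gamma> k(3) assms(2) by (meson closed_segment_subset subsetD)
    then have "0 \<le> grad f \<xi> \<bullet> (k - m)"
      using inner_le_sum_coords[of 0 "grad f \<xi>" "k - m"] fpos m_k by (simp add: grad_def less_imp_le)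
    with \<xi>(2) have "f m \<le> f k" by simp
    obtain \<zeta> where \<zeta>: "\<zeta> \<in> closed_segment l m" "f m - f l = grad f \<zeta> \<bullet> (m - l)"
      using mean_value_grad[OF assms(2) der l(3) m\<Gamma>] by auto
    then have g: "c \<le> grad f \<zeta> $ i" "grad f \<zeta> $ i \<le> C" for i
      using r(2)[of \<zeta>] seg by (auto simp: grad_def dist_commute less_imp_le subset_iff)
    \<comment> \<open>The shift by \<open>s\<close> makes every increment nonnegative, so the lower
      bound \<open>c\<close> applies, and the shifted increments add up to exactly
      \<open>t\<close>.\<close>
    have "c * (\<Sum>i\<in>UNIV. (m - l + s *\<^sub>R 1) $ i) \<le> grad f \<zeta> \<bullet> (m - l + s *\<^sub>R 1)"
      using l_m by (intro inner_le_sum_coords g) (simp add: algebra_simps)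
    also have "\<dots> = f m - f l + s * (\<Sum>i\<in>UNIV. grad f \<zeta> $ i)"
      unfolding \<zeta>(2) by (simp only: inner_add_right inner_scaleR_one)
    also have "\<dots> \<le> 0 + s * (\<Sum>i\<in>(UNIV :: 'n set). C)"
      using st(1) g(2) \<open>f m \<le> f k\<close> l(4) k(4) by (intro add_mono mult_left_mono sum_mono) auto
    finally have "c * t \<le> real CARD('n) * C * s"
      using sum_m by (simp add: sum.distrib sum_subtractf algebra_simps)
    then show "t \<le> real CARD('n) * C / c * s" using c by (simp add: field_simps)
    qed
  qed (use \<eta> in simp)
qed

text \<open>\<open>f\<close> is strictly increasing along the diagonal, and the segment between the
  two diagonal points stays in \<open>\<Gamma>\<close>.\<close>

lemma scalar_level_matrix_unique:
  fixes \<Gamma> :: "(real^'n) set"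
  assumes "open \<Gamma>" "convex \<Gamma>" "pos_cone \<subseteq> \<Gamma>" "f differentiable_on \<Gamma>"
    and fpos: "\<And>i l. l \<in> \<Gamma> \<Longrightarrow> partial_deriv i f l > 0"
    and A: "c *\<^sub>R mat 1 \<in> level_matrices \<Gamma> f" and b: "b > 0" "f (b *\<^sub>R 1) = 1"
  shows "c = b"
proof -
  have der: "(f has_derivative (\<lambda>v. grad f l \<bullet> v)) (at l)" if "l \<in> \<Gamma>" for l
    using has_derivative_grad assms(1,4) that by (metis at_within_open differentiable_on_def)
  obtain l where "eigenvalues_of (c *\<^sub>R mat 1 :: real^'n^'n) l" "l \<in> \<Gamma>" "f l = 1"
    using A by (auto simp: level_matrices_def)
  then have c: "c *\<^sub>R 1 \<in> \<Gamma>" "f (c *\<^sub>R 1) = 1"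
    using eigenvalues_of_scalar_matrix by blast+
  have "b *\<^sub>R 1 \<in> \<Gamma>" using b(1) assms(3) by (auto simp: pos_cone_def)
  then obtain \<xi> where \<xi>: "\<xi> \<in> closed_segment (c *\<^sub>R 1) (b *\<^sub>R 1)" "f (b *\<^sub>R 1) - f (c *\<^sub>R 1) = grad f \<xi> \<bullet> (b *\<^sub>R 1 - c *\<^sub>R 1)"
    using mean_value_grad[OF assms(2) der c(1)] by blast
  have "\<xi> \<in> \<Gamma>" using \<xi>(1) c(1) \<open>b *\<^sub>R 1 \<in> \<Gamma>\<close> assms(2) by (meson closed_segment_subset subsetD)
  then have "0 < (\<Sum>i\<in>UNIV. grad f \<xi> $ i)" using fpos by (intro sum_pos) (auto simp: grad_def)
  moreover have "(b - c) * (\<Sum>i\<in>UNIV. grad f \<xi> $ i) = 0"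
    using \<xi>(2) b(2) c(2) inner_scaleR_one[of "grad f \<xi>" "b - c"] by (simp add: scaleR_left_diff_distrib)
  ultimately show ?thesis by auto
qed

section \<open>Twice continuously differentiable functions\<close>

text \<open>Gradient and Hessian are carried as explicit functions, so that powers, barriers and
  Kelvin transforms come with computable formulas. Symmetry of \<open>H\<close> is a consequence,
  proved below for functions on the whole space.\<close>

definition C2_data :: "(real^'n) set \<Rightarrow> (real^'n \<Rightarrow> real) \<Rightarrow> (real^'n \<Rightarrow> real^'n) \<Rightarrow> (real^'n \<Rightarrow> real^'n^'n) \<Rightarrow> bool" where
  "C2_data S w G H \<longleftrightarrow> open S \<and> continuous_on S H \<and>
    (\<forall>x\<in>S. (w has_derivative (\<lambda>v. G x \<bullet> v)) (at x) \<and> (G has_derivative (\<lambda>v. H x *v v)) (at x))"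

lemma C2_dataD:
  assumes "C2_data S w G H"
  shows "open S" "continuous_on S H" "continuous_on S w" "continuous_on S G"
    "\<And>x. x \<in> S \<Longrightarrow> (w has_derivative (\<lambda>v. G x \<bullet> v)) (at x)"
    "\<And>x. x \<in> S \<Longrightarrow> (G has_derivative (\<lambda>v. H x *v v)) (at x)"
proof -
  show w: "\<And>x. x \<in> S \<Longrightarrow> (w has_derivative (\<lambda>v. G x \<bullet> v)) (at x)"
    and G: "\<And>x. x \<in> S \<Longrightarrow> (G has_derivative (\<lambda>v. H x *v v)) (at x)"
    and "open S" "continuous_on S H"
    using assms by (auto simp: C2_data_def)
  show "continuous_on S w" "continuous_on S G"
    by (auto intro!: continuous_at_imp_continuous_on has_derivative_continuous[OF w] has_derivative_continuous[OF G])
qed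

lemma C2_data_subset: "C2_data S w G H \<Longrightarrow> open T \<Longrightarrow> T \<subseteq> S \<Longrightarrow> C2_data T w G H"
  by (auto simp: C2_data_def intro: continuous_on_subset)

lemma C2_data_add:
  assumes "C2_data S v G H" "C2_data S w G' H'"
  shows "C2_data S (\<lambda>x. v x + w x) (\<lambda>x. G x + G' x) (\<lambda>x. H x + H' x)"
  using assms
  by (auto simp: C2_data_def inner_add_left matrix_vector_mult_add_rdistrib intro!: has_derivative_add continuous_on_add)

lemma C2_data_scale:
  assumes "C2_data S w G H"
  shows "C2_data S (\<lambda>x. c * w x) (\<lambda>x. c *\<^sub>R G x) (\<lambda>x. c *\<^sub>R H x)"
  using assms
  by (auto simp: C2_data_def scaleR_matrix_vector_assoc[symmetric]
      intro!: has_derivative_mult_right has_derivative_scaleR_right continuous_intros)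

lemma C2_data_diff:
  assumes "C2_data S v G H" "C2_data S w G' H'"
  shows "C2_data S (\<lambda>x. v x - w x) (\<lambda>x. G x - G' x) (\<lambda>x. H x - H' x)"
  using C2_data_add[OF assms(1) C2_data_scale[OF assms(2), of "-1"]] by simp

lemma C2_data_const: "open S \<Longrightarrow> C2_data S (\<lambda>x. c) (\<lambda>x. 0) (\<lambda>x. 0)"
  by (auto simp: C2_data_def)

lemma C2_data_linear: "open S \<Longrightarrow> C2_data S (\<lambda>x. p \<bullet> x) (\<lambda>x. p) (\<lambda>x. 0)"
  by (auto simp: C2_data_def intro!: derivative_eq_intros)

lemma C2_data_dist_square:
  "open S \<Longrightarrow> C2_data S (\<lambda>x. (x - z) \<bullet> (x - z)) (\<lambda>x. 2 *\<^sub>R (x - z)) (\<lambda>x. 2 *\<^sub>R mat 1)"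
  by (auto simp: C2_data_def scaleR_matrix_vector_assoc[symmetric] algebra_simps inner_commute
      intro!: derivative_eq_intros)

lemma C2_data_translate:
  assumes "C2_data UNIV w G H"
  shows "C2_data UNIV (\<lambda>x. w (a + x)) (\<lambda>x. G (a + x)) (\<lambda>x. H (a + x))"
proof -
  have shift: "((\<lambda>x. a + x) has_derivative (\<lambda>v. v)) (at x)" for x
    by (auto intro!: derivative_eq_intros)
  show ?thesis
    unfolding C2_data_def
    using C2_dataD[OF assms]
    by (auto intro!: has_derivative_compose[OF shift] continuous_on_compose2[of UNIV H] continuous_intros)
qed

lemma continuous_on_outer:
  assumes "continuous_on S F" "continuous_on S G"
  shows "continuous_on S (\<lambda>x. outer (F x) (G x))"
  unfolding outer_def by (intro continuous_intros assms)

lemma C2_data_compose: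
  assumes w: "C2_data S w G H"
    and h: "\<And>x. x \<in> S \<Longrightarrow> (h has_real_derivative h1 (w x)) (at (w x))"
    and h1: "\<And>x. x \<in> S \<Longrightarrow> (h1 has_real_derivative h2 (w x)) (at (w x))"
    and h2: "continuous_on (w ` S) h2"
  shows "C2_data S (\<lambda>x. h (w x)) (\<lambda>x. h1 (w x) *\<^sub>R G x) (\<lambda>x. h1 (w x) *\<^sub>R H x + h2 (w x) *\<^sub>R outer (G x) (G x))"
proof -
  note D = C2_dataD[OF w]
  have h1c: "continuous_on (w ` S) h1"
    using h1 by (auto intro!: continuous_at_imp_continuous_on DERIV_isCont)
  have comp: "((\<lambda>x. k (w x)) has_derivative (\<lambda>v. k' * (G x \<bullet> v))) (at x)"
    if "x \<in> S" "(k has_real_derivative k') (at (w x))" for x k k'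
    using has_derivative_compose[OF D(5)[OF that(1)] that(2)[unfolded has_field_derivative_def]] .
  show ?thesis
    unfolding C2_data_def
  proof (intro conjI ballI)
    show "open S" by (rule D)
    show "continuous_on S (\<lambda>x. h1 (w x) *\<^sub>R H x + h2 (w x) *\<^sub>R outer (G x) (G x))"
      by (intro continuous_intros continuous_on_outer D continuous_on_compose2[OF h1c] continuous_on_compose2[OF h2]) auto
    fix x assume x: "x \<in> S"
    show "((\<lambda>x. h (w x)) has_derivative (\<lambda>v. (h1 (w x) *\<^sub>R G x) \<bullet> v)) (at x)"
      using comp[OF x h[OF x]] by simp
    have "((\<lambda>x. h1 (w x) *\<^sub>R G x) has_derivative (\<lambda>v. h1 (w x) *\<^sub>R (H x *v v) + (h2 (w x) * (G x \<bullet> v)) *\<^sub>R G x)) (at x)"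
      by (rule has_derivative_scaleR[OF comp[OF x h1[OF x]] D(6)[OF x]])
    then show "((\<lambda>x. h1 (w x) *\<^sub>R G x) has_derivative (*v) (h1 (w x) *\<^sub>R H x + h2 (w x) *\<^sub>R outer (G x) (G x))) (at x)"
      by (rule has_derivative_eq_rhs)
        (simp add: fun_eq_iff matrix_vector_mult_add_rdistrib scaleR_matrix_vector_assoc[symmetric] outer_mult_vector)
  qed
qed

text \<open>If the form of \<open>H q\<close> were negative along \<open>v\<close>, the derivative
  along the ray would be negative right after \<open>q\<close>, and the mean value theorem would
  give a value of \<open>w\<close> below the minimum.\<close>

lemma local_min_second_order:
  assumes "C2_data S w G H" "q \<in> S" and min: "\<And>x. x \<in> S \<Longrightarrow> w q \<le> w x"
  shows "G q = 0" "0 \<le> v \<bullet> (H q *v v)"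
proof -
  note D = C2_dataD[OF assms(1)]
  have "(\<lambda>v. G q \<bullet> v) = (\<lambda>v. 0)"
    by (rule differential_zero_maxmin[OF assms(2) D(1) D(5)[OF assms(2)]]) (use min in auto)
  then show G0: "G q = 0" by (metis inner_eq_zero_iff)
  show "0 \<le> v \<bullet> (H q *v v)"
  proof (rule ccontr)
    assume "\<not> 0 \<le> v \<bullet> (H q *v v)"
    then have neg: "v \<bullet> (H q *v v) < 0" by simp
    have line: "((\<lambda>t. q + t *\<^sub>R v) has_derivative (\<lambda>h. h *\<^sub>R v)) (at t)" for t
      by (auto intro!: derivative_eq_intros)
    obtain e where e: "e > 0" "ball q e \<subseteq> S"
      using D(1) assms(2) open_contains_ball by blast
    have "((\<lambda>t. G (q + t *\<^sub>R v) \<bullet> v) has_derivative (\<lambda>h. (H q *v (h *\<^sub>R v)) \<bullet> v)) (at 0)"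
      using has_derivative_compose[OF line[of 0], of G "\<lambda>x. H q *v x"] D(6)[OF assms(2)]
      by (auto intro!: has_derivative_inner_left)
    then have "((\<lambda>t. G (q + t *\<^sub>R v) \<bullet> v) has_real_derivative v \<bullet> (H q *v v)) (at 0)"
      by (simp add: has_field_derivative_def matrix_vector_mult_scaleR inner_commute mult_commute_abs)
    from DERIV_neg_dec_right[OF this neg] obtain d where d: "d > 0"
      "\<And>h. 0 < h \<Longrightarrow> h < d \<Longrightarrow> G (q + h *\<^sub>R v) \<bullet> v < 0"
      using G0 by auto
    \<comment> \<open>The first bound stays where the directional derivative is negative, the second
      keeps the segment in \<open>S\<close>; the \<open>+ 1\<close> keeps the denominator
      positive.\<close>
    define b where "b = min (d / 2) (e / (2 * (norm v + 1)))"
    have b: "0 < b" "b < d" using d(1) e(1) by (auto simp: b_def add_nonneg_pos)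
    have inS: "q + t *\<^sub>R v \<in> S" if "0 \<le> t" "t \<le> b" for t
    proof -
      have "t * norm v \<le> b * (norm v + 1)" using that by (intro mult_mono) auto
      also have "\<dots> \<le> (e / (2 * (norm v + 1))) * (norm v + 1)"
        by (intro mult_right_mono) (auto simp: b_def)
      also have "\<dots> = e / 2"
      proof -
        have "(e / (2 * n)) * n = e / 2" if "n \<noteq> 0" for n :: real using that by simp
        moreover have "norm v + 1 \<noteq> 0" using norm_ge_zero[of v] by linarith
        ultimately show ?thesis by blast
      qed
      also have "\<dots> < e" using e(1) by simp
      finally show ?thesis using that e(2) by (auto simp: dist_norm subset_iff)
    qed
    have der: "((\<lambda>t. w (q + t *\<^sub>R v)) has_derivative (\<lambda>h. G (q + t *\<^sub>R v) \<bullet> (h *\<^sub>R v))) (at t within {0..b})"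
      if "0 \<le> t" "t \<le> b" for t
      by (rule has_derivative_at_withinI, rule has_derivative_compose[OF line D(5)[OF inS[OF that]]])
    obtain t where t: "t \<in> {0<..<b}" "w (q + b *\<^sub>R v) - w (q + 0 *\<^sub>R v) = G (q + t *\<^sub>R v) \<bullet> ((b - 0) *\<^sub>R v)"
      using mvt_simple[OF b(1) der] by auto
    then have "w (q + b *\<^sub>R v) - w q = b * (G (q + t *\<^sub>R v) \<bullet> v)" by simp
    also have "\<dots> < 0" using t(1) d(2)[of t] b by (intro mult_pos_neg) auto
    finally show False using min[OF inS[of b]] b by simp
  qed
qed

text \<open>\<open>norm M\<close> is the Frobenius norm; Cauchy-Schwarz is applied to each
  row.\<close>

lemma norm_matrix_vector_mult_le:
  fixes M :: "real^'n^'m"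
  shows "norm (M *v x) \<le> norm M * norm x"
proof -
  have "norm (M *v x) = L2_set (\<lambda>i. \<bar>M $ i \<bullet> x\<bar>) UNIV"
    by (simp add: norm_vec_def matrix_vector_mul_component)
  also have "\<dots> \<le> L2_set (\<lambda>i. norm (M $ i) * norm x) UNIV"
    by (intro L2_set_mono) (auto simp: Cauchy_Schwarz_ineq2)
  also have "\<dots> = norm M * norm x"
    by (simp add: norm_vec_def[of M] L2_set_left_distrib[symmetric])
  finally show ?thesis .
qed

lemma abs_matrix_form_le:
  fixes M :: "real^'n^'n"
  shows "\<bar>x \<bullet> (M *v x)\<bar> \<le> norm M * (x \<bullet> x)"
proof -
  have "\<bar>x \<bullet> (M *v x)\<bar> \<le> norm x * norm (M *v x)" by (rule Cauchy_Schwarz_ineq2)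
  also have "\<dots> \<le> norm x * (norm M * norm x)"
    by (intro mult_left_mono norm_matrix_vector_mult_le) auto
  finally show ?thesis by (simp add: power2_norm_eq_inner[symmetric] power2_eq_square mult_ac)
qed

section \<open>Traces, and the matrix of the equation in terms of \<open>w\<close>\<close>

lemma trace_eq_sum_forms: "trace M = (\<Sum>i\<in>UNIV. axis i 1 \<bullet> (M *v axis i 1))"
  for M :: "real^'n^'n"
  by (simp add: trace_def matrix_vector_mult_basis inner_axis' column_def)

lemma trace_add: "trace (A + B) = trace A + trace (B :: real^'n^'n)"
  and trace_diff: "trace (A - B) = trace A - trace B"
  and trace_scaleR: "trace (c *\<^sub>R A) = c * trace A"
  and trace_outer: "trace (outer v v) = v \<bullet> v"
  and trace_mat1: "trace (mat 1 :: real^'n^'n) = real CARD('n)"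
  by (simp_all add: trace_def sum.distrib sum_subtractf sum_distrib_left outer_def inner_vec_def mat_def)

definition conf_matrix :: "real \<Rightarrow> real^'n \<Rightarrow> real^'n^'n \<Rightarrow> real^'n^'n" where
  "conf_matrix c g M = c *\<^sub>R M - (g \<bullet> g / 2) *\<^sub>R mat 1"

lemma conf_matrix_form: "x \<bullet> (conf_matrix c g M *v x) = c * (x \<bullet> (M *v x)) - (g \<bullet> g) / 2 * (x \<bullet> x)"
  by (simp add: conf_matrix_def matrix_vector_mult_diff_rdistrib scaleR_matrix_vector_assoc[symmetric] inner_diff_right)

context elliptic_matrices
begin

definition solution :: "(real^'n) set \<Rightarrow> (real^'n \<Rightarrow> real) \<Rightarrow> (real^'n \<Rightarrow> real^'n) \<Rightarrow> (real^'n \<Rightarrow> real^'n^'n) \<Rightarrow> bool" where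
  "solution S w G H \<longleftrightarrow> C2_data S w G H \<and> (\<forall>x\<in>S. w x > 0 \<and> conf_matrix (w x) (G x) (H x) \<in> E)"

lemma solutionD:
  assumes "solution S w G H"
  shows "C2_data S w G H" "\<And>x. x \<in> S \<Longrightarrow> w x > 0" "\<And>x. x \<in> S \<Longrightarrow> conf_matrix (w x) (G x) (H x) \<in> E"
  using assms by (auto simp: solution_def)

lemma solution_subset: "solution S w G H \<Longrightarrow> open T \<Longrightarrow> T \<subseteq> S \<Longrightarrow> solution T w G H"
  by (auto simp: solution_def intro: C2_data_subset)

lemma solution_translate:
  "solution UNIV w G H \<Longrightarrow> solution UNIV (\<lambda>x. w (a + x)) (\<lambda>x. G (a + x)) (\<lambda>x. H (a + x))"
  by (auto simp: solution_def intro: C2_data_translate)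

end

section \<open>Hopf lemma and strong maximum principle\<close>

lemma has_derivative_along_line:
  assumes "(g has_derivative (\<lambda>v. L \<bullet> v)) (at (y + t *\<^sub>R d))"
  shows "((\<lambda>t. g (y + t *\<^sub>R d)) has_real_derivative L \<bullet> d) (at t)"
proof -
  have "((\<lambda>t. y + t *\<^sub>R d) has_derivative (\<lambda>h. h *\<^sub>R d)) (at t)"
    by (auto intro!: derivative_eq_intros)
  from has_derivative_compose[OF this assms] show ?thesis
    by (simp add: has_field_derivative_def mult_commute_abs)
qed

text \<open>The hypotheses describe a negative minimum of \<open>w1 - w2 - \<epsilon> h\<close> for
  the barrier \<open>exp (- \<alpha> |y|^2)\<close>, whose value there is \<open>e\<close>. The
  radial second derivative of the barrier gains order \<open>\<alpha>^2\<close>, whereas its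
  tangential ones, the gradient terms and the zeroth-order term lose only order
  \<open>\<alpha>\<close>. The bound \<open>\<epsilon> * \<alpha> \<le> 1\<close> tames the square
  of the barrier gradient.\<close>

lemma barrier_form:
  fixes H1 H2 :: "real^'n^'n" and y v g2 :: "real^'n"
  assumes w: "w2 \<le> w1" "w1 - w2 \<le> \<epsilon> * e" "c \<le> w1" "w1 \<le> K" and c: "0 < c"
    and H2: "norm H2 \<le> K" and g2: "norm g2 \<le> K"
    and y: "R / 2 \<le> norm y" "norm y \<le> R" and R: "0 < R"
    and \<alpha>: "1 \<le> \<alpha>" "\<epsilon> * \<alpha> \<le> 1" and \<epsilon>: "0 \<le> \<epsilon>" and e: "0 < e" "e \<le> 1"
    and H1: "v \<bullet> (H2 *v v) + \<epsilon> * (e * (4 * \<alpha>\<^sup>2 * (y \<bullet> v)\<^sup>2 - 2 * \<alpha> * (v \<bullet> v))) \<le> v \<bullet> (H1 *v v)"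
  shows "v \<bullet> (conf_matrix w2 g2 H2 *v v) + (\<epsilon> * e * \<alpha>\<^sup>2 * c * R\<^sup>2) * ((y /\<^sub>R norm y) \<bullet> v)\<^sup>2
      - (\<epsilon> * e * \<alpha> * (3 * K + 2 * K * R + 2 * R\<^sup>2)) * (v \<bullet> v)
    \<le> v \<bullet> (conf_matrix w1 (g2 - (\<epsilon> * (2 * \<alpha> * e)) *\<^sub>R y) H1 *v v)"
proof -
  define X where "X = v \<bullet> v"
  define N where "N = ((y /\<^sub>R norm y) \<bullet> v)\<^sup>2"
  define k where "k = \<epsilon> * e"
  have X: "X \<ge> 0" and N: "N \<ge> 0" by (simp_all add: X_def N_def)
  have k: "0 \<le> k" using \<epsilon> e by (simp add: k_def)
  have K: "0 < K" using w c by linarith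
  have y0: "y \<noteq> 0" using y R by auto
  have Y: "(y \<bullet> v)\<^sup>2 = (norm y)\<^sup>2 * N"
    using y0 by (simp add: N_def power_mult_distrib[symmetric] inverse_eq_divide)
  have R2: "R\<^sup>2 \<le> 4 * (norm y)\<^sup>2"
    using power_mono[OF y(1), of 2] R by (simp add: power_divide)
  \<comment> \<open>Bookkeeping: \<open>iii\<close> is the radial gain. Of the \<open>3 * K\<close>,
    two parts come from \<open>iv\<close> and one from \<open>ii\<close>, raised to order
    \<open>\<alpha>\<close> by \<open>vii\<close>; \<open>v\<close> and \<open>vi\<close> give the
    terms with \<open>R\<close>.\<close>
  have i: "w1 * (v \<bullet> (H2 *v v)) + w1 * (k * (4 * \<alpha>\<^sup>2 * (y \<bullet> v)\<^sup>2 - 2 * \<alpha> * X)) \<le> w1 * (v \<bullet> (H1 *v v))"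
    using mult_left_mono[OF H1, of w1] w c by (simp add: distrib_left X_def k_def mult.assoc)
  have ii: "(w1 - w2) * (v \<bullet> (H2 *v v)) \<ge> - (k * K * X)"
  proof -
    have "\<bar>v \<bullet> (H2 *v v)\<bar> \<le> K * X"
      using abs_matrix_form_le[of v H2] mult_right_mono[OF H2 X] by (simp add: X_def)
    then have "(w1 - w2) * \<bar>v \<bullet> (H2 *v v)\<bar> \<le> k * (K * X)"
      using w by (intro mult_mono) (auto simp: k_def)
    moreover have "(w1 - w2) * (v \<bullet> (H2 *v v)) \<ge> - ((w1 - w2) * \<bar>v \<bullet> (H2 *v v)\<bar>)"
      using w by (simp add: abs_if mult_nonneg_nonneg mult_nonneg_nonpos)
    ultimately show ?thesis by (simp add: mult.assoc)
  qed
  have iii: "k * \<alpha>\<^sup>2 * c * R\<^sup>2 * N \<le> w1 * (k * (4 * \<alpha>\<^sup>2 * (y \<bullet> v)\<^sup>2))"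
  proof -
    have "c * (R\<^sup>2 * N) \<le> w1 * (4 * (norm y)\<^sup>2 * N)"
      using w c R2 N by (intro mult_mono) auto
    then have "(k * \<alpha>\<^sup>2) * (c * (R\<^sup>2 * N)) \<le> (k * \<alpha>\<^sup>2) * (w1 * (4 * (norm y)\<^sup>2 * N))"
      using k by (intro mult_left_mono) auto
    then show ?thesis unfolding Y by (simp add: mult_ac)
  qed
  have iv: "w1 * (k * (2 * \<alpha> * X)) \<le> 2 * K * k * \<alpha> * X"
  proof -
    have "w1 * (k * (2 * \<alpha> * X)) \<le> K * (k * (2 * \<alpha> * X))"
      using w k \<alpha> X by (intro mult_right_mono) auto
    then show ?thesis by (simp add: mult_ac)
  qed
  define g1 where "g1 = g2 - (\<epsilon> * (2 * \<alpha> * e)) *\<^sub>R y"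
  have v: "g1 \<bullet> g1 - g2 \<bullet> g2 \<le> k * \<alpha> * (4 * K * R + 4 * R\<^sup>2)"
  proof -
    have "g1 \<bullet> g1 - g2 \<bullet> g2 = k * \<alpha> * (- (4 * (g2 \<bullet> y)) + 4 * (\<epsilon> * \<alpha>) * e * (norm y)\<^sup>2)"
      unfolding g1_def k_def power2_norm_eq_inner
      by (simp add: inner_simps inner_commute power2_eq_square algebra_simps)
    also have "\<dots> \<le> k * \<alpha> * (4 * K * R + 4 * R\<^sup>2)"
    proof (intro mult_left_mono add_mono)
      have "- (g2 \<bullet> y) \<le> norm g2 * norm y" using Cauchy_Schwarz_ineq2[of g2 y] by linarith
      also have "\<dots> \<le> K * R" using g2 y K by (intro mult_mono) auto
      finally show "- (4 * (g2 \<bullet> y)) \<le> 4 * K * R" by simp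
      have "(\<epsilon> * \<alpha>) * e * (norm y)\<^sup>2 \<le> 1 * 1 * R\<^sup>2"
        using \<alpha> \<epsilon> e y by (intro mult_mono power_mono) auto
      then show "4 * (\<epsilon> * \<alpha>) * e * (norm y)\<^sup>2 \<le> 4 * R\<^sup>2" by simp
      show "0 \<le> k * \<alpha>" using k \<alpha> by simp
    qed
    finally show ?thesis .
  qed
  then have vi: "(g1 \<bullet> g1) / 2 * X - (g2 \<bullet> g2) / 2 * X \<le> k * \<alpha> * (2 * K * R + 2 * R\<^sup>2) * X"
    using mult_right_mono[OF v X] by (simp add: algebra_simps)
  have vii: "k * K * X \<le> k * \<alpha> * K * X"
  proof -
    have "1 * (k * K * X) \<le> \<alpha> * (k * K * X)" using \<alpha> k K X by (intro mult_right_mono) auto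
    then show ?thesis by (simp add: mult_ac)
  qed
  have "k * \<alpha>\<^sup>2 * c * R\<^sup>2 * N - k * \<alpha> * (3 * K + 2 * K * R + 2 * R\<^sup>2) * X
     \<le> w1 * (v \<bullet> (H1 *v v)) - (g1 \<bullet> g1) / 2 * X - (w2 * (v \<bullet> (H2 *v v)) - (g2 \<bullet> g2) / 2 * X)"
    using i ii iii iv vi vii by (simp add: algebra_simps)
  then show ?thesis
    unfolding conf_matrix_form by (simp add: X_def N_def k_def g1_def)
qed

context elliptic_matrices
begin

text \<open>If the barrier on an annulus did not stay below \<open>w1 - w2\<close>, then at an
  interior minimum the matrices of \<open>w2\<close> and \<open>w1\<close>, both in
  \<open>E\<close>, would violate \<open>E_elliptic\<close>. Hence the inward derivative of
  \<open>w1 - w2\<close> at \<open>y0\<close> is at least that of \<open>\<epsilon>\<close> times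
  the barrier, which is positive.\<close>

lemma hopf:
  fixes w1 w2 :: "real^'n \<Rightarrow> real"
  assumes s1: "solution S w1 G1 H1" and s2: "solution S w2 G2 H2"
    and "ball z R \<subseteq> S" "y0 \<in> S" "dist z y0 = R" "R > 0"
    and less: "\<And>x. x \<in> ball z R \<Longrightarrow> w2 x < w1 x" and eq: "w1 y0 = w2 y0"
  shows "0 < (G1 y0 - G2 y0) \<bullet> (z - y0)"
proof -
  note D1 = C2_dataD[OF solutionD(1)[OF s1]] and D2 = C2_dataD[OF solutionD(1)[OF s2]]
  let ?A = "\<lambda>x. conf_matrix (w2 x) (G2 x) (H2 x)"
  obtain \<delta> KE where \<delta>: "\<delta> > 0" and KE: "KE > 0"
    and ell: "\<And>A B s t \<nu>. A \<in> E \<Longrightarrow> B \<in> E \<Longrightarrow> (\<And>x. \<bar>x \<bullet> ((A - ?A y0) *v x)\<bar> \<le> \<delta> * (x \<bullet> x)) \<Longrightarrow>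
      0 \<le> s \<Longrightarrow> s \<le> \<delta> \<Longrightarrow> 0 \<le> t \<Longrightarrow> t \<le> \<delta> \<Longrightarrow> norm \<nu> = 1 \<Longrightarrow>
      (\<And>x. x \<bullet> (A *v x) + t * (\<nu> \<bullet> x)\<^sup>2 - s * (x \<bullet> x) \<le> x \<bullet> (B *v x)) \<Longrightarrow> t \<le> KE * s"
    using E_elliptic[OF solutionD(3)[OF s2 \<open>y0 \<in> S\<close>]] by blast
  have "continuous_on S ?A"
    unfolding conf_matrix_def by (auto intro!: continuous_intros D2)
  then obtain d1 where d1: "d1 > 0" "\<And>x. x \<in> S \<Longrightarrow> dist x y0 < d1 \<Longrightarrow> dist (?A x) (?A y0) < \<delta>"
    using \<open>y0 \<in> S\<close> \<delta> unfolding continuous_on_iff by meson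
  obtain d2 where d2: "d2 > 0" "cball y0 d2 \<subseteq> S"
    using D1(1) \<open>y0 \<in> S\<close> open_contains_cball by blast
  define \<rho> where "\<rho> = min (d1 / 2) d2"
  have \<rho>: "\<rho> > 0" "cball y0 \<rho> \<subseteq> S" using d1 d2 by (auto simp: \<rho>_def subset_iff)
  have near: "norm (?A x - ?A y0) \<le> \<delta>" if "x \<in> cball y0 \<rho>" for x
    using that d1 \<rho>(2) by (auto simp: \<rho>_def dist_norm[symmetric] dist_commute subset_iff less_imp_le)
  have bdd: "\<exists>B. \<forall>x\<in>cball y0 \<rho>. norm (F x) \<le> B" if "continuous_on S F" for F :: "real^'n \<Rightarrow> 'z::real_normed_vector"
    using compact_imp_bounded[OF compact_continuous_image[OF continuous_on_subset[OF that \<rho>(2)] compact_cball]]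
    by (auto simp: bounded_iff)
  obtain B1 B2 B3 where B: "\<And>x. x \<in> cball y0 \<rho> \<Longrightarrow> norm (H2 x) \<le> B1" "\<And>x. x \<in> cball y0 \<rho> \<Longrightarrow> norm (G2 x) \<le> B2"
    "\<And>x. x \<in> cball y0 \<rho> \<Longrightarrow> norm (w1 x) \<le> B3"
    using bdd[OF D2(2)] bdd[OF D2(4)] bdd[OF D1(3)] by blast
  define K where "K = max B1 (max B2 B3)"
  have K: "norm (H2 x) \<le> K" "norm (G2 x) \<le> K" "w1 x \<le> K" if "x \<in> cball y0 \<rho>" for x
    using B[OF that] by (auto simp: K_def)
  obtain xm where xm: "xm \<in> cball y0 \<rho>" "\<And>x. x \<in> cball y0 \<rho> \<Longrightarrow> w1 xm \<le> w1 x"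
    using continuous_attains_inf[OF compact_cball _ continuous_on_subset[OF D1(3) \<rho>(2)]] \<rho>(1) by auto
  define c where "c = w1 xm"
  have c: "c > 0" "\<And>x. x \<in> cball y0 \<rho> \<Longrightarrow> c \<le> w1 x"
    using xm solutionD(2)[OF s1] \<rho>(2) by (auto simp: c_def)
  have "c \<le> K" using c(2)[OF xm(1)] K(3)[OF xm(1)] by linarith
  then have K0: "K > 0" using c by linarith

  text \<open>Shrinking the ball towards \<open>y0\<close> leaves \<open>y0\<close> as the only contact point on the closed ball.\<close>
  define \<theta> where "\<theta> = min (1/2) (\<rho> / (2 * R))"
  have \<theta>: "0 < \<theta>" "\<theta> \<le> 1/2" using \<rho>(1) \<open>R > 0\<close> by (auto simp: \<theta>_def)
  have "\<theta> * R \<le> \<rho> / (2 * R) * R" using \<open>R > 0\<close> by (intro mult_right_mono) (auto simp: \<theta>_def)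
  then have \<theta>R: "2 * (\<theta> * R) \<le> \<rho>" using \<open>R > 0\<close> by (simp add: field_simps)
  define z' where "z' = y0 + \<theta> *\<^sub>R (z - y0)"
  define R' where "R' = \<theta> * R"
  have R': "R' > 0" using \<theta> \<open>R > 0\<close> by (simp add: R'_def)
  have zy: "norm (z - y0) = R" using assms(5) by (simp add: dist_norm)
  have y0z': "dist z' y0 = R'" using zy \<theta>(1) by (simp add: z'_def R'_def dist_norm)
  have sub\<rho>: "x \<in> cball y0 \<rho>" if "dist z' x \<le> R'" for x
    using dist_triangle[of y0 x z'] that y0z' \<theta>R by (simp add: R'_def dist_commute)
  have gt: "w2 x < w1 x" if "dist z' x \<le> R'" "x \<noteq> y0" for x
  proof (rule less)
    define a where "a = x - y0"
    define b where "b = z - y0"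
    have a: "a \<bullet> a > 0" using that by (simp add: a_def)
    have b: "b \<bullet> b = R\<^sup>2" using zy by (simp add: b_def power2_norm_eq_inner[symmetric])
    have "z' - x = \<theta> *\<^sub>R b - a" by (simp add: z'_def a_def b_def)
    then have "(norm (\<theta> *\<^sub>R b - a))\<^sup>2 \<le> (\<theta> * R)\<^sup>2"
      using that(1) R' unfolding R'_def dist_norm by (intro power_mono) auto
    then have 1: "a \<bullet> a \<le> 2 * \<theta> * (a \<bullet> b)"
      unfolding power2_norm_eq_inner using b by (simp add: inner_simps inner_commute power2_eq_square algebra_simps)
    have "a \<bullet> b > 0"
    proof (rule ccontr)
      assume "\<not> a \<bullet> b > 0"
      then have "2 * \<theta> * (a \<bullet> b) \<le> 0" using \<theta> by (simp add: mult_le_0_iff)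
      then show False using 1 a by linarith
    qed
    then have "2 * \<theta> * (a \<bullet> b) \<le> 1 * (a \<bullet> b)" using \<theta> by (intro mult_right_mono) auto
    with 1 a \<open>a \<bullet> b > 0\<close> have "a \<bullet> a < 2 * (a \<bullet> b)" by linarith
    then have "(norm (b - a))\<^sup>2 < R\<^sup>2"
      unfolding power2_norm_eq_inner using b by (simp add: inner_simps inner_commute)
    then have "norm (b - a) < R" using \<open>R > 0\<close> by (simp add: power_less_imp_less_base)
    then show "x \<in> ball z R" by (simp add: a_def b_def dist_norm)
  qed
  have ge: "w2 x \<le> w1 x" if "dist z' x \<le> R'" for x
    using gt[OF that] eq by (cases "x = y0") (auto simp: less_imp_le)

  define K2 where "K2 = 3 * K + 2 * K * R' + 2 * R'\<^sup>2"
  have K2: "K2 > 0" using K0 R' by (simp add: K2_def add_pos_pos)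
  \<comment> \<open>Makes \<open>KE * s < t\<close> for the gain \<open>t\<close> and the loss
    \<open>s\<close> of \<open>barrier_form\<close>, since
    \<open>t / s = \<alpha> c R'^2 / K2\<close>.\<close>
  define \<alpha> where "\<alpha> = max 1 (KE * K2 / (c * R'\<^sup>2) + 1)"
  have \<alpha>: "\<alpha> \<ge> 1" by (simp add: \<alpha>_def)
  have "KE * K2 / (c * R'\<^sup>2) < \<alpha>" by (simp add: \<alpha>_def)
  then have \<alpha>big: "KE * K2 < \<alpha> * (c * R'\<^sup>2)" using c(1) R' by (simp add: divide_less_eq)
  have "compact (cball z' (R'/2))" "cball z' (R'/2) \<noteq> {}" using R' by auto
  moreover have "continuous_on (cball z' (R'/2)) (\<lambda>x. w1 x - w2 x)"
    using sub\<rho> \<rho>(2) R' by (intro continuous_intros continuous_on_subset[OF D1(3)] continuous_on_subset[OF D2(3)])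
      (auto simp: subset_iff)
  ultimately obtain xn where xn: "xn \<in> cball z' (R'/2)" "\<And>x. x \<in> cball z' (R'/2) \<Longrightarrow> w1 xn - w2 xn \<le> w1 x - w2 x"
    using continuous_attains_inf by (metis (no_types, lifting))
  define m where "m = w1 xn - w2 xn"
  have "xn \<noteq> y0" using xn(1) y0z' R' by auto
  then have m: "m > 0" using gt[of xn] xn(1) R' by (simp add: m_def)
  \<comment> \<open>In this order: the smallness required by \<open>barrier_form\<close>; the
    barrier stays below the gap \<open>m\<close> on the inner sphere;
    \<open>s \<le> \<delta>\<close>; \<open>t \<le> \<delta>\<close>.\<close>
  define \<epsilon> where "\<epsilon> = min (1/\<alpha>) (min m (min (\<delta> / (\<alpha> * K2)) (\<delta> / (\<alpha>\<^sup>2 * c * R'\<^sup>2))))"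
  have \<epsilon>: "\<epsilon> > 0" using \<alpha> m \<delta> K2 c(1) R' by (simp add: \<epsilon>_def)
  have "\<epsilon> \<le> 1/\<alpha>" "\<epsilon> \<le> m" "\<epsilon> \<le> \<delta> / (\<alpha> * K2)" "\<epsilon> \<le> \<delta> / (\<alpha>\<^sup>2 * c * R'\<^sup>2)"
    by (simp_all add: \<epsilon>_def)
  then have \<epsilon>le: "\<epsilon> * \<alpha> \<le> 1" "\<epsilon> \<le> m" "\<epsilon> * (\<alpha> * K2) \<le> \<delta>" "\<epsilon> * (\<alpha>\<^sup>2 * c * R'\<^sup>2) \<le> \<delta>"
    using \<alpha> K2 c(1) R' by (simp_all add: le_divide_eq)

  define e where "e x = exp (- \<alpha> * ((x - z') \<bullet> (x - z')))" for x
  have e: "0 < e x" "e x \<le> 1" for x using \<alpha> by (simp_all add: e_def)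
  \<comment> \<open>Normalised to vanish on the outer sphere, which contains
    \<open>y0\<close>.\<close>
  define h where "h x = e x - exp (- \<alpha> * R'\<^sup>2)" for x
  define g where "g x = w1 x - w2 x - \<epsilon> * h x" for x
  define Gh where "Gh x = (- \<alpha> * e x) *\<^sub>R (2 *\<^sub>R (x - z'))" for x
  define Hh where "Hh x = (- \<alpha> * e x) *\<^sub>R (2 *\<^sub>R mat 1) + (\<alpha>\<^sup>2 * e x) *\<^sub>R outer (2 *\<^sub>R (x - z')) (2 *\<^sub>R (x - z'))" for x
  have "C2_data UNIV e Gh Hh"
    unfolding e_def Gh_def Hh_def
    by (rule C2_data_compose[OF C2_data_dist_square[OF open_UNIV], where h = "\<lambda>s. exp (- \<alpha> * s)"
          and ?h1.0 = "\<lambda>s. - \<alpha> * exp (- \<alpha> * s)" and ?h2.0 = "\<lambda>s. \<alpha>\<^sup>2 * exp (- \<alpha> * s)"])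
      (auto intro!: derivative_eq_intros continuous_intros simp: power2_eq_square)
  then have "C2_data UNIV h Gh Hh"
    using C2_data_diff[OF _ C2_data_const[OF open_UNIV], of e Gh Hh "exp (- \<alpha> * R'\<^sup>2)"] by (simp add: h_def[abs_def])
  then have "C2_data S (\<lambda>x. \<epsilon> * h x) (\<lambda>x. \<epsilon> *\<^sub>R Gh x) (\<lambda>x. \<epsilon> *\<^sub>R Hh x)"
    by (intro C2_data_scale C2_data_subset[OF _ D1(1)]) auto
  then have gdata: "C2_data S g (\<lambda>x. G1 x - G2 x - \<epsilon> *\<^sub>R Gh x) (\<lambda>x. H1 x - H2 x - \<epsilon> *\<^sub>R Hh x)"
    unfolding g_def by (intro C2_data_diff solutionD(1)[OF s1] solutionD(1)[OF s2])
  have h_le: "h x \<le> e x" for x by (simp add: h_def)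
  have Hhform: "v \<bullet> (Hh x *v v) = e x * (4 * \<alpha>\<^sup>2 * ((x - z') \<bullet> v)\<^sup>2 - 2 * \<alpha> * (v \<bullet> v))" for x v
    by (simp add: Hh_def matrix_vector_mult_add_rdistrib scaleR_matrix_vector_assoc[symmetric] outer_mult_vector
        inner_simps inner_commute power2_eq_square algebra_simps)

  \<comment> \<open>On the inner sphere \<open>g\<close> is nonnegative because
    \<open>\<epsilon> \<le> m\<close>, on the outer one because \<open>h\<close> vanishes, so a
    negative minimum would lie in the open annulus. The inner radius supplies the lower bound on the
    distance to \<open>z'\<close> that \<open>barrier_form\<close> needs.\<close>
  have g_ge: "g x \<ge> 0" if "R'/2 \<le> dist z' x" "dist z' x \<le> R'" for x
  proof (rule ccontr)
    assume neg: "\<not> g x \<ge> 0"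
    define N where "N = cball z' R' - ball z' (R'/2)"
    have "compact N" unfolding N_def by (intro compact_diff) auto
    moreover have xN: "x \<in> N" using that by (simp add: N_def)
    moreover have NS: "N \<subseteq> S" using sub\<rho> \<rho>(2) by (auto simp: N_def subset_iff)
    ultimately obtain q where q: "q \<in> N" "\<And>x. x \<in> N \<Longrightarrow> g q \<le> g x"
      using continuous_attains_inf[of N g] continuous_on_subset[OF C2_dataD(3)[OF gdata] NS] by blast
    have gq: "g q < 0" using q(2)[OF xN] neg by linarith
    have qd: "R'/2 \<le> dist z' q" "dist z' q \<le> R'" using q(1) by (auto simp: N_def)
    have "dist z' q \<noteq> R'/2"
    proof
      assume "dist z' q = R'/2"
      then have "m \<le> w1 q - w2 q" using xn(2)[of q] by (simp add: m_def)
      moreover have "\<epsilon> * h q \<le> \<epsilon> * 1" using h_le[of q] e[of q] \<epsilon> by (intro mult_left_mono) auto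
      ultimately show False using gq \<epsilon>le(2) by (simp add: g_def)
    qed
    moreover have "dist z' q \<noteq> R'"
    proof
      assume "dist z' q = R'"
      then have "h q = 0" by (simp add: h_def e_def dist_norm norm_minus_commute power2_norm_eq_inner[symmetric])
      then show False using gq ge[OF qd(2)] by (simp add: g_def)
    qed
    ultimately have qU: "q \<in> ball z' R' - cball z' (R'/2)" using qd by auto
    have US: "ball z' R' - cball z' (R'/2) \<subseteq> S" using NS by (auto simp: N_def)
    have "C2_data (ball z' R' - cball z' (R'/2)) g (\<lambda>x. G1 x - G2 x - \<epsilon> *\<^sub>R Gh x) (\<lambda>x. H1 x - H2 x - \<epsilon> *\<^sub>R Hh x)"
      by (rule C2_data_subset[OF gdata _ US]) auto
    from local_min_second_order[OF this qU q(2)]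
    have G: "G1 q - G2 q - \<epsilon> *\<^sub>R Gh q = 0" and H: "\<And>v. 0 \<le> v \<bullet> ((H1 q - H2 q - \<epsilon> *\<^sub>R Hh q) *v v)"
      by (auto simp: N_def)
    have G1: "G1 q = G2 q - (\<epsilon> * (2 * \<alpha> * e q)) *\<^sub>R (q - z')"
      using G by (simp add: Gh_def algebra_simps)
    have H1: "v \<bullet> (H2 q *v v) + \<epsilon> * (e q * (4 * \<alpha>\<^sup>2 * ((q - z') \<bullet> v)\<^sup>2 - 2 * \<alpha> * (v \<bullet> v))) \<le> v \<bullet> (H1 q *v v)" for v
      using H[of v] unfolding Hhform[symmetric]
      by (simp add: matrix_vector_mult_diff_rdistrib scaleR_matrix_vector_assoc[symmetric] inner_diff_right)
    have q\<rho>: "q \<in> cball y0 \<rho>" using sub\<rho> qd by simp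
    then have qS: "q \<in> S" using \<rho>(2) by auto
    have "\<epsilon> * h q \<le> \<epsilon> * e q" using h_le \<epsilon> by (intro mult_left_mono) auto
    then have diff: "w1 q - w2 q \<le> \<epsilon> * e q" using gq by (simp add: g_def)
    have nq: "R'/2 \<le> norm (q - z')" "norm (q - z') \<le> R'" using qd by (simp_all add: dist_norm norm_minus_commute)
    define s where "s = \<epsilon> * e q * \<alpha> * K2"
    define t where "t = \<epsilon> * e q * \<alpha>\<^sup>2 * c * R'\<^sup>2"
    have form: "v \<bullet> (?A q *v v) + t * (((q - z') /\<^sub>R norm (q - z')) \<bullet> v)\<^sup>2 - s * (v \<bullet> v)
       \<le> v \<bullet> (conf_matrix (w1 q) (G1 q) (H1 q) *v v)" for v
      unfolding s_def t_def K2_def G1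
      by (rule barrier_form[OF ge[OF qd(2)] diff c(2)[OF q\<rho>] K(3)[OF q\<rho>] c(1) K(1)[OF q\<rho>] K(2)[OF q\<rho>] nq R' \<alpha> \<epsilon>le(1) less_imp_le[OF \<epsilon>] e H1])
    have s1': "s = e q * (\<epsilon> * (\<alpha> * K2))" and t1': "t = e q * (\<epsilon> * (\<alpha>\<^sup>2 * c * R'\<^sup>2))" by (simp_all add: s_def t_def)
    have s: "0 \<le> s" "s \<le> \<delta>"
      using mult_mono[OF e(2)[of q] \<epsilon>le(3)] \<delta> e[of q] \<epsilon> \<alpha> K2 by (simp_all add: s1')
    have t: "0 \<le> t" "t \<le> \<delta>"
      using mult_mono[OF e(2)[of q] \<epsilon>le(4)] \<delta> e[of q] \<epsilon> \<alpha> c(1) R' by (simp_all add: t1')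
    have nu: "norm ((q - z') /\<^sub>R norm (q - z')) = 1"
    proof -
      have "norm (q - z') \<noteq> 0" using nq R' by linarith
      then show ?thesis by simp
    qed
    have close: "\<bar>x \<bullet> ((?A q - ?A y0) *v x)\<bar> \<le> \<delta> * (x \<bullet> x)" for x
      using abs_matrix_form_le[of x "?A q - ?A y0"] mult_right_mono[OF near[OF q\<rho>], of "x \<bullet> x"] by simp
    have "t \<le> KE * s"
      by (rule ell[OF solutionD(3)[OF s2 qS] solutionD(3)[OF s1 qS] close s t nu form])
    then have "(\<epsilon> * e q * \<alpha>) * (\<alpha> * (c * R'\<^sup>2)) \<le> (\<epsilon> * e q * \<alpha>) * (KE * K2)"
      by (simp add: s_def t_def power2_eq_square mult_ac)
    moreover have "\<epsilon> * e q * \<alpha> > 0" using \<epsilon> e \<alpha> by simp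
    ultimately show False using \<alpha>big by (simp add: mult_le_cancel_left_pos)
  qed

  let ?D = "(G1 y0 - G2 y0 - \<epsilon> *\<^sub>R Gh y0) \<bullet> (z' - y0)"
  have der: "((\<lambda>t. g (y0 + t *\<^sub>R (z' - y0))) has_real_derivative ?D) (at 0)"
    by (rule has_derivative_along_line) (use C2_dataD(5)[OF gdata \<open>y0 \<in> S\<close>] in simp)
  have gy0: "g y0 = 0"
    using y0z' eq by (simp add: g_def h_def e_def dist_norm norm_minus_commute power2_norm_eq_inner[symmetric])
  have "?D \<ge> 0"
  proof (rule ccontr)
    assume "\<not> ?D \<ge> 0"
    then obtain d where d: "d > 0" "\<And>t. 0 < t \<Longrightarrow> t < d \<Longrightarrow> g (y0 + t *\<^sub>R (z' - y0)) < 0"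
      using DERIV_neg_dec_right[OF der] gy0 by auto
    \<comment> \<open>\<open>t \<le> 1/2\<close> keeps the point in the annulus, where
      \<open>g_ge\<close> applies.\<close>
    define t where "t = min (1/2) (d/2)"
    have t: "0 < t" "t < d" "t \<le> 1/2" using d(1) by (auto simp: t_def)
    have "z' - (y0 + t *\<^sub>R (z' - y0)) = (1 - t) *\<^sub>R (z' - y0)" by (simp add: algebra_simps)
    then have "dist z' (y0 + t *\<^sub>R (z' - y0)) = (1 - t) * R'"
      using y0z' t by (simp add: dist_norm)
    moreover have "(1/2) * R' \<le> (1 - t) * R'" "(1 - t) * R' \<le> 1 * R'" using t R' by (auto intro!: mult_right_mono)
    ultimately have "g (y0 + t *\<^sub>R (z' - y0)) \<ge> 0" by (intro g_ge) auto
    then show False using d(2)[OF t(1,2)] by linarith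
  qed
  moreover have "Gh y0 \<bullet> (z' - y0) > 0"
  proof -
    have "Gh y0 \<bullet> (z' - y0) = 2 * \<alpha> * e y0 * ((z' - y0) \<bullet> (z' - y0))"
      by (simp add: Gh_def inner_simps inner_commute algebra_simps)
    moreover have "(z' - y0) \<bullet> (z' - y0) > 0" using y0z' R' by auto
    ultimately show ?thesis using \<alpha> e by simp
  qed
  ultimately have "(G1 y0 - G2 y0) \<bullet> (z' - y0) > 0"
    using \<epsilon> by (simp add: inner_diff_left) (smt (verit) mult_pos_pos)
  then have "\<theta> * ((G1 y0 - G2 y0) \<bullet> (z - y0)) > 0" by (simp add: z'_def)
  then show ?thesis using \<theta>(1) by (simp add: zero_less_mult_iff)
qed

text \<open>The contact set is closed. For openness, take a non-contact point \<open>z\<close> near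
  a contact point and let \<open>y0\<close> be the contact point nearest to \<open>z\<close>. The
  open ball about \<open>z\<close> reaching \<open>y0\<close> is free of contact, so the Hopf lemma
  separates the gradients at \<open>y0\<close>; but they agree there because \<open>w1 - w2\<close>
  is minimal.\<close>

lemma strong_maximum_principle:
  fixes w1 w2 :: "real^'n \<Rightarrow> real"
  assumes s1: "solution S w1 G1 H1" and s2: "solution S w2 G2 H2" and "connected S"
    and le: "\<And>x. x \<in> S \<Longrightarrow> w2 x \<le> w1 x" and p: "p \<in> S" "w1 p = w2 p" and x: "x \<in> S"
  shows "w1 x = w2 x"
proof -
  note D1 = C2_dataD[OF solutionD(1)[OF s1]] and D2 = C2_dataD[OF solutionD(1)[OF s2]]
  let ?Z = "{x \<in> S. w1 x - w2 x = 0}"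
  have cont: "continuous_on S (\<lambda>x. w1 x - w2 x)" by (intro continuous_intros D1 D2)
  have closed: "closedin (top_of_set S) ?Z"
    using continuous_closedin_preimage_constant[OF cont, of 0] by simp
  have grad: "G1 y = G2 y" if "y \<in> S" "w1 y = w2 y" for y
    using local_min_second_order(1)[OF C2_data_diff[OF solutionD(1)[OF s1] solutionD(1)[OF s2]] that(1)] that le by auto
  have "open ?Z"
    unfolding open_contains_ball
  proof
    fix p assume p: "p \<in> ?Z"
    obtain \<rho> where \<rho>: "\<rho> > 0" "cball p \<rho> \<subseteq> S"
      using D1(1) p open_contains_cball by blast
    have "z \<in> ?Z" if z: "z \<in> ball p (\<rho>/2)" for z
    proof (rule ccontr)
      assume "z \<notin> ?Z"
      moreover have "z \<in> S" using z \<rho> by (auto simp: subset_iff)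
      ultimately have zgt: "w2 z < w1 z" using le[of z] by auto
      \<comment> \<open>Intersecting with a closed ball makes the contact set closed in the whole
        space. As \<open>z\<close> is within \<open>\<rho>/2\<close> of \<open>p\<close>, the ball
        from \<open>z\<close> to its nearest contact point stays inside.\<close>
      define Y where "Y = {x \<in> cball p \<rho>. w1 x - w2 x = 0}"
      have "closed Y" unfolding Y_def
        by (rule continuous_closed_preimage_constant[OF continuous_on_subset[OF cont \<rho>(2)]]) auto
      moreover have "p \<in> Y" using p \<rho>(1) by (simp add: Y_def)
      ultimately obtain y0 where y0: "y0 \<in> Y" "\<And>y. y \<in> Y \<Longrightarrow> dist z y0 \<le> dist z y"
        using distance_attains_inf[of Y z] by blast
      have R: "dist z y0 < \<rho>/2" using y0(2)[OF \<open>p \<in> Y\<close>] z by (simp add: dist_commute)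
      have "y0 \<in> S" "w1 y0 = w2 y0" using y0(1) \<rho>(2) by (auto simp: Y_def)
      moreover have "dist z y0 > 0" using zgt \<open>w1 y0 = w2 y0\<close> by auto
      moreover have ball: "x \<in> cball p \<rho>" if "x \<in> ball z (dist z y0)" for x
        using that R z dist_triangle[of p x z] by simp
      moreover have "w2 x < w1 x" if "x \<in> ball z (dist z y0)" for x
        using ball[OF that] y0(2)[of x] that le[of x] \<rho>(2) by (force simp: Y_def)
      ultimately have "0 < (G1 y0 - G2 y0) \<bullet> (z - y0)"
        using \<rho>(2) by (intro hopf[OF s1 s2, of z "dist z y0"]) auto
      then show False using grad[OF \<open>y0 \<in> S\<close> \<open>w1 y0 = w2 y0\<close>] by simp
    qed
    then show "\<exists>e>0. ball p e \<subseteq> ?Z" using \<rho>(1) by (intro exI[of _ "\<rho>/2"]) auto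
  qed
  then have "openin (top_of_set S) ?Z" by (simp add: openin_open_eq D1(1))
  then have "?Z = {} \<or> ?Z = S"
    by (intro connected_clopen[THEN iffD1, OF \<open>connected S\<close>, rule_format] conjI closed)
  then have "?Z = S" using p by auto
  then show ?thesis using x by auto
qed

end

section \<open>Kelvin transform\<close>

definition reflection :: "real^'n \<Rightarrow> real^'n^'n" where
  "reflection y = mat 1 - (2 / (y \<bullet> y)) *\<^sub>R outer y y"

lemma reflection_mult_vector: "reflection y *v v = v - (2 * (y \<bullet> v) / (y \<bullet> y)) *\<^sub>R y"
  by (simp add: reflection_def matrix_vector_mult_diff_rdistrib scaleR_matrix_vector_assoc[symmetric] outer_mult_vector)

lemma reflection_reflection:
  assumes "y \<noteq> 0"
  shows "reflection y *v (reflection y *v v) = v"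
proof -
  have "y \<bullet> (reflection y *v v) = - (y \<bullet> v)"
    using assms by (simp add: reflection_mult_vector inner_diff_right)
  then show ?thesis
    by (simp add: reflection_mult_vector[of y "reflection y *v v"]) (simp add: reflection_mult_vector)
qed

lemma transpose_reflection: "transpose (reflection y) = reflection y"
  by (simp add: reflection_def transpose_def outer_def mat_def vec_eq_iff mult.commute)

lemma orthogonal_reflection:
  assumes "y \<noteq> 0"
  shows "orthogonal_matrix (reflection y)"
  unfolding orthogonal_matrix transpose_reflection
  by (simp add: matrix_eq matrix_vector_mul_assoc[symmetric] reflection_reflection[OF assms])

definition kelvin_point :: "real \<Rightarrow> real^'n \<Rightarrow> real^'n" where
  "kelvin_point \<mu> y = (\<mu>\<^sup>2 / (y \<bullet> y)) *\<^sub>R y"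

definition kelvin :: "real \<Rightarrow> (real^'n \<Rightarrow> real) \<Rightarrow> real^'n \<Rightarrow> real" where
  "kelvin \<mu> w y = (y \<bullet> y) / \<mu>\<^sup>2 * w (kelvin_point \<mu> y)"

text \<open>The derivative of \<open>kelvin_point\<close> at \<open>y\<close> is
  \<open>\<mu>^2 / |y|^2\<close> times the reflection. Collecting the multiples of \<open>y\<close>
  in the gradient leaves this coefficient, which returns as the multiple of the identity in the
  Hessian.\<close>

definition kelvin_coeff :: "real \<Rightarrow> (real^'n \<Rightarrow> real) \<Rightarrow> (real^'n \<Rightarrow> real^'n) \<Rightarrow> real^'n \<Rightarrow> real" where
  "kelvin_coeff \<mu> w G y = 2 * (w (kelvin_point \<mu> y) / \<mu>\<^sup>2 - (y \<bullet> G (kelvin_point \<mu> y)) / (y \<bullet> y))"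

definition kelvin_grad :: "real \<Rightarrow> (real^'n \<Rightarrow> real) \<Rightarrow> (real^'n \<Rightarrow> real^'n) \<Rightarrow> real^'n \<Rightarrow> real^'n" where
  "kelvin_grad \<mu> w G y = G (kelvin_point \<mu> y) + kelvin_coeff \<mu> w G y *\<^sub>R y"

definition kelvin_hess :: "real \<Rightarrow> (real^'n \<Rightarrow> real) \<Rightarrow> (real^'n \<Rightarrow> real^'n) \<Rightarrow> (real^'n \<Rightarrow> real^'n^'n) \<Rightarrow> real^'n \<Rightarrow> real^'n^'n" where
  "kelvin_hess \<mu> w G H y = kelvin_coeff \<mu> w G y *\<^sub>R mat 1 +
    (\<mu>\<^sup>2 / (y \<bullet> y)) *\<^sub>R (reflection y ** H (kelvin_point \<mu> y) ** reflection y)"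

lemma kelvin_point_has_derivative:
  assumes "y \<noteq> 0"
  shows "(kelvin_point \<mu> has_derivative (\<lambda>v. (\<mu>\<^sup>2 / (y \<bullet> y)) *\<^sub>R (reflection y *v v))) (at y)"
proof -
  have sq: "((\<lambda>y. y \<bullet> y) has_derivative (\<lambda>v. 2 * (y \<bullet> v))) (at y)"
    by (auto intro!: derivative_eq_intros simp: inner_commute)
  have "((\<lambda>y. \<mu>\<^sup>2 / (y \<bullet> y)) has_derivative (\<lambda>v. (0 * (y \<bullet> y) - \<mu>\<^sup>2 * (2 * (y \<bullet> v))) / ((y \<bullet> y) * (y \<bullet> y)))) (at y)"
    by (rule has_derivative_divide'[OF has_derivative_const sq]) (use assms in simp)
  from has_derivative_scaleR[OF this has_derivative_ident]
  have "((\<lambda>y. (\<mu>\<^sup>2 / (y \<bullet> y)) *\<^sub>R y) has_derivative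
     (\<lambda>v. (\<mu>\<^sup>2 / (y \<bullet> y)) *\<^sub>R v + ((0 * (y \<bullet> y) - \<mu>\<^sup>2 * (2 * (y \<bullet> v))) / ((y \<bullet> y) * (y \<bullet> y))) *\<^sub>R y)) (at y)" .
  then have "((\<lambda>y. (\<mu>\<^sup>2 / (y \<bullet> y)) *\<^sub>R y) has_derivative (\<lambda>v. (\<mu>\<^sup>2 / (y \<bullet> y)) *\<^sub>R (reflection y *v v))) (at y)"
    by (rule has_derivative_eq_rhs)
      (simp add: fun_eq_iff reflection_mult_vector scaleR_diff_right)
  then show ?thesis by (simp add: kelvin_point_def[abs_def])
qed

lemma inner_reflection:
  "g \<bullet> (reflection y *v v) = g \<bullet> v - 2 * (y \<bullet> v) / (y \<bullet> y) * (y \<bullet> g)"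
  by (simp add: reflection_mult_vector inner_diff_right inner_commute)

lemma continuous_on_kelvin_point: "continuous_on (UNIV - {0}) (kelvin_point \<mu>)"
  unfolding kelvin_point_def[abs_def] by (auto intro!: continuous_intros)

lemma continuous_on_matrix_mult:
  fixes A B :: "'z::topological_space \<Rightarrow> real^'n^'n"
  assumes "continuous_on S A" "continuous_on S B"
  shows "continuous_on S (\<lambda>x. A x ** B x)"
  unfolding matrix_matrix_mult_def by (intro continuous_intros assms)

lemma C2_data_kelvin:
  fixes w :: "real^'n \<Rightarrow> real"
  assumes w: "C2_data S w G H" and \<mu>: "\<mu> \<noteq> 0"
  shows "C2_data {y. y \<noteq> 0 \<and> kelvin_point \<mu> y \<in> S} (kelvin \<mu> w) (kelvin_grad \<mu> w G) (kelvin_hess \<mu> w G H)"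
    (is "C2_data ?T _ _ _")
  unfolding C2_data_def
proof (intro conjI ballI)
  note D = C2_dataD[OF w]
  have "open ((UNIV - {0}) \<inter> kelvin_point \<mu> -` S)"
    by (rule continuous_open_preimage[OF continuous_on_kelvin_point _ D(1)]) auto
  moreover have "(UNIV - {0}) \<inter> kelvin_point \<mu> -` S = ?T" by auto
  ultimately show "open ?T" by simp
  have kp: "continuous_on ?T (kelvin_point \<mu>)"
    by (rule continuous_on_subset[OF continuous_on_kelvin_point]) auto
  have comp: "continuous_on ?T (\<lambda>x. F (kelvin_point \<mu> x))" if "continuous_on S F"
    for F :: "real^'n \<Rightarrow> 'z::topological_space"
    by (rule continuous_on_compose2[OF that kp]) auto
  show "continuous_on ?T (kelvin_hess \<mu> w G H)"
    unfolding kelvin_hess_def[abs_def] kelvin_coeff_def reflection_def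
    using \<mu> by (auto intro!: continuous_intros continuous_on_matrix_mult continuous_on_outer comp D)
  fix y assume y: "y \<in> ?T"
  then have y0: "y \<noteq> 0" and yS: "kelvin_point \<mu> y \<in> S" by auto
  define q where "q = y \<bullet> y"
  have q: "q \<noteq> 0" using y0 by (simp add: q_def)
  define c where "c = w (kelvin_point \<mu> y)"
  define g where "g = G (kelvin_point \<mu> y)"
  define M where "M = H (kelvin_point \<mu> y)"
  note dp = kelvin_point_has_derivative[OF y0, of \<mu>, folded q_def]
  have sq: "((\<lambda>y. y \<bullet> y) has_derivative (\<lambda>v. 2 * (y \<bullet> v))) (at y)"
    by (auto intro!: derivative_eq_intros simp: inner_commute)
  have dw: "((\<lambda>y. w (kelvin_point \<mu> y)) has_derivative (\<lambda>v. g \<bullet> ((\<mu>\<^sup>2 / q) *\<^sub>R (reflection y *v v)))) (at y)"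
    unfolding g_def by (rule has_derivative_compose[OF dp D(5)[OF yS]])
  have dG: "((\<lambda>y. G (kelvin_point \<mu> y)) has_derivative (\<lambda>v. M *v ((\<mu>\<^sup>2 / q) *\<^sub>R (reflection y *v v)))) (at y)"
    unfolding M_def by (rule has_derivative_compose[OF dp D(6)[OF yS]])
  have "((\<lambda>y. (y \<bullet> y) / \<mu>\<^sup>2 * w (kelvin_point \<mu> y)) has_derivative
     (\<lambda>v. (y \<bullet> y) / \<mu>\<^sup>2 * (g \<bullet> ((\<mu>\<^sup>2 / q) *\<^sub>R (reflection y *v v))) + (2 * (y \<bullet> v)) / \<mu>\<^sup>2 * w (kelvin_point \<mu> y))) (at y)"
    by (rule has_derivative_mult[OF bounded_linear.has_derivative[OF bounded_linear_divide sq] dw])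
  then have "((\<lambda>y. (y \<bullet> y) / \<mu>\<^sup>2 * w (kelvin_point \<mu> y)) has_derivative (\<lambda>v. kelvin_grad \<mu> w G y \<bullet> v)) (at y)"
  proof (rule has_derivative_eq_rhs)
    show "(\<lambda>v. (y \<bullet> y) / \<mu>\<^sup>2 * (g \<bullet> ((\<mu>\<^sup>2 / q) *\<^sub>R (reflection y *v v))) + (2 * (y \<bullet> v)) / \<mu>\<^sup>2 * w (kelvin_point \<mu> y))
      = (\<lambda>v. kelvin_grad \<mu> w G y \<bullet> v)"
      using q \<mu> unfolding kelvin_grad_def kelvin_coeff_def g_def[symmetric] c_def[symmetric] q_def[symmetric]
      by (simp add: fun_eq_iff inner_reflection q_def[symmetric] inner_add_left field_simps)
  qed
  then show "(kelvin \<mu> w has_derivative (\<lambda>v. kelvin_grad \<mu> w G y \<bullet> v)) (at y)"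
    by (simp add: kelvin_def[abs_def])
  \<comment> \<open>The derivative of the coefficient is precisely the correction that turns
    \<open>M ** reflection y\<close> into \<open>reflection y ** M ** reflection y\<close>.\<close>
  have dk: "(kelvin_coeff \<mu> w G has_derivative (\<lambda>v. - 2 * (\<mu>\<^sup>2 / q\<^sup>2) * (y \<bullet> (M *v (reflection y *v v))))) (at y)"
  proof -
    have "((\<lambda>y. y \<bullet> G (kelvin_point \<mu> y)) has_derivative (\<lambda>v. y \<bullet> (M *v ((\<mu>\<^sup>2 / q) *\<^sub>R (reflection y *v v))) + v \<bullet> G (kelvin_point \<mu> y))) (at y)"
      by (rule has_derivative_inner[OF has_derivative_ident dG])
    from has_derivative_divide'[OF this sq]
    have "((\<lambda>y. (y \<bullet> G (kelvin_point \<mu> y)) / (y \<bullet> y)) has_derivative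
       (\<lambda>v. ((y \<bullet> (M *v ((\<mu>\<^sup>2 / q) *\<^sub>R (reflection y *v v))) + v \<bullet> g) * q - (y \<bullet> g) * (2 * (y \<bullet> v))) / (q * q))) (at y)"
      using q by (simp add: q_def g_def)
    moreover have "((\<lambda>y. w (kelvin_point \<mu> y) / \<mu>\<^sup>2) has_derivative (\<lambda>v. (g \<bullet> ((\<mu>\<^sup>2 / q) *\<^sub>R (reflection y *v v))) / \<mu>\<^sup>2)) (at y)"
      by (rule bounded_linear.has_derivative[OF bounded_linear_divide dw])
    ultimately have "(kelvin_coeff \<mu> w G has_derivative (\<lambda>v. 2 * ((g \<bullet> ((\<mu>\<^sup>2 / q) *\<^sub>R (reflection y *v v))) / \<mu>\<^sup>2 -
      ((y \<bullet> (M *v ((\<mu>\<^sup>2 / q) *\<^sub>R (reflection y *v v))) + v \<bullet> g) * q - (y \<bullet> g) * (2 * (y \<bullet> v))) / (q * q)))) (at y)"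
      unfolding kelvin_coeff_def[abs_def] by (intro has_derivative_mult_right has_derivative_diff)
    then show ?thesis
    proof (rule has_derivative_eq_rhs)
      show "(\<lambda>v. 2 * ((g \<bullet> ((\<mu>\<^sup>2 / q) *\<^sub>R (reflection y *v v))) / \<mu>\<^sup>2 -
        ((y \<bullet> (M *v ((\<mu>\<^sup>2 / q) *\<^sub>R (reflection y *v v))) + v \<bullet> g) * q - (y \<bullet> g) * (2 * (y \<bullet> v))) / (q * q)))
        = (\<lambda>v. - 2 * (\<mu>\<^sup>2 / q\<^sup>2) * (y \<bullet> (M *v (reflection y *v v))))"
      proof
        fix v
        define a where "a = y \<bullet> g"
        define b where "b = y \<bullet> v"
        define d where "d = g \<bullet> v"
        define X where "X = y \<bullet> (M *v (reflection y *v v))"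
        have e1: "g \<bullet> ((\<mu>\<^sup>2 / q) *\<^sub>R (reflection y *v v)) = (\<mu>\<^sup>2 / q) * (d - 2 * b / q * a)"
          by (simp add: inner_reflection q_def a_def b_def d_def)
        have e2: "y \<bullet> (M *v ((\<mu>\<^sup>2 / q) *\<^sub>R (reflection y *v v))) = (\<mu>\<^sup>2 / q) * X"
          by (simp add: matrix_vector_mult_scaleR X_def)
        have e3: "v \<bullet> g = d" by (simp add: d_def inner_commute)
        have e4: "2 * ((\<mu>\<^sup>2 / q) * (d - 2 * b / q * a) / \<mu>\<^sup>2 - (((\<mu>\<^sup>2 / q) * X + d) * q - a * (2 * b)) / (q * q)) = - 2 * (\<mu>\<^sup>2 / q\<^sup>2) * X"
          using q \<mu> by (simp add: field_simps power2_eq_square)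
        show "2 * ((g \<bullet> ((\<mu>\<^sup>2 / q) *\<^sub>R (reflection y *v v))) / \<mu>\<^sup>2 -
          ((y \<bullet> (M *v ((\<mu>\<^sup>2 / q) *\<^sub>R (reflection y *v v))) + v \<bullet> g) * q - (y \<bullet> g) * (2 * (y \<bullet> v))) / (q * q))
          = - 2 * (\<mu>\<^sup>2 / q\<^sup>2) * (y \<bullet> (M *v (reflection y *v v)))"
          unfolding e1 e2 e3 a_def[symmetric] b_def[symmetric] X_def[symmetric] by (rule e4)
      qed
    qed
  qed
  have "((\<lambda>y. G (kelvin_point \<mu> y) + kelvin_coeff \<mu> w G y *\<^sub>R y) has_derivative
    (\<lambda>v. M *v ((\<mu>\<^sup>2 / q) *\<^sub>R (reflection y *v v)) + (kelvin_coeff \<mu> w G y *\<^sub>R v + (- 2 * (\<mu>\<^sup>2 / q\<^sup>2) * (y \<bullet> (M *v (reflection y *v v)))) *\<^sub>R y))) (at y)"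
    by (rule has_derivative_add[OF dG has_derivative_scaleR[OF dk has_derivative_ident]])
  then have "((\<lambda>y. G (kelvin_point \<mu> y) + kelvin_coeff \<mu> w G y *\<^sub>R y) has_derivative (\<lambda>v. kelvin_hess \<mu> w G H y *v v)) (at y)"
  proof (rule has_derivative_eq_rhs)
    show "(\<lambda>v. M *v ((\<mu>\<^sup>2 / q) *\<^sub>R (reflection y *v v)) + (kelvin_coeff \<mu> w G y *\<^sub>R v + (- 2 * (\<mu>\<^sup>2 / q\<^sup>2) * (y \<bullet> (M *v (reflection y *v v)))) *\<^sub>R y))
      = (\<lambda>v. kelvin_hess \<mu> w G H y *v v)"
      unfolding kelvin_hess_def M_def[symmetric] q_def[symmetric]
      by (simp add: fun_eq_iff matrix_vector_mult_add_rdistrib scaleR_matrix_vector_assoc[symmetric]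
          matrix_vector_mul_assoc[symmetric] reflection_mult_vector[of y "M *v _"] q_def[symmetric]
          matrix_vector_mult_scaleR scaleR_diff_right power2_eq_square)
  qed
  then show "(kelvin_grad \<mu> w G has_derivative (\<lambda>v. kelvin_hess \<mu> w G H y *v v)) (at y)"
    by (simp add: kelvin_grad_def[abs_def])
qed

text \<open>Half the squared gradient of the Kelvin transform is \<open>|g|^2 / 2\<close> plus its
  value times \<open>kelvin_coeff\<close>, and that product cancels the identity part of the
  Hessian. What remains is the original matrix conjugated by the reflection.\<close>

lemma conf_matrix_kelvin:
  assumes "y \<noteq> 0" "\<mu> \<noteq> 0"
  shows "conf_matrix (kelvin \<mu> w y) (kelvin_grad \<mu> w G y) (kelvin_hess \<mu> w G H y) =
    transpose (reflection y) ** conf_matrix (w (kelvin_point \<mu> y)) (G (kelvin_point \<mu> y)) (H (kelvin_point \<mu> y)) ** reflection y"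
proof -
  define q where "q = y \<bullet> y"
  have q: "q \<noteq> 0" using assms by (simp add: q_def)
  define c where "c = w (kelvin_point \<mu> y)"
  define g where "g = G (kelvin_point \<mu> y)"
  define M where "M = H (kelvin_point \<mu> y)"
  define k where "k = kelvin_coeff \<mu> w G y"
  have k: "k = 2 * (c / \<mu>\<^sup>2 - (y \<bullet> g) / q)"
    by (simp add: k_def kelvin_coeff_def c_def g_def q_def)
  have "kelvin_grad \<mu> w G y \<bullet> kelvin_grad \<mu> w G y = g \<bullet> g + k * (2 * (y \<bullet> g) + k * q)"
    by (simp add: kelvin_grad_def k_def[symmetric] g_def[symmetric] q_def inner_simps inner_commute algebra_simps)
  also have "2 * (y \<bullet> g) + k * q = 2 * (q * c / \<mu>\<^sup>2)"
    using q by (simp add: k field_simps)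
  finally have gg: "kelvin_grad \<mu> w G y \<bullet> kelvin_grad \<mu> w G y / 2 = g \<bullet> g / 2 + q * c / \<mu>\<^sup>2 * k"
    by simp
  have W: "kelvin \<mu> w y = q * c / \<mu>\<^sup>2" by (simp add: kelvin_def q_def c_def)
  have "q * c / \<mu>\<^sup>2 * (\<mu>\<^sup>2 / q) = c" using q assms by simp
  then have "conf_matrix (kelvin \<mu> w y) (kelvin_grad \<mu> w G y) (kelvin_hess \<mu> w G H y) *v v
     = c *\<^sub>R (reflection y *v (M *v (reflection y *v v))) - (g \<bullet> g / 2) *\<^sub>R v" for v
    unfolding conf_matrix_def gg W kelvin_hess_def M_def[symmetric] q_def[symmetric] k_def[symmetric]
    by (simp add: matrix_vector_mult_add_rdistrib matrix_vector_mult_diff_rdistrib scaleR_matrix_vector_assoc[symmetric]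
        matrix_vector_mul_assoc[symmetric] algebra_simps)
  moreover have "transpose (reflection y) ** conf_matrix c g M ** reflection y *v v
     = c *\<^sub>R (reflection y *v (M *v (reflection y *v v))) - (g \<bullet> g / 2) *\<^sub>R v" for v
    unfolding conf_matrix_def transpose_reflection matrix_vector_mul_assoc[symmetric]
    by (simp add: matrix_vector_mult_diff_rdistrib scaleR_matrix_vector_assoc[symmetric] matrix_vector_mult_diff_distrib
        matrix_vector_mult_scaleR reflection_reflection[OF assms(1)])
  ultimately show ?thesis
    unfolding matrix_eq c_def[symmetric] g_def[symmetric] M_def[symmetric] by simp
qed

lemma (in elliptic_matrices) solution_kelvin:
  assumes "solution S w G H" "\<mu> \<noteq> 0"
  shows "solution {y. y \<noteq> 0 \<and> kelvin_point \<mu> y \<in> S} (kelvin \<mu> w) (kelvin_grad \<mu> w G) (kelvin_hess \<mu> w G H)"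
  unfolding solution_def
proof (intro conjI ballI)
  show "C2_data {y. y \<noteq> 0 \<and> kelvin_point \<mu> y \<in> S} (kelvin \<mu> w) (kelvin_grad \<mu> w G) (kelvin_hess \<mu> w G H)"
    by (rule C2_data_kelvin[OF solutionD(1)[OF assms(1)] assms(2)])
  fix y assume "y \<in> {y. y \<noteq> 0 \<and> kelvin_point \<mu> y \<in> S}"
  then have y: "y \<noteq> 0" "kelvin_point \<mu> y \<in> S" by auto
  show "0 < kelvin \<mu> w y"
    using y assms(2) solutionD(2)[OF assms(1) y(2)] by (simp add: kelvin_def)
  show "conf_matrix (kelvin \<mu> w y) (kelvin_grad \<mu> w G y) (kelvin_hess \<mu> w G H y) \<in> E"
    unfolding conf_matrix_kelvin[OF y(1) assms(2)]
    by (rule E_conjugate[OF solutionD(3)[OF assms(1) y(2)] orthogonal_reflection[OF y(1)]])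
qed

text \<open>For \<open>m = (n-2)/2\<close> the factor \<open>n/2\<close> in the trace equals
  \<open>m + 1\<close>, so the gradient terms in the Laplacian of \<open>w^(-m)\<close> combine with
  \<open>w \<Delta>w\<close> to the trace of the matrix. Solutions thus yield superharmonic
  functions, and \<open>|x|^2\<close> yields the fundamental solution.\<close>

lemma C2_data_neg_powr:
  fixes w :: "real^'n \<Rightarrow> real"
  assumes w: "C2_data S w G H" and pos: "\<And>x. x \<in> S \<Longrightarrow> w x > 0"
  defines "m \<equiv> (real CARD('n) - 2) / 2"
  shows "\<exists>G' H'. C2_data S (\<lambda>x. w x powr (- m)) G' H' \<and>
    (\<forall>x\<in>S. trace (H' x) = - m * w x powr (- m - 2) * trace (conf_matrix (w x) (G x) (H x)))"
proof (intro exI conjI ballI)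
  let ?h1 = "\<lambda>s. - m * s powr (- m - 1)" and ?h2 = "\<lambda>s. - m * ((- m - 1) * s powr (- m - 2))"
  show "C2_data S (\<lambda>x. w x powr (- m)) (\<lambda>x. ?h1 (w x) *\<^sub>R G x)
     (\<lambda>x. ?h1 (w x) *\<^sub>R H x + ?h2 (w x) *\<^sub>R outer (G x) (G x))"
  proof (rule C2_data_compose[OF w])
    fix x assume x: "x \<in> S"
    show "((\<lambda>s. s powr - m) has_real_derivative ?h1 (w x)) (at (w x))"
      using pos[OF x] by (auto intro!: derivative_eq_intros)
    show "(?h1 has_real_derivative ?h2 (w x)) (at (w x))"
      using pos[OF x] by (auto intro!: derivative_eq_intros simp: diff_diff_eq)
  next
    show "continuous_on (w ` S) ?h2"
      by (intro continuous_intros) (auto dest: pos)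
  qed
  fix x assume x: "x \<in> S"
  have e: "- m - 1 = (- m - 2) + 1" by simp
  have "w x powr (- m - 1) = w x powr (- m - 2) * w x"
    unfolding e powr_add using pos[OF x] by simp
  moreover have "real CARD('n) / 2 = m + 1" by (simp add: m_def field_simps)
  ultimately show "trace (?h1 (w x) *\<^sub>R H x + ?h2 (w x) *\<^sub>R outer (G x) (G x)) =
     - m * w x powr (- m - 2) * trace (conf_matrix (w x) (G x) (H x))"
    by (simp add: conf_matrix_def trace_add trace_diff trace_scaleR trace_outer trace_mat1 algebra_simps)
      (simp add: field_simps)
qed

section \<open>Superharmonic functions on punctured balls\<close>

text \<open>Near the puncture only \<open>V \<ge> 0\<close> is known. Adding
  \<open>\<epsilon>\<close> times the fundamental solution makes \<open>V - h\<close> nonnegative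
  there, so a negative minimum would be interior and its Hessian trace would contradict
  \<open>neg\<close>; \<open>\<epsilon>\<close> is arbitrary.\<close>

lemma superharmonic_puncture:
  fixes V h :: "real^'n \<Rightarrow> real"
  assumes n: "CARD('n) > 2"
    and V: "C2_data S V G H" and S: "cball 0 r - {0} \<subseteq> S" and r: "r > 0"
    and neg: "\<And>x. x \<in> S \<Longrightarrow> trace (H x) < 0" and nonneg: "\<And>x. x \<in> S \<Longrightarrow> 0 \<le> V x"
    and h: "C2_data UNIV h Gh Hh" and harm: "\<And>x. trace (Hh x) = 0"
    and bd: "\<And>x. norm x = r \<Longrightarrow> h x \<le> V x"
    and x: "x \<noteq> 0" "norm x \<le> r"
  shows "h x \<le> V x"
proof -
  define m where "m = (real CARD('n) - 2) / 2"
  have m: "m > 0" using n by (simp add: m_def)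
  define F where "F x = (x \<bullet> x) powr (- m)" for x :: "real^'n"
  have Fnn: "F x \<ge> 0" for x by (simp add: F_def)
  have sq: "C2_data (UNIV - {0 :: real^'n}) (\<lambda>x. (x - 0) \<bullet> (x - 0)) (\<lambda>x. 2 *\<^sub>R (x - 0)) (\<lambda>x. 2 *\<^sub>R mat 1)"
    by (rule C2_data_dist_square) auto
  obtain GF HF where F: "C2_data (UNIV - {0}) F GF HF"
    and HF: "\<And>x. x \<noteq> 0 \<Longrightarrow> trace (HF x) = 0"
  proof -
    obtain G' H' where "C2_data (UNIV - {0}) (\<lambda>x. ((x - 0) \<bullet> (x - 0)) powr (- ((real CARD('n) - 2) / 2))) G' H'"
      "\<forall>x\<in>UNIV - {0}. trace (H' x) = - ((real CARD('n) - 2) / 2) * ((x - 0) \<bullet> (x - 0)) powr (- ((real CARD('n) - 2) / 2) - 2) *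
        trace (conf_matrix ((x - 0) \<bullet> (x - 0)) (2 *\<^sub>R (x - 0)) (2 *\<^sub>R mat 1 :: real^'n^'n))"
      using C2_data_neg_powr[OF sq] by auto
    moreover have "trace (conf_matrix (x \<bullet> x) (2 *\<^sub>R x) (2 *\<^sub>R mat 1 :: real^'n^'n)) = 0" for x :: "real^'n"
      by (simp add: conf_matrix_def trace_diff trace_scaleR trace_mat1)
    ultimately show thesis by (intro that[of G' H']) (simp_all add: F_def[abs_def] m_def)
  qed
  have "h x \<le> V x + \<epsilon> * F x" if \<epsilon>: "\<epsilon> > 0" for \<epsilon>
  proof (rule ccontr)
    assume "\<not> h x \<le> V x + \<epsilon> * F x"
    then have less: "V x - h x + \<epsilon> * F x < 0" by simp
    have "bounded (h ` cball 0 r)"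
      by (intro compact_imp_bounded compact_continuous_image continuous_on_subset[OF C2_dataD(3)[OF h]]) auto
    then obtain B where B: "B > 0" "\<And>y. y \<in> cball 0 r \<Longrightarrow> norm (h y) \<le> B"
      unfolding bounded_pos by blast
    \<comment> \<open>A squared radius: inside it \<open>\<epsilon> * F\<close> is at least the
      bound \<open>B\<close> for \<open>|h|\<close>.\<close>
    define \<sigma> where "\<sigma> = (B / \<epsilon>) powr (- 1 / m)"
    have \<sigma>: "\<sigma> > 0" using B \<epsilon> by (simp add: \<sigma>_def)
    have \<sigma>m: "\<sigma> powr (- m) = B / \<epsilon>" using m B \<epsilon> by (simp add: \<sigma>_def powr_powr)
    have F_ge: "B \<le> \<epsilon> * F y" if "y \<noteq> 0" "y \<bullet> y \<le> \<sigma>" for y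
    proof -
      have "B / \<epsilon> \<le> F y" using powr_mono2'[of "- m" "y \<bullet> y" \<sigma>] m that by (simp add: F_def \<sigma>m)
      then show ?thesis using \<epsilon> by (simp add: pos_divide_le_eq mult.commute)
    qed
    define f where "f y = (V y - h y) + \<epsilon> * F y" for y
    have f_near: "f y \<ge> 0" if "y \<noteq> 0" "y \<bullet> y \<le> \<sigma>" "norm y \<le> r" for y
      using F_ge[OF that(1,2)] B(2)[of y] nonneg[of y] S that by (auto simp: f_def subset_iff abs_le_iff)
    have SS: "S - {0} \<subseteq> UNIV - {0}" by auto
    have oS: "open (S - {0})" using C2_dataD(1)[OF V] by (rule open_delete)
    have fdata: "C2_data (S - {0}) f (\<lambda>x. (G x - Gh x) + \<epsilon> *\<^sub>R GF x) (\<lambda>x. (H x - Hh x) + \<epsilon> *\<^sub>R HF x)"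
      unfolding f_def
      by (intro C2_data_add C2_data_diff C2_data_scale C2_data_subset[OF V oS] C2_data_subset[OF h oS] C2_data_subset[OF F oS SS]) auto
    define K where "K = {y :: real^'n. norm y \<le> r \<and> \<sigma> \<le> y \<bullet> y}"
    have KS: "K \<subseteq> S - {0}" using S \<sigma> by (auto simp: K_def subset_iff)
    have "K = cball 0 r \<inter> {y. \<sigma> \<le> y \<bullet> y}" by (auto simp: K_def)
    moreover have "closed {y :: real^'n. \<sigma> \<le> y \<bullet> y}" by (intro closed_Collect_le continuous_intros)
    ultimately have "compact K" by (simp add: compact_Int_closed)
    have fx: "f x < 0" using less by (simp add: f_def)
    then have xK: "x \<in> K" using f_near[OF x(1) _ x(2)] x(2) by (force simp: K_def)
    obtain q where q: "q \<in> K" "\<And>y. y \<in> K \<Longrightarrow> f q \<le> f y"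
      using continuous_attains_inf[OF \<open>compact K\<close> _ continuous_on_subset[OF C2_dataD(3)[OF fdata] KS]] xK by auto
    have fq: "f q < 0" using q(2)[OF xK] fx by linarith
    have q0: "q \<noteq> 0" using q(1) KS by auto
    have "\<sigma> < q \<bullet> q" using f_near[OF q0] fq q(1) by (force simp: K_def)
    moreover have "norm q < r"
    proof (rule ccontr)
      assume "\<not> norm q < r"
      then have "norm q = r" using q(1) by (simp add: K_def)
      then have "f q \<ge> 0" using bd[of q] Fnn[of q] \<epsilon> by (simp add: f_def)
      then show False using fq by simp
    qed
    ultimately have qU: "q \<in> {y. norm y < r \<and> \<sigma> < y \<bullet> y}" by simp
    have "open {y :: real^'n. norm y < r \<and> \<sigma> < y \<bullet> y}"
      by (intro open_Collect_conj open_Collect_less continuous_intros)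
    moreover have "{y. norm y < r \<and> \<sigma> < y \<bullet> y} \<subseteq> S - {0}"
      by (rule order_trans[OF _ KS]) (auto simp: K_def)
    ultimately have U: "C2_data {y. norm y < r \<and> \<sigma> < y \<bullet> y} f (\<lambda>x. (G x - Gh x) + \<epsilon> *\<^sub>R GF x) (\<lambda>x. (H x - Hh x) + \<epsilon> *\<^sub>R HF x)"
      by (rule C2_data_subset[OF fdata])
    have "0 \<le> v \<bullet> (((H q - Hh q) + \<epsilon> *\<^sub>R HF q) *v v)" for v
      by (rule local_min_second_order(2)[OF U qU]) (use q(2) in \<open>auto simp: K_def\<close>)
    then have "0 \<le> trace ((H q - Hh q) + \<epsilon> *\<^sub>R HF q)"
      unfolding trace_eq_sum_forms by (intro sum_nonneg) auto
    then have "0 \<le> trace (H q)" using harm HF[OF q0] by (simp add: trace_add trace_diff trace_scaleR)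
    then show False using neg[of q] q(1) KS by fastforce
  qed
  then have *: "h x - V x \<le> \<epsilon> * F x" if "\<epsilon> > 0" for \<epsilon> using that by fastforce
  have Fp: "F x > 0" using x by (simp add: F_def)
  show ?thesis
  proof (rule ccontr)
    assume "\<not> h x \<le> V x"
    then show False using *[of "(h x - V x) / (2 * F x)"] Fp by simp
  qed
qed

text \<open>The maximum of two affine functions with distinct slopes has a genuine kink at the
  origin. A harmonic function below it on a small sphere can still exceed \<open>\<beta>\<close> at
  the centre by a fixed amount; by \<open>superharmonic_puncture\<close> it bounds \<open>V\<close>
  from below up to the puncture, against \<open>lim\<close>.\<close>

lemma touching_gradients_equal:
  fixes V :: "real^'n \<Rightarrow> real"
  assumes n: "CARD('n) > 2"
    and V: "C2_data S V G H" and S: "ball 0 r0 - {0} \<subseteq> S" and r0: "r0 > 0"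
    and neg: "\<And>x. x \<in> S \<Longrightarrow> trace (H x) < 0" and nonneg: "\<And>x. x \<in> S \<Longrightarrow> 0 \<le> V x"
    and t1: "\<And>\<eta>. \<eta> > 0 \<Longrightarrow> \<exists>r>0. \<forall>z. 0 < norm z \<and> norm z < r \<longrightarrow> \<beta> + p1 \<bullet> z - \<eta> * norm z \<le> V z"
    and t2: "\<And>\<eta>. \<eta> > 0 \<Longrightarrow> \<exists>r>0. \<forall>z. 0 < norm z \<and> norm z < r \<longrightarrow> \<beta> + p2 \<bullet> z - \<eta> * norm z \<le> V z"
    and lim: "\<And>\<kappa> r. \<kappa> > 0 \<Longrightarrow> r > 0 \<Longrightarrow> \<exists>z. 0 < norm z \<and> norm z < r \<and> V z < \<beta> + \<kappa>"
  shows "p1 = p2"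
proof (rule ccontr)
  assume "p1 \<noteq> p2"
  define d where "d = (1/2) *\<^sub>R (p1 - p2)"
  define a where "a = (1/2) *\<^sub>R (p1 + p2)"
  define N where "N = real CARD('n)"
  have N: "N > 0" by (simp add: N_def)
  have p: "p1 = a + d" "p2 = a - d"
    by (simp_all add: a_def d_def algebra_simps scaleR_add_left[symmetric])
  have d: "norm d > 0" using \<open>p1 \<noteq> p2\<close> by (simp add: d_def)
  \<comment> \<open>The trace correction in \<open>h\<close> contributes
    \<open>norm d * r / N\<close> on the sphere. One half of it pays for the error
    \<open>\<eta> * r\<close>, the other becomes the excess of \<open>h\<close> over
    \<open>\<beta>\<close> at the origin.\<close>
  define \<eta> where "\<eta> = norm d / (2 * N)"
  have \<eta>: "\<eta> > 0" using d N by (simp add: \<eta>_def)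
  obtain r1 where r1: "r1 > 0" "\<And>z. 0 < norm z \<Longrightarrow> norm z < r1 \<Longrightarrow> \<beta> + p1 \<bullet> z - \<eta> * norm z \<le> V z"
    using t1[OF \<eta>] by blast
  obtain r2 where r2: "r2 > 0" "\<And>z. 0 < norm z \<Longrightarrow> norm z < r2 \<Longrightarrow> \<beta> + p2 \<bullet> z - \<eta> * norm z \<le> V z"
    using t2[OF \<eta>] by blast
  define r where "r = min r0 (min r1 r2) / 2"
  have r: "r > 0" "r < r0" "r < r1" "r < r2" using r0 r1(1) r2(1) by (auto simp: r_def)
  \<comment> \<open>On the sphere \<open>|d . z| \<le> norm d * r\<close>, so with this
    \<open>k\<close> the quadratic \<open>k (d . z)^2\<close> stays below \<open>|d . z|\<close>;
    the constant \<open>c\<close> below removes its trace.\<close>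
  define k where "k = 1 / (norm d * r)"
  have k: "k > 0" using d r by (simp add: k_def)
  define c where "c = (d \<bullet> d) / N"
  define b where "b = \<beta> + norm d * r / (2 * N)"
  define h where "h x = (b + a \<bullet> x) + k * ((d \<bullet> x)\<^sup>2 - c * ((x - 0) \<bullet> (x - 0)))" for x
  text \<open>\<open>h\<close> is harmonic, lies below \<open>\<beta> + max (p1 \<bullet> x) (p2 \<bullet> x) - \<eta> * norm x\<close> on the sphere of
    radius \<open>r\<close>, and exceeds \<open>\<beta>\<close> at the origin.\<close>
  have "C2_data UNIV (\<lambda>x. (d \<bullet> x)\<^sup>2) (\<lambda>x. (2 * (d \<bullet> x)) *\<^sub>R d) (\<lambda>x. (2 * (d \<bullet> x)) *\<^sub>R 0 + 2 *\<^sub>R outer d d)"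
    by (rule C2_data_compose[OF C2_data_linear[OF open_UNIV], where h = "\<lambda>s. s\<^sup>2" and ?h1.0 = "\<lambda>s. 2 * s" and ?h2.0 = "\<lambda>s. 2"])
      (auto intro!: derivative_eq_intros)
  then have hdata: "C2_data UNIV h (\<lambda>x. (0 + a) + k *\<^sub>R ((2 * (d \<bullet> x)) *\<^sub>R d - c *\<^sub>R (2 *\<^sub>R (x - 0))))
      (\<lambda>x. (0 + 0) + k *\<^sub>R (((2 * (d \<bullet> x)) *\<^sub>R 0 + 2 *\<^sub>R outer d d) - c *\<^sub>R (2 *\<^sub>R mat 1)))"
    unfolding h_def
    by (intro C2_data_add C2_data_scale C2_data_diff C2_data_const C2_data_linear C2_data_dist_square) auto
  have "d \<bullet> d = c * N" using N by (simp add: c_def)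
  then have harm: "trace ((0 + 0) + k *\<^sub>R (((2 * (d \<bullet> x)) *\<^sub>R 0 + 2 *\<^sub>R outer d d) - c *\<^sub>R (2 *\<^sub>R mat 1)) :: real^'n^'n) = 0" for x
    by (simp add: trace_diff trace_scaleR trace_outer trace_mat1 N_def)
  have bd: "h z \<le> V z" if z: "norm z = r" for z
  proof -
    have "\<beta> + a \<bullet> z + \<bar>d \<bullet> z\<bar> - \<eta> * r \<le> V z"
      using r1(2)[of z] r2(2)[of z] z r by (simp add: p inner_add_left inner_diff_left abs_if)
    moreover have "k * (d \<bullet> z)\<^sup>2 \<le> \<bar>d \<bullet> z\<bar>"
    proof -
      have "\<bar>d \<bullet> z\<bar> \<le> norm d * r" using Cauchy_Schwarz_ineq2[of d z] z by simp
      then have "\<bar>d \<bullet> z\<bar> * \<bar>d \<bullet> z\<bar> \<le> \<bar>d \<bullet> z\<bar> * (norm d * r)" by (intro mult_left_mono) auto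
      then show ?thesis using d r by (simp add: k_def power2_eq_square field_simps)
    qed
    moreover have "k * (c * (z \<bullet> z)) = norm d * r / N"
    proof -
      have "z \<bullet> z = r * r" "d \<bullet> d = norm d * norm d" using z by (simp_all add: power2_norm_eq_inner[symmetric] power2_eq_square)
      then show ?thesis using d r N by (simp add: k_def c_def field_simps)
    qed
    moreover have "norm d * r / (2 * N) = \<eta> * r" "norm d * r / N = 2 * (\<eta> * r)" by (simp_all add: \<eta>_def)
    ultimately show ?thesis
      by (simp add: h_def b_def right_diff_distrib)
  qed
  have le: "h z \<le> V z" if "z \<noteq> 0" "norm z \<le> r" for z
    using superharmonic_puncture[OF n V _ r(1) neg nonneg hdata harm bd that] S r(2) by (auto simp: subset_iff)
  define \<kappa> where "\<kappa> = norm d * r / (4 * N)"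
  have \<kappa>: "\<kappa> > 0" using d r N by (simp add: \<kappa>_def)
  have "h 0 = \<beta> + 2 * \<kappa>" by (simp add: h_def b_def \<kappa>_def)
  moreover have "isCont h 0"
    using C2_dataD(3)[OF hdata] by (simp add: continuous_on_eq_continuous_at)
  ultimately obtain s where s: "s > 0" "\<And>z. norm z < s \<Longrightarrow> \<bar>h z - (\<beta> + 2 * \<kappa>)\<bar> < \<kappa>"
    using \<kappa> unfolding continuous_at_eps_delta by (metis dist_0_norm dist_commute dist_real_def)
  obtain z where z: "0 < norm z" "norm z < min s r" "V z < \<beta> + \<kappa>"
    using lim[OF \<kappa>, of "min s r"] s(1) r(1) by auto
  have "h z \<le> V z" using le[of z] z by simp
  moreover have "h z > \<beta> + \<kappa>" using s(2)[of z] z(2) by (simp add: abs_if split: if_splits)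
  ultimately show False using z(3) by linarith
qed

section \<open>Moving spheres\<close>

lemma kelvin_point_simps:
  fixes y :: "real^'n"
  assumes "y \<noteq> 0" "\<mu> \<noteq> 0"
  shows "norm (kelvin_point \<mu> y) = \<mu>\<^sup>2 / norm y" "kelvin_point \<mu> y \<noteq> 0"
    "kelvin_point \<mu> (kelvin_point \<mu> y) = y"
proof -
  have yy: "y \<bullet> y = norm y * norm y" by (simp add: power2_norm_eq_inner[symmetric] power2_eq_square)
  show n: "norm (kelvin_point \<mu> y) = \<mu>\<^sup>2 / norm y"
    using assms by (simp add: kelvin_point_def yy)
  then show nz: "kelvin_point \<mu> y \<noteq> 0" using assms by (metis divide_eq_0_iff norm_eq_zero power_not_zero)
  have "kelvin_point \<mu> y \<bullet> kelvin_point \<mu> y = (\<mu>\<^sup>2)\<^sup>2 / (y \<bullet> y)"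
    using n assms by (simp add: power2_norm_eq_inner[symmetric] power_divide)
  then have "kelvin_point \<mu> (kelvin_point \<mu> y) = (\<mu>\<^sup>2 / ((\<mu>\<^sup>2)\<^sup>2 / (y \<bullet> y)) * (\<mu>\<^sup>2 / (y \<bullet> y))) *\<^sub>R y"
    by (simp add: kelvin_point_def[of \<mu> "kelvin_point \<mu> y"]) (simp add: kelvin_point_def)
  also have "\<mu>\<^sup>2 / ((\<mu>\<^sup>2)\<^sup>2 / (y \<bullet> y)) * (\<mu>\<^sup>2 / (y \<bullet> y)) = 1"
    using assms by (simp add: field_simps power2_eq_square)
  finally show "kelvin_point \<mu> (kelvin_point \<mu> y) = y" by simp
qed

text \<open>In terms of \<open>w^(-(n-2)/2)\<close> the inequality is reversed: that function
  dominates its own Kelvin transform outside the sphere of radius \<open>\<mu>\<close>.\<close>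

definition sphere_bound :: "(real^'n \<Rightarrow> real) \<Rightarrow> real \<Rightarrow> bool" where
  "sphere_bound w \<mu> \<longleftrightarrow> (\<forall>y. \<mu> \<le> norm y \<longrightarrow> w y \<le> kelvin \<mu> w y)"

text \<open>The limit superior of \<open>w y / |y|^2\<close> at infinity is at least
  \<open>\<alpha>\<close>.\<close>

definition tail_at_least :: "(real^'n \<Rightarrow> real) \<Rightarrow> real \<Rightarrow> bool" where
  "tail_at_least w \<alpha> \<longleftrightarrow> (\<forall>\<kappa>>0. \<forall>M. \<exists>y. M \<le> norm y \<and> (\<alpha> - \<kappa>) * (y \<bullet> y) < w y)"

text \<open>The derivative of \<open>w (t x) / t\<close> in \<open>t\<close> has the sign of
  \<open>t x . G (t x) - w (t x)\<close>. This is about spheres because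
  \<open>kelvin \<mu> w y\<close> equals \<open>w (s y) / s\<close> for
  \<open>s = \<mu>^2 / |y|^2\<close>.\<close>

lemma radial_decrease:
  assumes d: "\<And>x. x \<in> C \<Longrightarrow> (w has_derivative (\<lambda>v. G x \<bullet> v)) (at x)"
    and C: "convex C" "\<And>x. x \<in> C \<Longrightarrow> x \<bullet> G x < w x"
    and x: "x \<in> C" "s *\<^sub>R x \<in> C" and s: "0 < s" "s \<le> 1"
  shows "w x \<le> w (s *\<^sub>R x) / s"
proof -
  have "w (1 *\<^sub>R x) / 1 \<le> w (s *\<^sub>R x) / s"
  proof (rule DERIV_nonpos_imp_nonincreasing[OF s(2), of "\<lambda>t. w (t *\<^sub>R x) / t"])
    fix t assume t: "s \<le> t" "t \<le> 1"
    have tC: "t *\<^sub>R x \<in> C"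
    proof (cases "s = 1")
      case True
      then show ?thesis using x(1) t by simp
    next
      case False
      define \<theta> where "\<theta> = (1 - t) / (1 - s)"
      have \<theta>: "0 \<le> \<theta>" "0 \<le> 1 - \<theta>" using False t s by (auto simp: \<theta>_def divide_le_eq_1)
      have "\<theta> * (1 - s) = 1 - t" using False by (simp add: \<theta>_def)
      then have "t = \<theta> * s + (1 - \<theta>)" unfolding right_diff_distrib by linarith
      then have "t *\<^sub>R x = \<theta> *\<^sub>R (s *\<^sub>R x) + (1 - \<theta>) *\<^sub>R x"
        by (metis scaleR_add_left scaleR_scaleR)
      also have "\<dots> \<in> C" by (rule convexD[OF C(1) x(2) x(1) \<theta>]) simp
      finally show ?thesis .
    qed
    have "((\<lambda>t. w (0 + t *\<^sub>R x)) has_real_derivative G (t *\<^sub>R x) \<bullet> x) (at t)"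
      by (rule has_derivative_along_line) (use d[OF tC] in simp)
    then have "((\<lambda>t. w (t *\<^sub>R x) / t) has_real_derivative ((G (t *\<^sub>R x) \<bullet> x) * t - w (t *\<^sub>R x) * 1) / (t * t)) (at t)"
      using t s by (intro DERIV_divide) auto
    moreover have "(G (t *\<^sub>R x) \<bullet> x) * t - w (t *\<^sub>R x) * 1 < 0"
      using C(2)[OF tC] by (simp add: inner_commute mult.commute)
    ultimately show "\<exists>y. ((\<lambda>t. w (t *\<^sub>R x) / t) has_real_derivative y) (at t) \<and> y \<le> 0"
      by (intro exI conjI) (auto simp: divide_nonpos_nonneg)
  qed
  then show ?thesis by simp
qed

lemma radial_decrease_kelvin:
  assumes d: "\<And>x. x \<in> C \<Longrightarrow> (w has_derivative (\<lambda>v. G x \<bullet> v)) (at x)"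
    and C: "convex C" "\<And>x. x \<in> C \<Longrightarrow> x \<bullet> G x < w x"
    and y: "y \<in> C" "kelvin_point \<mu> y \<in> C" and \<mu>: "0 < \<mu>" "\<mu> \<le> norm y"
  shows "w y \<le> kelvin \<mu> w y"
proof -
  have "\<mu>\<^sup>2 \<le> y \<bullet> y" using \<mu> power_mono[of \<mu> "norm y" 2] by (simp add: power2_norm_eq_inner)
  moreover have "0 < \<mu>\<^sup>2" using \<mu> by simp
  ultimately have "0 < y \<bullet> y" by linarith
  with \<open>\<mu>\<^sup>2 \<le> y \<bullet> y\<close> \<open>0 < \<mu>\<^sup>2\<close> have s: "0 < \<mu>\<^sup>2 / (y \<bullet> y)" "\<mu>\<^sup>2 / (y \<bullet> y) \<le> 1"
    by (simp_all add: divide_le_eq_1)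
  show ?thesis
    using radial_decrease[OF d C y(1) _ s] y(2) by (simp add: kelvin_def kelvin_point_def mult.commute)
qed

lemma connected_exterior:
  assumes "CARD('n) > 1"
  shows "connected {y :: real^'n. \<mu> < norm y}"
proof -
  have "{y :: real^'n. \<mu> < norm y} = - cball 0 \<mu>" by auto
  then show ?thesis
    using connected_complement_bounded_convex[of "cball (0 :: real^'n) \<mu>"] assms by simp
qed

context elliptic_matrices
begin

section \<open>Growth at infinity, small radii and the critical radius\<close>

lemma superharmonic_solution:
  assumes n: "CARD('n) > 2" and s: "solution S w G H"
  shows "\<exists>G' H'. C2_data S (\<lambda>x. w x powr (- ((real CARD('n) - 2) / 2))) G' H' \<and> (\<forall>x\<in>S. trace (H' x) < 0)"
proof -
  obtain G' H' where *: "C2_data S (\<lambda>x. w x powr (- ((real CARD('n) - 2) / 2))) G' H'"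
    "\<forall>x\<in>S. trace (H' x) = - ((real CARD('n) - 2) / 2) * w x powr (- ((real CARD('n) - 2) / 2) - 2) * trace (conf_matrix (w x) (G x) (H x))"
    using C2_data_neg_powr[OF solutionD(1)[OF s] solutionD(2)[OF s]] by blast
  have "trace (H' x) < 0" if x: "x \<in> S" for x
  proof -
    have "- ((real CARD('n) - 2) / 2) < 0" using n by simp
    moreover have "w x powr (- ((real CARD('n) - 2) / 2) - 2) > 0" using solutionD(2)[OF s x] by simp
    moreover have "trace (conf_matrix (w x) (G x) (H x)) > 0" by (rule E_trace[OF solutionD(3)[OF s x]])
    ultimately show ?thesis using *(2) x by (simp add: mult_neg_pos)
  qed
  with * show ?thesis by blast
qed

text \<open>After inversion the superharmonic power of \<open>w\<close> is bounded below on the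
  punctured unit ball by its minimum on the unit sphere. As the exponent is negative, this bounds
  \<open>w y / |y|^2\<close> from above.\<close>

lemma quadratic_growth:
  assumes n: "CARD('n) > 2" and s: "solution UNIV w G H"
  shows "\<exists>C>0. \<forall>y. 1 \<le> norm y \<longrightarrow> w y \<le> C * (y \<bullet> y)"
proof -
  define m where "m = (real CARD('n) - 2) / 2"
  have m: "m > 0" using n by (simp add: m_def)
  let ?S = "{y :: real^'n. y \<noteq> 0 \<and> kelvin_point 1 y \<in> UNIV}"
  define W where "W = kelvin 1 w"
  have sW: "solution ?S W (kelvin_grad 1 w G) (kelvin_hess 1 w G H)"
    unfolding W_def by (rule solution_kelvin[OF s]) simp
  obtain G' H' where V: "C2_data ?S (\<lambda>x. W x powr (- m)) G' H'" and neg: "\<And>x. x \<in> ?S \<Longrightarrow> trace (H' x) < 0"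
    using superharmonic_solution[OF n sW] unfolding m_def by blast
  have Wpos: "W x > 0" if "x \<noteq> 0" for x using solutionD(2)[OF sW, of x] that by simp
  have "sphere 0 1 \<subseteq> ?S" by auto
  then have "continuous_on (sphere 0 1) (\<lambda>x. W x powr (- m))"
    by (rule continuous_on_subset[OF C2_dataD(3)[OF V]])
  then obtain x0 :: "real^'n" where x0: "x0 \<in> sphere 0 1" "\<And>x. x \<in> sphere 0 1 \<Longrightarrow> W x0 powr (- m) \<le> W x powr (- m)"
    using continuous_attains_inf[of "sphere (0 :: real^'n) 1" "\<lambda>x. W x powr (- m)"] by auto
  have x00: "x0 \<noteq> 0" using x0(1) by auto
  show ?thesis
  proof (intro exI conjI allI impI)
    show "W x0 > 0" by (rule Wpos[OF x00])
    fix y :: "real^'n" assume y: "1 \<le> norm y"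
    then have y0: "y \<noteq> 0" by auto
    define z where "z = kelvin_point 1 y"
    have z: "norm z = 1 / norm y" "z \<noteq> 0" "kelvin_point 1 z = y"
      using kelvin_point_simps[OF y0, of 1] by (simp_all add: z_def)
    have "norm z \<le> 1" using z(1) y by (simp add: divide_le_eq)
    have "W x0 powr (- m) \<le> W z powr (- m)"
    proof (rule superharmonic_puncture[OF n V _ zero_less_one neg _ C2_data_const[OF open_UNIV]])
      show "W x0 powr (- m) \<le> W x powr (- m)" if "norm x = 1" for x
        using x0(2)[of x] that by simp
      show "trace (0 :: real^'n^'n) = 0" by (simp add: trace_def)
    qed (use z(2) \<open>norm z \<le> 1\<close> in auto)
    then have "W z \<le> W x0"
      using powr_less_mono2_neg[of "- m" "W x0" "W z"] m Wpos[OF x00] by linarith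
    moreover have "W z = w y / (y \<bullet> y)"
    proof -
      have "z \<bullet> z = 1 / (y \<bullet> y)"
        using z(1) by (simp add: power2_norm_eq_inner[symmetric] power_divide)
      then show ?thesis by (simp add: W_def kelvin_def z(3))
    qed
    ultimately show "w y \<le> W x0 * (y \<bullet> y)" using y0 by (simp add: divide_le_eq)
  qed
qed

text \<open>Near the origin \<open>w x - x . G x\<close> is close to \<open>w 0 > 0\<close>, so
  radial monotonicity applies. Farther out the Kelvin transform is at least
  \<open>|y|^2 / \<mu>^2\<close> times the minimum of \<open>w\<close> on a small ball, which beats
  the quadratic growth of \<open>w\<close> once \<open>\<mu>\<close> is small.\<close>

lemma sphere_bound_start:
  assumes n: "CARD('n) > 2" and s: "solution UNIV w G H"
  shows "\<exists>\<mu>0>0. \<forall>\<mu>. 0 < \<mu> \<and> \<mu> \<le> \<mu>0 \<longrightarrow> sphere_bound w \<mu>"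
proof -
  note D = C2_dataD[OF solutionD(1)[OF s]]
  have wpos: "w x > 0" for x using solutionD(2)[OF s] by simp
  have "continuous_on UNIV (\<lambda>x. w x - x \<bullet> G x)" by (intro continuous_intros D)
  moreover have "w 0 - 0 \<bullet> G 0 > 0" using wpos by simp
  ultimately obtain e where e: "e > 0" "\<And>x. dist x 0 < e \<Longrightarrow> dist (w x - x \<bullet> G x) (w 0 - 0 \<bullet> G 0) < w 0 - 0 \<bullet> G 0"
    unfolding continuous_on_iff by (metis UNIV_I)
  define r where "r = min e 1 / 2"
  have r: "r > 0" "r < 1" "r < e" using e(1) by (auto simp: r_def)
  have rad: "x \<bullet> G x < w x" if "x \<in> ball 0 e" for x
    using e(2)[of x] that by (auto simp: dist_real_def abs_if split: if_splits)
  obtain xa where xa: "xa \<in> cball 0 r" "\<And>x. x \<in> cball 0 r \<Longrightarrow> w xa \<le> w x"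
    using continuous_attains_inf[OF compact_cball _ continuous_on_subset[OF D(3)], of 0 r] r(1) by auto
  obtain xb where xb: "xb \<in> cball 0 1" "\<And>x. x \<in> cball 0 1 \<Longrightarrow> w x \<le> w xb"
    using continuous_attains_sup[OF compact_cball _ continuous_on_subset[OF D(3)], of 0 1] by auto
  obtain C where C: "C > 0" "\<And>y. 1 \<le> norm y \<Longrightarrow> w y \<le> C * (y \<bullet> y)"
    using quadratic_growth[OF n s] by blast
  \<comment> \<open>Enlarging \<open>C\<close> extends the growth bound from the exterior of the
    unit ball to that of the ball of radius \<open>r\<close>.\<close>
  define C' where "C' = max C (w xb / r\<^sup>2)"
  have C': "C' > 0" using C(1) by (simp add: C'_def)
  have growth: "w y \<le> C' * (y \<bullet> y)" if y: "r \<le> norm y" for y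
  proof (cases "1 \<le> norm y")
    case True
    have "w y \<le> C * (y \<bullet> y)" by (rule C(2)[OF True])
    also have "\<dots> \<le> C' * (y \<bullet> y)" by (intro mult_right_mono) (auto simp: C'_def)
    finally show ?thesis .
  next
    case False
    have "r\<^sup>2 \<le> y \<bullet> y" using power_mono[OF y, of 2] r(1) by (simp add: power2_norm_eq_inner)
    have "w y \<le> w xb" using xb(2)[of y] False by simp
    also have "\<dots> = w xb / r\<^sup>2 * r\<^sup>2" using r(1) by simp
    also have "\<dots> \<le> C' * (y \<bullet> y)"
      using C' \<open>r\<^sup>2 \<le> y \<bullet> y\<close> by (intro mult_mono) (auto simp: C'_def)
    finally show ?thesis .
  qed
  define \<mu>0 where "\<mu>0 = min r (sqrt (w xa / C'))"
  show ?thesis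
  proof (intro exI conjI allI impI)
    show "\<mu>0 > 0" using r(1) wpos[of xa] C' by (simp add: \<mu>0_def)
    fix \<mu> assume \<mu>: "0 < \<mu> \<and> \<mu> \<le> \<mu>0"
    show "sphere_bound w \<mu>"
      unfolding sphere_bound_def
    proof (intro allI impI)
      fix y :: "real^'n" assume y: "\<mu> \<le> norm y"
      have y0: "y \<noteq> 0" using y \<mu> by auto
      have "\<mu>\<^sup>2 / norm y \<le> \<mu>" using y \<mu> by (simp add: divide_le_eq power2_eq_square)
      then have kp: "norm (kelvin_point \<mu> y) \<le> \<mu>"
        using kelvin_point_simps(1)[OF y0, of \<mu>] \<mu> by simp
      show "w y \<le> kelvin \<mu> w y"
      proof (cases "norm y < e")
        case True
        then show ?thesis
          using kp \<mu> y r by (intro radial_decrease_kelvin[where C = "ball 0 e" and G = G] D(5) rad)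
            (auto simp: \<mu>0_def)
      next
        case False
        have "\<mu> \<le> sqrt (w xa / C')" "\<mu> \<le> r" using \<mu> by (auto simp: \<mu>0_def)
        then have "\<mu>\<^sup>2 \<le> w xa / C'" using \<mu> C' wpos[of xa] by (metis less_imp_le real_sqrt_le_iff real_sqrt_unique)
        then have "\<mu>\<^sup>2 * C' \<le> w xa" using C' by (simp add: le_divide_eq)
        also have "\<dots> \<le> w (kelvin_point \<mu> y)" using kp \<open>\<mu> \<le> r\<close> by (intro xa(2)) auto
        finally have "C' \<le> w (kelvin_point \<mu> y) / \<mu>\<^sup>2" using \<mu> by (simp add: le_divide_eq mult.commute)
        then have "C' * (y \<bullet> y) \<le> w (kelvin_point \<mu> y) / \<mu>\<^sup>2 * (y \<bullet> y)" by (intro mult_right_mono) auto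
        moreover have "w y \<le> C' * (y \<bullet> y)" using False r by (intro growth) auto
        ultimately show ?thesis by (simp add: kelvin_def mult.commute)
      qed
    qed
  qed
qed

text \<open>\<open>w 0 / \<mu>^2\<close> is the limit of \<open>kelvin \<mu> w y / |y|^2\<close> at
  infinity, so failure of the tail condition means a gap at infinity. With a gap, violations at
  radii approaching the critical one stay bounded and accumulate at a contact point
  \<open>y\<close>. Contact outside the sphere would propagate into the far region by the strong
  maximum principle; at contact on the sphere the Hopf lemma makes \<open>w\<close> radially
  monotone near \<open>y\<close>, which rules out the violations.\<close>

lemma moving_spheres:
  assumes n: "CARD('n) > 2" and s: "solution UNIV w G H"
  shows "(\<forall>\<mu>>0. sphere_bound w \<mu>) \<or> (\<exists>\<mu>>0. sphere_bound w \<mu> \<and> tail_at_least w (w 0 / \<mu>\<^sup>2))"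
proof (rule disjCI, rule ccontr)
  assume nottail: "\<not> (\<exists>\<mu>>0. sphere_bound w \<mu> \<and> tail_at_least w (w 0 / \<mu>\<^sup>2))"
  assume notall: "\<not> (\<forall>\<mu>>0. sphere_bound w \<mu>)"
  note D = C2_dataD[OF solutionD(1)[OF s]]
  have wpos: "w x > 0" for x using solutionD(2)[OF s] by simp
  have wcont: "isCont w x" for x using D(3) by (simp add: continuous_on_eq_continuous_at)
  obtain \<mu>0 where \<mu>0: "\<mu>0 > 0" "\<And>\<mu>. 0 < \<mu> \<Longrightarrow> \<mu> \<le> \<mu>0 \<Longrightarrow> sphere_bound w \<mu>"
    using sphere_bound_start[OF n s] by blast
  define B where "B = {\<mu>. \<mu> > 0 \<and> \<not> sphere_bound w \<mu>}"
  have Bne: "B \<noteq> {}" using notall by (auto simp: B_def)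
  have Blow: "\<mu>0 \<le> \<mu>" if "\<mu> \<in> B" for \<mu> using that \<mu>0(2)[of \<mu>] by (force simp: B_def)
  then have Bbd: "bdd_below B" by (auto simp: bdd_below_def)
  define \<mu> where "\<mu> = Inf B"
  have \<mu>: "\<mu> > 0" using cInf_greatest[OF Bne Blow] \<mu>0(1) by (simp add: \<mu>_def)
  have below: "sphere_bound w t" if "0 < t" "t < \<mu>" for t
    using that cInf_lower[OF _ Bbd, of t] by (force simp: B_def \<mu>_def)
  have ktend: "((\<lambda>j. kelvin (t j) w (Y j)) \<longlongrightarrow> kelvin \<mu> w y) F"
    if "(t \<longlongrightarrow> \<mu>) F" "(Y \<longlongrightarrow> y) F" "y \<noteq> 0" for t Y y and F :: "'z filter"
    unfolding kelvin_def kelvin_point_def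
    by (intro tendsto_intros isCont_tendsto_compose[OF wcont] that) (use \<mu> that in auto)
  have good: "w y \<le> kelvin \<mu> w y" if y: "\<mu> \<le> norm y" for y
  proof (rule tendsto_lowerbound)
    show "((\<lambda>t. kelvin t w y) \<longlongrightarrow> kelvin \<mu> w y) (at_left \<mu>)"
      by (rule ktend) (use y \<mu> in auto)
    show "\<forall>\<^sub>F t in at_left \<mu>. w y \<le> kelvin t w y"
      unfolding eventually_at_left_field
      by (rule exI[of _ 0]) (use \<mu> below y in \<open>auto simp: sphere_bound_def\<close>)
  qed simp
  then have "sphere_bound w \<mu>" by (simp add: sphere_bound_def)
  then have "\<not> tail_at_least w (w 0 / \<mu>\<^sup>2)" using nottail \<mu> by blast
  then obtain \<kappa> M where \<kappa>: "\<kappa> > 0" and tail: "\<And>y. M \<le> norm y \<Longrightarrow> w y \<le> (w 0 / \<mu>\<^sup>2 - \<kappa>) * (y \<bullet> y)"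
    unfolding tail_at_least_def by (meson not_le)
  \<comment> \<open>Joint continuity in the radius and the point: the gap at infinity persists for
    all radii near \<open>\<mu>\<close>.\<close>
  obtain \<tau> where \<tau>: "\<tau> > 0" and near: "\<And>t \<xi>. \<bar>t - \<mu>\<bar> < \<tau> \<Longrightarrow> norm \<xi> < \<tau> \<Longrightarrow> w 0 / \<mu>\<^sup>2 - \<kappa> < w \<xi> / t\<^sup>2"
  proof -
    have f: "((\<lambda>p. fst p) \<longlongrightarrow> \<mu>) (nhds (\<mu>, 0 :: real^'n))"
      using tendsto_fst[OF filterlim_ident, of "(\<mu>, 0 :: real^'n)"] by simp
    have g: "((\<lambda>p. snd p) \<longlongrightarrow> 0) (nhds (\<mu>, 0 :: real^'n))"
      using tendsto_snd[OF filterlim_ident, of "(\<mu>, 0 :: real^'n)"] by simp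
    have "((\<lambda>p. w (snd p) / (fst p)\<^sup>2) \<longlongrightarrow> w 0 / \<mu>\<^sup>2) (nhds (\<mu>, 0))"
      by (rule tendsto_divide[OF isCont_tendsto_compose[OF wcont g] tendsto_power[OF f]]) (use \<mu> in simp)
    then have "\<forall>\<^sub>F p in nhds (\<mu>, 0). w 0 / \<mu>\<^sup>2 - \<kappa> < w (snd p) / (fst p)\<^sup>2"
      using \<kappa> by (intro order_tendstoD) auto
    then obtain d where d: "d > 0" "\<And>p. dist p (\<mu>, 0) < d \<Longrightarrow> w 0 / \<mu>\<^sup>2 - \<kappa> < w (snd p) / (fst p)\<^sup>2"
      unfolding eventually_nhds_metric by blast
    show thesis
    proof (rule that[of "d / 2"])
      fix t :: real and \<xi> :: "real^'n" assume "\<bar>t - \<mu>\<bar> < d / 2" "norm \<xi> < d / 2"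
      moreover have "dist (t, \<xi>) (\<mu>, 0) \<le> \<bar>t - \<mu>\<bar> + norm \<xi>"
        unfolding dist_prod_def by (simp add: dist_real_def) (rule sqrt_sum_squares_le_sum_abs[of "\<bar>t - \<mu>\<bar>" "norm \<xi>", simplified])
      ultimately show "w 0 / \<mu>\<^sup>2 - \<kappa> < w \<xi> / t\<^sup>2" using d(2)[of "(t, \<xi>)"] by simp
    qed (use d in simp)
  qed
  have far: "kelvin t w y > w y"
    if t: "0 < t" "\<bar>t - \<mu>\<bar> < \<tau>" and y: "M \<le> norm y" "t\<^sup>2 / \<tau> < norm y" for t y
  proof -
    have "0 < t\<^sup>2 / \<tau>" using t \<tau> by simp
    then have ny: "norm y > 0" using y(2) by linarith
    have "t\<^sup>2 / norm y < \<tau>" using y(2) ny \<tau> by (simp add: divide_less_eq mult.commute)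
    then have "norm (kelvin_point t y) < \<tau>" using kelvin_point_simps(1)[of y t] ny t(1) by simp
    from near[OF t(2) this] have "(w 0 / \<mu>\<^sup>2 - \<kappa>) * (y \<bullet> y) < w (kelvin_point t y) / t\<^sup>2 * (y \<bullet> y)"
      using ny by (intro mult_strict_right_mono) auto
    then show ?thesis using tail[OF y(1)] by (simp add: kelvin_def mult.commute)
  qed

  \<comment> \<open>Violations at radii tending to the infimum; the bound by \<open>\<tau>\<close>
    keeps \<open>far\<close> applicable.\<close>
  have "\<exists>t y. \<mu> \<le> t \<and> t < \<mu> + min \<tau> (1 / real (Suc j)) \<and> t \<le> norm y \<and> kelvin t w y < w y" for j
  proof -
    have "Inf B < \<mu> + min \<tau> (1 / real (Suc j))" using \<tau> by (simp add: \<mu>_def)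
    then obtain t where t: "t \<in> B" "t < \<mu> + min \<tau> (1 / real (Suc j))"
      using cInf_lessD[OF Bne] by blast
    have "\<mu> \<le> t" unfolding \<mu>_def by (rule cInf_lower[OF t(1) Bbd])
    then show ?thesis using t by (force simp: B_def sphere_bound_def not_le)
  qed
  then obtain T Y where TY: "\<And>j. \<mu> \<le> T j" "\<And>j. T j < \<mu> + min \<tau> (1 / real (Suc j))"
    "\<And>j. T j \<le> norm (Y j)" "\<And>j. kelvin (T j) w (Y j) < w (Y j)"
    by metis
  have T1: "\<bar>T j - \<mu>\<bar> < \<tau>" "0 < T j" "T j \<le> \<mu> + \<tau>" for j using TY(1,2)[of j] \<mu> by auto
  have Tlim: "T \<longlonglongrightarrow> \<mu>"
  proof (rule LIMSEQ_I)
    fix e :: real assume "0 < e"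
    then obtain N where N: "1 / real (Suc N) < e" using nat_approx_posE by blast
    have "norm (T j - \<mu>) < e" if "N \<le> j" for j
    proof -
      have "1 / real (Suc j) \<le> 1 / real (Suc N)" using that by (simp add: frac_le)
      then show ?thesis using TY(1,2)[of j] N by auto
    qed
    then show "\<exists>no. \<forall>j\<ge>no. norm (T j - \<mu>) < e" by blast
  qed
  \<comment> \<open>Uniform in \<open>j\<close>, as every \<open>T j\<close> is at most
    \<open>\<mu> + \<tau>\<close>.\<close>
  define M' where "M' = max M ((\<mu> + \<tau>)\<^sup>2 / \<tau>)"
  have "Y j \<in> cball 0 M'" for j
  proof (rule ccontr)
    assume "Y j \<notin> cball 0 M'"
    then have "M \<le> norm (Y j)" "(\<mu> + \<tau>)\<^sup>2 / \<tau> < norm (Y j)" by (auto simp: M'_def)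
    moreover have "(T j)\<^sup>2 / \<tau> \<le> (\<mu> + \<tau>)\<^sup>2 / \<tau>"
      using T1[of j] \<tau> by (intro divide_right_mono power_mono) auto
    ultimately show False using far[of "T j" "Y j"] T1[of j] TY(4)[of j] by simp
  qed
  then obtain y r where y: "strict_mono r" "(Y \<circ> r) \<longlonglongrightarrow> y"
    using compact_cball[of "0 :: real^'n" M'] unfolding compact_def by metis
  have Tr: "(T \<circ> r) \<longlonglongrightarrow> \<mu>" using LIMSEQ_subseq_LIMSEQ[OF Tlim y(1)] .
  have ny: "\<mu> \<le> norm y"
    by (rule tendsto_le[OF _ tendsto_norm[OF y(2)] Tr]) (use TY(3) in auto)
  then have y0: "y \<noteq> 0" using \<mu> by auto
  have "kelvin \<mu> w y \<le> w y"
  proof (rule tendsto_le)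
    show "((\<lambda>j. w ((Y \<circ> r) j)) \<longlongrightarrow> w y) sequentially" by (rule isCont_tendsto_compose[OF wcont y(2)])
    show "((\<lambda>j. kelvin ((T \<circ> r) j) w ((Y \<circ> r) j)) \<longlongrightarrow> kelvin \<mu> w y) sequentially" by (rule ktend[OF Tr y(2) y0])
    show "\<forall>\<^sub>F j in sequentially. kelvin ((T \<circ> r) j) w ((Y \<circ> r) j) \<le> w ((Y \<circ> r) j)"
      using TY(4) by (auto simp: less_imp_le)
  qed simp
  then have eq: "kelvin \<mu> w y = w y" using good[OF ny] by simp

  define K where "K = {y :: real^'n. y \<noteq> 0 \<and> kelvin_point \<mu> y \<in> UNIV}"
  have sK: "solution K (kelvin \<mu> w) (kelvin_grad \<mu> w G) (kelvin_hess \<mu> w G H)"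
    unfolding K_def by (rule solution_kelvin[OF s]) (use \<mu> in simp)
  have oK: "open K" using C2_dataD(1)[OF solutionD(1)[OF sK]] .
  have strict: "w x < kelvin \<mu> w x" if x: "\<mu> < norm x" for x
  proof (rule ccontr)
    assume "\<not> w x < kelvin \<mu> w x"
    then have xeq: "kelvin \<mu> w x = w x" using good[of x] x by simp
    let ?X = "{y :: real^'n. \<mu> < norm y}"
    have oX: "open ?X" by (intro open_Collect_less continuous_intros)
    have XK: "?X \<subseteq> K" using \<mu> by (auto simp: K_def)
    obtain e :: "real^'n" where e: "norm e = 1" using vector_choose_size[of 1] by auto
    \<comment> \<open>So large that \<open>far\<close> applies at radius \<open>\<mu>\<close> to a
      point of norm \<open>R\<close>, against the equality propagated from \<open>x\<close>.\<close>
    define R where "R = max (\<mu> + 1) (max M (\<mu>\<^sup>2 / \<tau> + 1))"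
    have R: "R > \<mu>" "M \<le> R" "\<mu>\<^sup>2 / \<tau> < R" by (auto simp: R_def)
    have nR: "norm (R *\<^sub>R e) = R" using e R \<mu> by simp
    have "kelvin \<mu> w (R *\<^sub>R e) = w (R *\<^sub>R e)"
      by (rule strong_maximum_principle[OF solution_subset[OF sK oX XK] solution_subset[OF s oX] connected_exterior])
        (use n x xeq good nR R in auto)
    moreover have "kelvin \<mu> w (R *\<^sub>R e) > w (R *\<^sub>R e)"
      by (rule far) (use \<mu> \<tau> R nR in auto)
    ultimately show False by simp
  qed
  then have n\<mu>: "norm y = \<mu>" using eq ny by (force simp: less_le)
  have yy: "y \<bullet> y = \<mu>\<^sup>2" using n\<mu> by (simp add: power2_norm_eq_inner[symmetric])
  have kpy: "kelvin_point \<mu> y = y" using \<mu> by (simp add: kelvin_point_def yy)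
  \<comment> \<open>The ball about \<open>2 y\<close> of radius \<open>\<mu>\<close> touches the
    sphere from outside at \<open>y\<close>.\<close>
  have ball: "\<mu> < norm x" if "x \<in> ball (2 *\<^sub>R y) \<mu>" for x
  proof -
    have "2 * \<mu> \<le> norm (2 *\<^sub>R y - x) + norm x" using norm_triangle_ineq[of "2 *\<^sub>R y - x" x] n\<mu> by simp
    then show ?thesis using that by (simp add: dist_norm)
  qed
  have "0 < (kelvin_grad \<mu> w G y - G y) \<bullet> (2 *\<^sub>R y - y)"
  proof (rule hopf[OF sK solution_subset[OF s oK] _ _ _ \<mu> _ eq])
    show "ball (2 *\<^sub>R y) \<mu> \<subseteq> K"
    proof
      fix x assume "x \<in> ball (2 *\<^sub>R y) \<mu>"
      then have "\<mu> < norm x" by (rule ball)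
      then show "x \<in> K" using \<mu> by (auto simp: K_def)
    qed
    have "2 *\<^sub>R y - y = y" by (simp add: scaleR_2)
    then show "dist (2 *\<^sub>R y) y = \<mu>" using n\<mu> by (simp add: dist_norm)
  qed (use y0 ball strict in \<open>auto simp: K_def\<close>)
  \<comment> \<open>The inversion fixes \<open>y\<close>, so the gradient difference is radial with
    coefficient \<open>2 (w y - y . G y) / \<mu>^2\<close>.\<close>
  moreover have "(kelvin_grad \<mu> w G y - G y) \<bullet> (2 *\<^sub>R y - y) = 2 * (w y - y \<bullet> G y)"
    using \<mu> by (simp add: kelvin_grad_def kelvin_coeff_def kpy yy scaleR_2 field_simps)
  ultimately have pos: "0 < w y - y \<bullet> G y" by simp
  have "isCont (\<lambda>x. w x - x \<bullet> G x) y"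
    using D(3,4) by (auto simp: continuous_on_eq_continuous_at intro!: continuous_intros)
  then have "((\<lambda>x. w x - x \<bullet> G x) \<longlongrightarrow> w y - y \<bullet> G y) (nhds y)"
    unfolding isCont_def tendsto_at_iff_tendsto_nhds[of "\<lambda>x. w x - x \<bullet> G x" y] .
  then have "\<forall>\<^sub>F x in nhds y. 0 < w x - x \<bullet> G x"
    using pos by (rule order_tendstoD)
  then obtain e where e: "e > 0" "\<And>x. dist x y < e \<Longrightarrow> 0 < w x - x \<bullet> G x"
    unfolding eventually_nhds_metric by blast
  \<comment> \<open>The violating points and their reflections both converge to \<open>y\<close>,
    hence enter the ball where radial monotonicity holds.\<close>
  have "((\<lambda>j. kelvin_point ((T \<circ> r) j) ((Y \<circ> r) j)) \<longlongrightarrow> kelvin_point \<mu> y) sequentially"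
    unfolding kelvin_point_def by (intro tendsto_intros Tr y(2)) (use y0 in auto)
  then have "\<forall>\<^sub>F j in sequentially. dist (kelvin_point ((T \<circ> r) j) ((Y \<circ> r) j)) y < e \<and> dist ((Y \<circ> r) j) y < e"
    using y(2) e(1) by (intro eventually_conj tendstoD) (auto simp: kpy comp_def)
  then obtain j where j: "dist (kelvin_point (T (r j)) (Y (r j))) y < e" "dist (Y (r j)) y < e"
    by (auto simp: eventually_sequentially)
  have "w (Y (r j)) \<le> kelvin (T (r j)) w (Y (r j))"
    by (rule radial_decrease_kelvin[where C = "ball y e" and G = G])
      (use j e(2) T1 TY(3) D(5) in \<open>auto simp: dist_commute\<close>)
  then show False using TY(4)[of "r j"] by simp
qed

end

section \<open>Entire solutions are quadratic\<close>

text \<open>The sphere bound at \<open>a\<close> caps the limit superior of \<open>w / |y|^2\<close>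
  at \<open>w a / \<mu>^2\<close>, and this limit superior does not depend on the centre from which
  \<open>y\<close> is measured.\<close>

lemma tail_comparison:
  fixes w :: "real^'n \<Rightarrow> real"
  assumes cont: "isCont w a" and wa: "w a > 0" and \<mu>: "\<mu> > 0"
    and bound: "sphere_bound (\<lambda>x. w (a + x)) \<mu>" and tail: "tail_at_least (\<lambda>x. w (b + x)) \<beta>"
  shows "\<beta> \<le> w a / \<mu>\<^sup>2"
proof (rule ccontr)
  define A where "A = w a / \<mu>\<^sup>2"
  have A: "A > 0" using wa \<mu> by (simp add: A_def)
  assume "\<not> \<beta> \<le> w a / \<mu>\<^sup>2"
  then have less: "A < \<beta>" by (simp add: A_def)
  \<comment> \<open>Solves \<open>(A + \<kappa>) (1 + \<kappa>) \<le> \<beta> - \<kappa>\<close>: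
    \<open>A + \<kappa>\<close> allows for continuity at \<open>a\<close>,
    \<open>1 + \<kappa>\<close> for the change of centre.\<close>
  define \<kappa> where "\<kappa> = min 1 ((\<beta> - A) / (A + 3))"
  have \<kappa>: "\<kappa> > 0" "\<kappa> \<le> 1" "\<kappa> * (A + 3) \<le> \<beta> - A"
  proof -
    show "\<kappa> > 0" "\<kappa> \<le> 1" using A less by (simp_all add: \<kappa>_def)
    have "\<kappa> \<le> (\<beta> - A) / (A + 3)" by (simp add: \<kappa>_def)
    then show "\<kappa> * (A + 3) \<le> \<beta> - A" using A by (simp add: le_divide_eq)
  qed
  have "(A + \<kappa>) * (1 + \<kappa>) \<le> A + \<kappa> * (A + 2)"
    using mult_left_mono[OF \<kappa>(2), of \<kappa>] \<kappa>(1) by (simp add: algebra_simps)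
  then have key: "(A + \<kappa>) * (1 + \<kappa>) \<le> \<beta> - \<kappa>" using \<kappa>(3) by (simp add: algebra_simps)
  have "\<kappa> * \<mu>\<^sup>2 > 0" using \<kappa> \<mu> by simp
  then obtain e where e: "e > 0" "\<And>x. dist x a < e \<Longrightarrow> dist (w x) (w a) < \<kappa> * \<mu>\<^sup>2"
    using cont unfolding continuous_at_eps_delta by (metis dist_commute)
  have upper: "w (a + y) \<le> (A + \<kappa>) * (y \<bullet> y)" if y: "\<mu> \<le> norm y" "\<mu>\<^sup>2 / e < norm y" for y
  proof -
    have y0: "y \<noteq> 0" using y \<mu> by auto
    have "\<mu>\<^sup>2 / norm y < e" using y(2) y0 e(1) by (simp add: divide_less_eq mult.commute)
    then have "norm (kelvin_point \<mu> y) < e" using kelvin_point_simps(1)[OF y0, of \<mu>] \<mu> by simp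
    then have "w (a + kelvin_point \<mu> y) < w a + \<kappa> * \<mu>\<^sup>2"
      using e(2)[of "a + kelvin_point \<mu> y"] by (simp add: dist_norm abs_if split: if_splits)
    then have "w (a + kelvin_point \<mu> y) / \<mu>\<^sup>2 \<le> A + \<kappa>"
      using \<mu> by (simp add: A_def field_simps)
    then have "w (a + kelvin_point \<mu> y) / \<mu>\<^sup>2 * (y \<bullet> y) \<le> (A + \<kappa>) * (y \<bullet> y)"
      by (intro mult_right_mono) auto
    moreover have "w (a + y) \<le> kelvin \<mu> (\<lambda>x. w (a + x)) y"
      using bound y(1) by (simp add: sphere_bound_def)
    ultimately show ?thesis by (simp add: kelvin_def mult.commute)
  qed
  define c where "c = b - a"
  \<comment> \<open>The first maximum keeps \<open>c + y\<close> in the range of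
    \<open>upper\<close>; the second gives
    \<open>|c + y|^2 \<le> (1 + \<kappa>) |y|^2\<close>.\<close>
  define M where "M = max (max \<mu> (\<mu>\<^sup>2 / e + 1) + norm c) (max 1 ((2 * norm c + norm c ^ 2) / \<kappa>))"
  obtain y where y: "M \<le> norm y" "(\<beta> - \<kappa>) * (y \<bullet> y) < w (b + y)"
    using tail \<kappa>(1) unfolding tail_at_least_def by blast
  have M: "max \<mu> (\<mu>\<^sup>2 / e + 1) + norm c \<le> norm y" "1 \<le> norm y" "(2 * norm c + norm c ^ 2) / \<kappa> \<le> norm y"
    using y(1) by (simp_all add: M_def)
  have "norm y - norm c \<le> norm (c + y)" using norm_triangle_ineq2[of y "- c"] by (simp add: add.commute)
  then have "w (a + (c + y)) \<le> (A + \<kappa>) * ((c + y) \<bullet> (c + y))"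
    using M(1) by (intro upper) auto
  also have "\<dots> \<le> (A + \<kappa>) * ((1 + \<kappa>) * (y \<bullet> y))"
  proof (intro mult_left_mono)
    have "2 * (c \<bullet> y) + c \<bullet> c \<le> 2 * (norm c * norm y) + norm c ^ 2"
      using norm_cauchy_schwarz[of c y] by (simp add: power2_norm_eq_inner)
    also have "\<dots> \<le> (2 * norm c + norm c ^ 2) * norm y"
      using mult_left_mono[OF M(2), of "norm c ^ 2"] by (simp add: algebra_simps)
    also have "\<dots> \<le> (\<kappa> * norm y) * norm y"
      using M(3) \<kappa>(1) by (intro mult_right_mono) (auto simp: divide_le_eq mult.commute)
    finally have "2 * (c \<bullet> y) + c \<bullet> c \<le> \<kappa> * (y \<bullet> y)"
      by (simp add: power2_norm_eq_inner[symmetric] power2_eq_square)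
    then show "(c + y) \<bullet> (c + y) \<le> (1 + \<kappa>) * (y \<bullet> y)"
      by (simp add: inner_simps inner_commute algebra_simps)
    show "0 \<le> A + \<kappa>" using A \<kappa> by simp
  qed
  also have "\<dots> \<le> (\<beta> - \<kappa>) * (y \<bullet> y)"
    using mult_right_mono[OF key, of "y \<bullet> y"] by (simp add: mult.assoc)
  finally show False using y(2) by (simp add: c_def add.assoc[symmetric])
qed

text \<open>\<open>\<phi>\<close> is the Kelvin transform in the unit sphere of the upper bound
  given by the sphere about \<open>a\<close>. The two inversions send \<open>0\<close> to infinity
  and on to \<open>a\<close>, so their composition \<open>I\<close> is regular at \<open>0\<close>,
  where \<open>kelvin 1 w\<close> itself is uncontrolled.\<close>

lemma kelvin_touching_function:
  fixes w :: "real^'n \<Rightarrow> real"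
  assumes d: "(w has_derivative (\<lambda>v. G a \<bullet> v)) (at a)" and wa: "w a > 0" and \<alpha>: "\<alpha> > 0" and \<mu>: "\<mu> > 0" "\<mu>\<^sup>2 = w a / \<alpha>"
    and bound: "sphere_bound (\<lambda>x. w (a + x)) \<mu>"
  shows "\<exists>\<phi> r. r > 0 \<and> (\<phi> has_derivative (\<lambda>v. (G a - (2 * \<alpha>) *\<^sub>R a) \<bullet> v)) (at 0) \<and> \<phi> 0 = \<alpha> \<and>
    (\<forall>z. 0 < norm z \<and> norm z < r \<longrightarrow> kelvin 1 w z \<le> \<phi> z)"
proof -
  \<comment> \<open>\<open>|z|^2\<close> times the squared distance from \<open>z / |z|^2\<close> to
    \<open>a\<close>, written as a polynomial so that it makes sense at
    \<open>z = 0\<close>.\<close>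
  define D where "D z = 1 - 2 * (a \<bullet> z) + (a \<bullet> a) * (z \<bullet> z)" for z
  define I where "I z = a + ((w a / \<alpha>) / D z) *\<^sub>R (z - (z \<bullet> z) *\<^sub>R a)" for z
  define \<phi> where "\<phi> z = (D z * (\<alpha> / w a)) * w (I z)" for z
  have D0: "D 0 = 1" and I0: "I 0 = a" by (simp_all add: D_def I_def)
  have dD: "(D has_derivative (\<lambda>v. - 2 * (a \<bullet> v))) (at 0)"
    unfolding D_def[abs_def] by (auto intro!: derivative_eq_intros)
  have d1: "((\<lambda>z. (w a / \<alpha>) / D z) has_derivative (\<lambda>v. (0 * D 0 - (w a / \<alpha>) * (- 2 * (a \<bullet> v))) / (D 0 * D 0))) (at 0)"
    by (rule has_derivative_divide'[OF has_derivative_const dD]) (simp add: D0)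
  have d2: "((\<lambda>z. z - (z \<bullet> z) *\<^sub>R a) has_derivative (\<lambda>v. v)) (at 0)"
    by (auto intro!: derivative_eq_intros)
  have dI: "(I has_derivative (\<lambda>v. (w a / \<alpha>) *\<^sub>R v)) (at 0)"
    unfolding I_def[abs_def]
    by (rule has_derivative_eq_rhs[OF has_derivative_add[OF has_derivative_const has_derivative_scaleR[OF d1 d2]]])
      (simp add: D0)
  have "((\<lambda>z. w (I z)) has_derivative (\<lambda>v. G a \<bullet> ((w a / \<alpha>) *\<^sub>R v))) (at 0)"
    by (rule has_derivative_compose[OF dI]) (use d in \<open>simp add: I0\<close>)
  from has_derivative_mult[OF has_derivative_mult_left[OF dD] this, of "\<alpha> / w a"]
  have "(\<phi> has_derivative (\<lambda>v. (D 0 * (\<alpha> / w a)) * (G a \<bullet> ((w a / \<alpha>) *\<^sub>R v)) + (- 2 * (a \<bullet> v) * (\<alpha> / w a)) * w (I 0))) (at 0)"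
    by (simp add: \<phi>_def[abs_def])
  then have der: "(\<phi> has_derivative (\<lambda>v. (G a - (2 * \<alpha>) *\<^sub>R a) \<bullet> v)) (at 0)"
    by (rule has_derivative_eq_rhs) (use wa \<alpha> in \<open>simp add: fun_eq_iff D0 I0 inner_diff_left\<close>)
  \<comment> \<open>For these \<open>z\<close> the inverted point has distance at least
    \<open>\<mu>\<close> from \<open>a\<close>, where the sphere bound holds.\<close>
  have le: "kelvin 1 w z \<le> \<phi> z" if z: "0 < norm z" "norm z < 1 / (\<mu> + norm a)" for z
  proof -
    define q where "q = z \<bullet> z"
    have q: "q > 0" using z(1) by (simp add: q_def)
    define y where "y = (1 / q) *\<^sub>R z - a"
    have "norm ((1 / q) *\<^sub>R z) = 1 / norm z"
      using z(1) by (simp add: q_def power2_norm_eq_inner[symmetric] power2_eq_square)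
    moreover have "\<mu> + norm a < 1 / norm z"
    proof -
      have "\<mu> + norm a > 0" using \<mu>(1) by (simp add: add_pos_nonneg)
      then show ?thesis using z by (simp add: less_divide_eq mult.commute)
    qed
    moreover have "norm ((1 / q) *\<^sub>R z) - norm a \<le> norm y" unfolding y_def by (rule norm_triangle_ineq2)
    ultimately have ny: "\<mu> \<le> norm y" by linarith
    have yy: "y \<bullet> y = D z / q"
      using q by (simp add: y_def D_def inner_simps inner_commute q_def[symmetric] field_simps power2_eq_square)
    have "y \<noteq> 0" using ny \<mu> by auto
    then have Dz: "D z > 0" using yy q by (metis inner_gt_zero_iff zero_less_divide_iff not_less_iff_gr_or_eq)
    have "a + y = kelvin_point 1 z" by (simp add: y_def kelvin_point_def q_def)
    then have "kelvin 1 w z = q * w (a + y)" by (simp add: kelvin_def q_def)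
    also have "\<dots> \<le> q * kelvin \<mu> (\<lambda>x. w (a + x)) y"
      using bound ny q by (intro mult_left_mono) (auto simp: sphere_bound_def)
    also have "kelvin_point \<mu> y = ((w a / \<alpha>) / D z) *\<^sub>R (z - q *\<^sub>R a)"
    proof -
      have "kelvin_point \<mu> y = ((w a / \<alpha>) * q / D z) *\<^sub>R y"
        by (simp add: kelvin_point_def yy \<mu>(2))
      also have "\<dots> = ((w a / \<alpha>) / D z) *\<^sub>R (q *\<^sub>R y)" by simp
      also have "q *\<^sub>R y = z - q *\<^sub>R a" using q by (simp add: y_def scaleR_diff_right)
      finally show ?thesis .
    qed
    then have "q * kelvin \<mu> (\<lambda>x. w (a + x)) y = \<phi> z"
      using q wa \<alpha> by (simp add: kelvin_def \<phi>_def I_def yy \<mu>(2) q_def[symmetric])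
    finally show ?thesis by simp
  qed
  have "1 / (\<mu> + norm a) > 0" using \<mu>(1) by (simp add: add_pos_nonneg)
  moreover have "\<phi> 0 = \<alpha>" using wa by (simp add: \<phi>_def D0 I0)
  ultimately show ?thesis using der le by blast
qed

text \<open>Put the centre on the line through \<open>y\<close> and \<open>y'\<close>, behind
  \<open>y\<close> at distance \<open>s\<close>, with the radius for which \<open>y'\<close>
  reflects to \<open>y\<close>. The bound reads \<open>w y' \<le> (1 + d / s) w y\<close>, and
  \<open>s\<close> is arbitrarily large.\<close>

lemma all_sphere_bounds_imp_const:
  fixes w :: "real^'n \<Rightarrow> real"
  assumes all: "\<And>a \<mu>. 0 < \<mu> \<Longrightarrow> sphere_bound (\<lambda>x. w (a + x)) \<mu>" and nonneg: "\<And>x. 0 \<le> w x"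
  shows "w y' \<le> w y"
proof (cases "y' = y")
  case False
  define d where "d = norm (y' - y)"
  have d: "d > 0" using False by (simp add: d_def)
  define \<theta> where "\<theta> = (1 / d) *\<^sub>R (y' - y)"
  have \<theta>: "norm \<theta> = 1" "y' = y + d *\<^sub>R \<theta>" using d by (simp_all add: \<theta>_def d_def)
  have *: "w y' \<le> w y + d * w y / s" if s: "s > 0" for s
  proof -
    define r where "r = s + d"
    have r: "r > s" using d by (simp add: r_def)
    define \<mu> where "\<mu> = sqrt (s * r)"
    have \<mu>: "\<mu> > 0" "\<mu>\<^sup>2 = s * r" using s r by (simp_all add: \<mu>_def)
    have "\<mu>\<^sup>2 \<le> r\<^sup>2" unfolding \<mu>(2) using s r by (simp add: power2_eq_square)
    then have "\<mu> \<le> r" by (rule power2_le_imp_le) (use s r in simp)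
    moreover have "norm (r *\<^sub>R \<theta>) = r" using \<theta> s r by simp
    ultimately have "w ((y - s *\<^sub>R \<theta>) + r *\<^sub>R \<theta>) \<le> kelvin \<mu> (\<lambda>x. w ((y - s *\<^sub>R \<theta>) + x)) (r *\<^sub>R \<theta>)"
      using all[OF \<mu>(1), of "y - s *\<^sub>R \<theta>"] by (simp add: sphere_bound_def)
    moreover have "(y - s *\<^sub>R \<theta>) + r *\<^sub>R \<theta> = y'" by (simp add: \<theta>(2) r_def algebra_simps)
    moreover have rr: "(r *\<^sub>R \<theta>) \<bullet> (r *\<^sub>R \<theta>) = r * r" using \<theta>(1) by (simp add: norm_eq_1)
    moreover have "kelvin_point \<mu> (r *\<^sub>R \<theta>) = s *\<^sub>R \<theta>"
      unfolding kelvin_point_def rr \<mu>(2) using s r by simp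
    ultimately have "w y' \<le> r / s * w y"
      using s r unfolding kelvin_def by (simp add: \<mu>(2) rr)
    then show ?thesis using s by (simp add: r_def add_divide_distrib distrib_right)
  qed
  show ?thesis
  proof (rule ccontr)
    assume "\<not> w y' \<le> w y"
    then have less: "w y' - w y > 0" by simp
    \<comment> \<open>Makes \<open>d * w y / s\<close> smaller than the assumed excess; the
      \<open>+ 1\<close> keeps \<open>s\<close> positive when \<open>w y = 0\<close>.\<close>
    define s where "s = d * (w y + 1) / (w y' - w y)"
    have s: "s > 0" using d less nonneg[of y] by (simp add: s_def add_nonneg_pos)
    have "d * w y / s = (w y' - w y) * (w y / (w y + 1))" using d less nonneg[of y] by (simp add: s_def)
    also have "\<dots> < (w y' - w y) * 1"
      using less nonneg[of y] by (intro mult_strict_left_mono) (auto simp: divide_less_eq)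
    finally show False using *[OF s] by simp
  qed
qed simp

context elliptic_matrices
begin

lemma not_all_sphere_bounds:
  assumes s: "solution UNIV w G H"
  shows "\<exists>a \<mu>. 0 < \<mu> \<and> \<not> sphere_bound (\<lambda>x. w (a + x)) \<mu>"
proof (rule ccontr)
  assume "\<not> ?thesis"
  then have le: "w y' \<le> w y" for y y'
    using all_sphere_bounds_imp_const[of w y' y] solutionD(2)[OF s] by (auto simp: less_imp_le)
  note data = solutionD(1)[OF s]
  have "G 0 = 0" by (rule local_min_second_order(1)[OF data UNIV_I le])
  have "0 \<le> v \<bullet> (H 0 *v v)" for v
    by (rule local_min_second_order(2)[OF data UNIV_I le])
  \<comment> \<open>As \<open>w\<close> is constant, \<open>- w\<close> is minimal too, which gives
    the opposite inequality for the Hessian form.\<close>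
  moreover have "0 \<le> v \<bullet> (((-1) *\<^sub>R H 0) *v v)" for v
    by (rule local_min_second_order(2)[OF C2_data_scale[OF data, of "-1"] UNIV_I]) (simp add: le)
  then have "0 \<le> v \<bullet> ((-1) *\<^sub>R (H 0 *v v))" for v
    unfolding scaleR_matrix_vector_assoc .
  then have "v \<bullet> (H 0 *v v) \<le> 0" for v
    by simp
  ultimately have "v \<bullet> (H 0 *v v) = 0" for v by (simp add: order_antisym)
  then have "trace (H 0) = 0" by (simp add: trace_eq_sum_forms)
  then have "trace (conf_matrix (w 0) (G 0) (H 0)) = 0"
    using \<open>G 0 = 0\<close> by (simp add: conf_matrix_def trace_diff trace_scaleR)
  then show False using E_trace[OF solutionD(3)[OF s, of 0]] by simp
qed

theorem entire_solution_quadratic: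
  assumes n: "CARD('n) > 2" and s: "solution UNIV w G H"
  shows "\<exists>\<alpha> p q. \<alpha> > 0 \<and> (\<forall>x. w x = \<alpha> * (x \<bullet> x) + p \<bullet> x + q) \<and> (2 * \<alpha> * q - p \<bullet> p / 2) *\<^sub>R mat 1 \<in> E"
proof -
  note data = solutionD(1)[OF s]
  note D = C2_dataD[OF data]
  have wpos: "w x > 0" for x using solutionD(2)[OF s] by simp
  have wcont: "isCont w x" for x using D(3) by (simp add: continuous_on_eq_continuous_at)
  note alternatives = moving_spheres[OF n solution_translate[OF s], simplified]
  obtain a0 where "\<not> (\<forall>\<mu>>0. sphere_bound (\<lambda>x. w (a0 + x)) \<mu>)"
    using not_all_sphere_bounds[OF s] by blast
  then obtain \<mu>0 where \<mu>0: "\<mu>0 > 0" "sphere_bound (\<lambda>x. w (a0 + x)) \<mu>0" "tail_at_least (\<lambda>x. w (a0 + x)) (w a0 / \<mu>0\<^sup>2)"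
    using alternatives[of a0] by blast
  define \<alpha> where "\<alpha> = w a0 / \<mu>0\<^sup>2"
  have \<alpha>: "\<alpha> > 0" using \<mu>0(1) wpos by (simp add: \<alpha>_def)
  \<comment> \<open>One \<open>\<alpha>\<close> serves all centres: \<open>tail_comparison\<close>
    against \<open>a0\<close> in both directions equates the two constants.\<close>
  have spheres: "\<exists>\<mu>>0. \<mu>\<^sup>2 = w a / \<alpha> \<and> sphere_bound (\<lambda>x. w (a + x)) \<mu> \<and> tail_at_least (\<lambda>x. w (a + x)) \<alpha>" for a
  proof -
    have "\<not> (\<forall>\<mu>>0. sphere_bound (\<lambda>x. w (a + x)) \<mu>)"
    proof
      assume all: "\<forall>\<mu>>0. sphere_bound (\<lambda>x. w (a + x)) \<mu>"
      \<comment> \<open>At this radius the bound would cap the limit superior by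
        \<open>\<alpha> / 2\<close>.\<close>
      define \<mu> where "\<mu> = sqrt (2 * w a / \<alpha>)"
      have \<mu>: "\<mu> > 0" "\<mu>\<^sup>2 = 2 * w a / \<alpha>" using wpos[of a] \<alpha> by (simp_all add: \<mu>_def)
      have "\<alpha> \<le> w a / \<mu>\<^sup>2"
        using tail_comparison[OF wcont wpos \<mu>(1) _ \<mu>0(3)] all \<mu>(1) by (simp add: \<alpha>_def)
      then show False using \<alpha> wpos[of a] by (simp add: \<mu>(2))
    qed
    then obtain \<mu> where \<mu>: "\<mu> > 0" "sphere_bound (\<lambda>x. w (a + x)) \<mu>" "tail_at_least (\<lambda>x. w (a + x)) (w a / \<mu>\<^sup>2)"
      using alternatives[of a] by blast
    have eq: "\<alpha> = w a / \<mu>\<^sup>2"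
      using tail_comparison[OF wcont wpos \<mu>(1,2) \<mu>0(3)] tail_comparison[OF wcont wpos \<mu>0(1,2) \<mu>(3)]
      by (simp add: \<alpha>_def)
    have "\<alpha> * \<mu>\<^sup>2 = w a" unfolding eq using \<mu>(1) by simp
    then have "\<mu>\<^sup>2 = w a / \<alpha>" using \<alpha> by (simp add: eq_divide_eq mult.commute)
    moreover have "tail_at_least (\<lambda>x. w (a + x)) \<alpha>" using \<mu>(3) unfolding eq[symmetric] .
    ultimately show ?thesis using \<mu> by blast
  qed

  define m where "m = (real CARD('n) - 2) / 2"
  have m: "m > 0" using n by (simp add: m_def)
  let ?S = "{y :: real^'n. y \<noteq> 0 \<and> kelvin_point 1 y \<in> UNIV}"
  define W where "W = kelvin 1 w"
  have sW: "solution ?S W (kelvin_grad 1 w G) (kelvin_hess 1 w G H)"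
    unfolding W_def by (rule solution_kelvin[OF s]) simp
  obtain G' H' where V: "C2_data ?S (\<lambda>x. W x powr (- m)) G' H'" and neg: "\<And>x. x \<in> ?S \<Longrightarrow> trace (H' x) < 0"
    using superharmonic_solution[OF n sW] unfolding m_def by blast
  have Wpos: "W x > 0" if "x \<noteq> 0" for x using solutionD(2)[OF sW, of x] that by simp
  define \<beta> where "\<beta> = \<alpha> powr (- m)"
  \<comment> \<open>Gradient at \<open>0\<close> of \<open>\<phi>^(-m)\<close>, where
    \<open>\<phi>\<close> is the touching function obtained from the centre
    \<open>a\<close>.\<close>
  define P where "P a = (- m * \<alpha> powr (- m - 1)) *\<^sub>R (G a - (2 * \<alpha>) *\<^sub>R a)" for a
  have touch: "\<exists>r>0. \<forall>z. 0 < norm z \<and> norm z < r \<longrightarrow> \<beta> + P a \<bullet> z - \<eta> * norm z \<le> W z powr (- m)"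
    if \<eta>: "\<eta> > 0" for a \<eta>
  proof -
    obtain \<mu> where \<mu>: "\<mu> > 0" "\<mu>\<^sup>2 = w a / \<alpha>" "sphere_bound (\<lambda>x. w (a + x)) \<mu>"
      using spheres[of a] by blast
    obtain \<phi> r where r: "r > 0" and der: "(\<phi> has_derivative (\<lambda>v. (G a - (2 * \<alpha>) *\<^sub>R a) \<bullet> v)) (at 0)" and \<phi>0: "\<phi> 0 = \<alpha>"
      and le: "\<And>z. 0 < norm z \<Longrightarrow> norm z < r \<Longrightarrow> W z \<le> \<phi> z"
      using kelvin_touching_function[of w G a \<alpha> \<mu>, OF D(5)[OF UNIV_I] wpos \<alpha> \<mu>] unfolding W_def by auto
    have "((\<lambda>s. s powr (- m)) has_real_derivative (- m * \<alpha> powr (- m - 1))) (at (\<phi> 0))"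
      using \<alpha> by (auto intro!: derivative_eq_intros simp: \<phi>0)
    from has_derivative_compose[OF der this[unfolded has_field_derivative_def]]
    have "((\<lambda>z. \<phi> z powr (- m)) has_derivative (\<lambda>v. P a \<bullet> v)) (at 0)"
      by (simp add: P_def)
    then obtain \<delta> where \<delta>: "\<delta> > 0" "\<And>z. norm z < \<delta> \<Longrightarrow> \<bar>\<phi> z powr (- m) - \<beta> - P a \<bullet> z\<bar> \<le> \<eta> * norm z"
      using \<eta> unfolding has_derivative_at_alt by (auto simp: \<phi>0 \<beta>_def)
    show ?thesis
    proof (intro exI conjI allI impI)
      show "min r \<delta> > 0" using r \<delta> by simp
      fix z :: "real^'n" assume z: "0 < norm z \<and> norm z < min r \<delta>"
      have "\<phi> z powr (- m) \<le> W z powr (- m)"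
        using powr_mono2'[of "- m" "W z" "\<phi> z"] m z le[of z] Wpos[of z] by auto
      moreover have "\<beta> + P a \<bullet> z - \<eta> * norm z \<le> \<phi> z powr (- m)" using \<delta>(2)[of z] z by auto
      ultimately show "\<beta> + P a \<bullet> z - \<eta> * norm z \<le> W z powr (- m)" by linarith
    qed
  qed
  \<comment> \<open>The tail condition at the centre \<open>0\<close>, read near the puncture:
    \<open>W\<close> exceeds \<open>\<alpha> - k\<close> at points arbitrarily close to it.\<close>
  have lim: "\<exists>z. 0 < norm z \<and> norm z < r \<and> W z powr (- m) < \<beta> + \<kappa>" if \<kappa>: "\<kappa> > 0" and r: "r > 0" for \<kappa> r
  proof -
    have "isCont (\<lambda>s. s powr (- m)) \<alpha>" using \<alpha> by (intro continuous_intros) auto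
    then obtain \<delta> where \<delta>: "\<delta> > 0" "\<And>s. dist s \<alpha> < \<delta> \<Longrightarrow> dist (s powr (- m)) \<beta> < \<kappa>"
      using \<kappa> unfolding continuous_at_eps_delta \<beta>_def by (metis dist_commute)
    define k where "k = min (\<delta> / 2) (\<alpha> / 2)"
    have k: "k > 0" "k < \<delta>" "k < \<alpha>" using \<delta>(1) \<alpha> by (auto simp: k_def)
    have "tail_at_least w \<alpha>" using spheres[of 0] by auto
    then obtain y where y: "1 / r + 1 \<le> norm y" "(\<alpha> - k) * (y \<bullet> y) < w y"
      using k(1) unfolding tail_at_least_def by blast
    have "1 / r > 0" using r by simp
    then have ny: "norm y > 0" "1 / r < norm y" using y(1) by linarith+
    then have y0: "y \<noteq> 0" by auto
    define z where "z = kelvin_point 1 y"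
    have z: "norm z = 1 / norm y" "z \<noteq> 0" "kelvin_point 1 z = y"
      using kelvin_point_simps[OF y0, of 1] by (simp_all add: z_def)
    have "z \<bullet> z = 1 / (y \<bullet> y)"
      using z(1) by (simp add: power2_norm_eq_inner[symmetric] power_divide)
    then have "W z = w y / (y \<bullet> y)" by (simp add: W_def kelvin_def z(3))
    then have Wz: "\<alpha> - k < W z" using y(2) y0 by (simp add: less_divide_eq)
    have "W z powr (- m) < (\<alpha> - k) powr (- m)"
      using powr_less_mono2_neg[of "- m" "\<alpha> - k" "W z"] m k Wz by simp
    moreover have "(\<alpha> - k) powr (- m) < \<beta> + \<kappa>"
      using \<delta>(2)[of "\<alpha> - k"] k by (simp add: dist_real_def abs_if split: if_splits)
    moreover have "norm z < r" using ny r z(1) by (simp add: divide_less_eq mult.commute)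
    ultimately show ?thesis using z(2) by (intro exI[of _ z]) auto
  qed
  have "P a = P 0" for a
    by (rule touching_gradients_equal[OF n V _ zero_less_one neg _ touch touch lim]) auto
  moreover have "- m * \<alpha> powr (- m - 1) \<noteq> 0" using m \<alpha> by simp
  ultimately have "G a - (2 * \<alpha>) *\<^sub>R a = G 0" for a by (simp add: P_def)
  then have G: "G a = (2 * \<alpha>) *\<^sub>R a + G 0" for a by (metis add.commute diff_eq_eq)

  define p where "p = G 0"
  define q where "q = w 0"
  have w: "w x = \<alpha> * (x \<bullet> x) + p \<bullet> x + q" for x
  proof -
    have zero: "G x - (\<alpha> *\<^sub>R (2 *\<^sub>R (x - 0)) + p) = 0" for x
      using G[of x] by (simp add: p_def mult.commute)
    have "C2_data UNIV (\<lambda>x. w x - (\<alpha> * ((x - 0) \<bullet> (x - 0)) + p \<bullet> x)) (\<lambda>x. G x - (\<alpha> *\<^sub>R (2 *\<^sub>R (x - 0)) + p)) (\<lambda>x. H x - (\<alpha> *\<^sub>R (2 *\<^sub>R mat 1) + 0))"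
      by (intro C2_data_diff data C2_data_add C2_data_scale C2_data_dist_square C2_data_linear) auto
    from C2_dataD(5)[OF this UNIV_I, unfolded zero]
    have "((\<lambda>x. w x - (\<alpha> * (x \<bullet> x) + p \<bullet> x)) has_derivative (\<lambda>v. 0)) (at x within UNIV)" for x
      by simp
    from has_derivative_zero_unique[OF convex_UNIV this UNIV_I UNIV_I, of x 0]
    show ?thesis by (simp add: q_def)
  qed
  \<comment> \<open>\<open>G\<close> is affine, so uniqueness of derivatives identifies
    \<open>H 0\<close> with \<open>2 \<alpha> I\<close>, and the matrix of the equation at
    \<open>0\<close> is scalar.\<close>
  have "((\<lambda>a. (2 * \<alpha>) *\<^sub>R a + G 0) has_derivative (\<lambda>v. (2 * \<alpha>) *\<^sub>R v)) (at 0)"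
    by (auto intro!: derivative_eq_intros)
  moreover have "(\<lambda>a. (2 * \<alpha>) *\<^sub>R a + G 0) = G" by (rule ext) (rule G[symmetric])
  ultimately have "(G has_derivative (\<lambda>v. (2 * \<alpha>) *\<^sub>R v)) (at 0)" by simp
  from has_derivative_unique[OF D(6)[OF UNIV_I] this]
  have "H 0 *v v = (2 * \<alpha>) *\<^sub>R v" for v by (rule fun_cong)
  then have "H 0 *v v = ((2 * \<alpha>) *\<^sub>R mat 1) *v v" for v
    by (simp add: scaleR_matrix_vector_assoc[symmetric])
  then have "H 0 = (2 * \<alpha>) *\<^sub>R mat 1" by (simp add: matrix_eq)
  then have "conf_matrix (w 0) (G 0) (H 0) = (2 * \<alpha> * q - p \<bullet> p / 2) *\<^sub>R mat 1"
    by (simp add: conf_matrix_def p_def q_def scaleR_diff_left mult_ac)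
  then have "(2 * \<alpha> * q - p \<bullet> p / 2) *\<^sub>R mat 1 \<in> E" using solutionD(3)[OF s, of 0] by simp
  then show ?thesis using \<alpha> w by blast
qed

end

section \<open>The Liouville theorem\<close>

lemma second_difference:
  fixes w :: "real^'n \<Rightarrow> real"
  assumes data: "C2_data UNIV w G H" and s: "0 < s"
  shows "\<exists>t r. 0 < t \<and> t < s \<and> 0 < r \<and> r < s \<and>
    w (x + s *\<^sub>R a + s *\<^sub>R b) - w (x + s *\<^sub>R a) - w (x + s *\<^sub>R b) + w x = s * (s * (a \<bullet> (H (x + t *\<^sub>R a + r *\<^sub>R b) *v b)))"
proof -
  note D = C2_dataD[OF data]
  have line: "((\<lambda>t. w (y + t *\<^sub>R a)) has_real_derivative G (y + t *\<^sub>R a) \<bullet> a) (at t)" for y t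
    by (rule has_derivative_along_line[OF D(5)[OF UNIV_I]])
  have d1: "((\<lambda>t. w (x + s *\<^sub>R b + t *\<^sub>R a) - w (x + t *\<^sub>R a)) has_real_derivative
    G (x + s *\<^sub>R b + t *\<^sub>R a) \<bullet> a - G (x + t *\<^sub>R a) \<bullet> a) (at t)" for t
    by (intro DERIV_diff line)
  from MVT2[OF s d1] obtain t where t: "0 < t" "t < s"
    "(w (x + s *\<^sub>R b + s *\<^sub>R a) - w (x + s *\<^sub>R a)) - (w (x + s *\<^sub>R b + 0 *\<^sub>R a) - w (x + 0 *\<^sub>R a))
      = (s - 0) * (G (x + s *\<^sub>R b + t *\<^sub>R a) \<bullet> a - G (x + t *\<^sub>R a) \<bullet> a)"
    by blast
  have d2: "((\<lambda>r. G (x + t *\<^sub>R a + r *\<^sub>R b) \<bullet> a) has_real_derivative a \<bullet> (H (x + t *\<^sub>R a + r *\<^sub>R b) *v b)) (at r)" for r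
  proof -
    have "((\<lambda>r. x + t *\<^sub>R a + r *\<^sub>R b) has_derivative (\<lambda>h. h *\<^sub>R b)) (at r)"
      by (auto intro!: derivative_eq_intros)
    from has_derivative_inner_left[OF has_derivative_compose[OF this D(6)[OF UNIV_I]], of a]
    show ?thesis
      by (simp add: has_field_derivative_def matrix_vector_mult_scaleR inner_commute mult_commute_abs)
  qed
  from MVT2[OF s d2] obtain r where "0 < r" "r < s"
    "G (x + t *\<^sub>R a + s *\<^sub>R b) \<bullet> a - G (x + t *\<^sub>R a + 0 *\<^sub>R b) \<bullet> a = (s - 0) * (a \<bullet> (H (x + t *\<^sub>R a + r *\<^sub>R b) *v b))"
    by blast
  with t show ?thesis
    by (intro exI[of _ t] exI[of _ r]) (simp add: add_ac)
qed

text \<open>The second difference of \<open>w\<close> is symmetric in \<open>a\<close> and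
  \<open>b\<close>, and the mean value theorem evaluates it as \<open>s^2\<close> times either mixed
  form at a nearby point; continuity of \<open>H\<close> carries the equality to
  \<open>x\<close>.\<close>

lemma C2_data_symmetric:
  fixes w :: "real^'n \<Rightarrow> real"
  assumes data: "C2_data UNIV w G H"
  shows "transpose (H x) = H x"
proof -
  note D = C2_dataD[OF data]
  have sym: "a \<bullet> (H x *v b) = b \<bullet> (H x *v a)" for a b
  proof (rule ccontr)
    assume ne: "a \<bullet> (H x *v b) \<noteq> b \<bullet> (H x *v a)"
    define N where "N = norm a * norm b + 1"
    have N: "N > 0" by (simp add: N_def add_nonneg_pos)
    \<comment> \<open>Two errors below \<open>\<epsilon> * N\<close> then add up to less than the
      assumed discrepancy.\<close>
    define \<epsilon> where "\<epsilon> = \<bar>a \<bullet> (H x *v b) - b \<bullet> (H x *v a)\<bar> / (2 * N)"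
    have \<epsilon>: "\<epsilon> > 0" using ne N by (simp add: \<epsilon>_def)
    obtain d where d: "d > 0" "\<And>y. dist y x < d \<Longrightarrow> dist (H y) (H x) < \<epsilon>"
      using D(2) \<epsilon> unfolding continuous_on_iff by (metis UNIV_I)
    define s where "s = d / (norm a + norm b + 1)"
    have s: "s > 0" using d(1) by (simp add: s_def add_nonneg_pos)
    have close: "\<bar>a' \<bullet> (H (x + t *\<^sub>R a' + r *\<^sub>R b') *v b') - a' \<bullet> (H x *v b')\<bar> < \<epsilon> * N"
      if tr: "0 < t" "t < s" "0 < r" "r < s" and ab: "a' = a \<and> b' = b \<or> a' = b \<and> b' = a" for t r a' b'
    proof -
      have "norm (t *\<^sub>R a' + r *\<^sub>R b') \<le> t * norm a' + r * norm b'"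
        using norm_triangle_ineq[of "t *\<^sub>R a'" "r *\<^sub>R b'"] tr by simp
      also have "\<dots> \<le> s * norm a' + s * norm b'" using tr by (intro add_mono mult_right_mono) auto
      also have "\<dots> = s * (norm a + norm b)" using ab by (auto simp: algebra_simps)
      also have "\<dots> < s * (norm a + norm b + 1)" using s by simp
      also have "\<dots> = d"
      proof -
        have "norm a + norm b + 1 \<noteq> 0" using norm_ge_zero[of a] norm_ge_zero[of b] by linarith
        then show ?thesis by (simp add: s_def)
      qed
      finally have lt: "norm (H (x + t *\<^sub>R a' + r *\<^sub>R b') - H x) < \<epsilon>"
        using d(2)[of "x + t *\<^sub>R a' + r *\<^sub>R b'"] by (simp add: dist_norm add.assoc)
      have "\<bar>a' \<bullet> ((H (x + t *\<^sub>R a' + r *\<^sub>R b') - H x) *v b')\<bar> \<le> norm a' * (norm (H (x + t *\<^sub>R a' + r *\<^sub>R b') - H x) * norm b')"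
        by (rule order_trans[OF Cauchy_Schwarz_ineq2]) (intro mult_left_mono norm_matrix_vector_mult_le, simp)
      also have "\<dots> \<le> norm a' * (\<epsilon> * norm b')" using lt by (intro mult_left_mono mult_right_mono) auto
      also have "\<dots> = \<epsilon> * (norm a * norm b)" using ab by (auto simp: mult_ac)
      also have "\<dots> < \<epsilon> * N" using \<epsilon> by (simp add: N_def)
      finally show ?thesis by (simp add: matrix_vector_mult_diff_rdistrib inner_diff_right)
    qed
    obtain t r where 1: "0 < t" "t < s" "0 < r" "r < s"
      "w (x + s *\<^sub>R a + s *\<^sub>R b) - w (x + s *\<^sub>R a) - w (x + s *\<^sub>R b) + w x = s * (s * (a \<bullet> (H (x + t *\<^sub>R a + r *\<^sub>R b) *v b)))"
      using second_difference[OF data s, of x a b] by blast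
    obtain t' r' where 2: "0 < t'" "t' < s" "0 < r'" "r' < s"
      "w (x + s *\<^sub>R b + s *\<^sub>R a) - w (x + s *\<^sub>R b) - w (x + s *\<^sub>R a) + w x = s * (s * (b \<bullet> (H (x + t' *\<^sub>R b + r' *\<^sub>R a) *v a)))"
      using second_difference[OF data s, of x b a] by blast
    have e: "x + s *\<^sub>R a + s *\<^sub>R b = x + s *\<^sub>R b + s *\<^sub>R a" by (simp add: add_ac)
    have "s * (s * (a \<bullet> (H (x + t *\<^sub>R a + r *\<^sub>R b) *v b))) = s * (s * (b \<bullet> (H (x + t' *\<^sub>R b + r' *\<^sub>R a) *v a)))"
      using 1(5) 2(5) unfolding e by linarith
    then have "a \<bullet> (H (x + t *\<^sub>R a + r *\<^sub>R b) *v b) = b \<bullet> (H (x + t' *\<^sub>R b + r' *\<^sub>R a) *v a)" using s by simp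
    then have "\<bar>a \<bullet> (H x *v b) - b \<bullet> (H x *v a)\<bar> < 2 * (\<epsilon> * N)"
      using close[OF 1(1-4), of a b] close[OF 2(1-4), of b a] by simp
    then show False using N by (simp add: \<epsilon>_def)
  qed
  have "H x $ i $ j = H x $ j $ i" for i j
    using sym[of "axis i 1" "axis j 1"] by (simp add: matrix_vector_mult_basis inner_axis' column_def)
  then show ?thesis by (simp add: transpose_def vec_eq_iff)
qed

text \<open>Row \<open>i\<close> of \<open>hess\<close> holds the \<open>i\<close>-th derivatives of
  the gradient components, so the derivative of \<open>grad u\<close> is a priori the transpose of
  \<open>hess u\<close>; symmetry of second derivatives removes the difference.\<close>

lemma C2_data_Ck:
  fixes u :: "real^'n \<Rightarrow> real"
  assumes "Ck_on 2 UNIV u"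
  shows "C2_data UNIV u (grad u) (hess u)"
proof -
  have reg: "u differentiable_on UNIV" "\<And>i. partial_deriv i u differentiable_on UNIV"
    "\<And>i j. continuous_on UNIV (partial_deriv i (partial_deriv j u))"
    using assms by (auto simp: numeral_2_eq_2)
  have "C2_data UNIV u (grad u) (\<lambda>x. transpose (hess u x))"
    unfolding C2_data_def
  proof (intro conjI ballI)
    have "continuous_on UNIV (\<lambda>x. (\<chi> i j. partial_deriv j (partial_deriv i u) x) :: real^'n^'n)"
      by (intro continuous_on_vec_lambda reg)
    then show "continuous_on UNIV (\<lambda>x. transpose (hess u x))"
      by (simp add: hess_def transpose_def)
    fix x
    show "(u has_derivative (\<lambda>v. grad u x \<bullet> v)) (at x)"
      using reg(1) by (intro has_derivative_grad) (simp add: differentiable_on_def)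
    show "(grad u has_derivative (\<lambda>v. transpose (hess u x) *v v)) (at x)"
      unfolding has_derivative_componentwise_within[of "grad u"]
    proof
      fix e :: "real^'n" assume "e \<in> Basis"
      then obtain j where e: "e = axis j 1" by (auto simp: Basis_vec_def)
      have "(partial_deriv j u has_derivative (\<lambda>v. grad (partial_deriv j u) x \<bullet> v)) (at x)"
        using reg(2) by (intro has_derivative_grad) (simp add: differentiable_on_def)
      moreover have "(\<lambda>x. grad u x \<bullet> e) = partial_deriv j u"
        by (simp add: e inner_axis grad_def)
      moreover have "(transpose (hess u x) *v v) \<bullet> e = grad (partial_deriv j u) x \<bullet> v" for v
        by (simp add: e inner_axis grad_def hess_def transpose_def matrix_vector_mul_component)
      ultimately show "((\<lambda>x. grad u x \<bullet> e) has_derivative (\<lambda>v. (transpose (hess u x) *v v) \<bullet> e)) (at x)"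
        by simp
    qed
  qed simp
  moreover from C2_data_symmetric[OF this] have "transpose (hess u x) = hess u x" for x
    by (simp add: transpose_transpose)
  ultimately show ?thesis by simp
qed

text \<open>With this exponent \<open>q\<close> the powers of \<open>u\<close> match:
  \<open>q + (q - 2)\<close> and \<open>2 (q - 1)\<close> coincide, and \<open>q (q - 1)\<close> and
  \<open>q^2 / 2\<close> are the constants in \<open>conf_hess\<close>.\<close>

lemma conf_hess_eq_conf_matrix:
  fixes u :: "real^'n \<Rightarrow> real"
  assumes n: "CARD('n) > 2" and data: "C2_data UNIV u (grad u) (hess u)" and pos: "\<And>x. u x > 0"
  shows "\<exists>G H. C2_data UNIV (\<lambda>x. u x powr (- 2 / (real CARD('n) - 2))) G H \<and>
    (\<forall>x. conf_matrix (u x powr (- 2 / (real CARD('n) - 2))) (G x) (H x) = conf_hess u x)"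
proof (intro exI conjI allI)
  define n' where "n' = real CARD('n)"
  define r where "r = n' - 2"
  have r: "r > 0" "n' = r + 2" using n by (simp_all add: n'_def r_def)
  define q where "q = - 2 / (n' - 2)"
  let ?G = "\<lambda>x. (q * u x powr (q - 1)) *\<^sub>R grad u x"
  let ?H = "\<lambda>x. (q * u x powr (q - 1)) *\<^sub>R hess u x + (q * ((q - 1) * u x powr (q - 2))) *\<^sub>R outer (grad u x) (grad u x)"
  have "C2_data UNIV (\<lambda>x. u x powr q) ?G ?H"
  proof (rule C2_data_compose[OF data, where h = "\<lambda>s. s powr q" and ?h1.0 = "\<lambda>s. q * s powr (q - 1)" and ?h2.0 = "\<lambda>s. q * ((q - 1) * s powr (q - 2))"])
    show "((\<lambda>s. s powr q) has_real_derivative q * u x powr (q - 1)) (at (u x))" for x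
      using pos[of x] by (auto intro!: derivative_eq_intros)
    show "((\<lambda>s. q * s powr (q - 1)) has_real_derivative q * ((q - 1) * u x powr (q - 2))) (at (u x))" for x
      using pos[of x] by (auto intro!: derivative_eq_intros simp: diff_diff_eq)
    show "continuous_on (range u) (\<lambda>s. q * ((q - 1) * s powr (q - 2)))"
      using pos by (intro continuous_intros) (auto simp: less_imp_neq[symmetric])
  qed
  then show "C2_data UNIV (\<lambda>x. u x powr (- 2 / (real CARD('n) - 2))) ?G ?H"
    by (simp add: q_def n'_def)
  fix x
  have e1: "u x powr q * u x powr (q - 1) = u x powr (- (n' + 2) / (n' - 2))"
  proof -
    have "q + (q - 1) = - (n' + 2) / (n' - 2)" using r(1) by (simp add: q_def r(2) field_simps)
    then show ?thesis by (simp add: powr_add[symmetric])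
  qed
  have e2: "u x powr q * u x powr (q - 2) = u x powr (- 2 * n' / (n' - 2))"
    and e3: "u x powr (q - 1) * u x powr (q - 1) = u x powr (- 2 * n' / (n' - 2))"
  proof -
    have "q + (q - 2) = - 2 * n' / (n' - 2)" "(q - 1) + (q - 1) = - 2 * n' / (n' - 2)"
      using r(1) by (simp_all add: q_def r(2) field_simps)
    then show "u x powr q * u x powr (q - 2) = u x powr (- 2 * n' / (n' - 2))"
      "u x powr (q - 1) * u x powr (q - 1) = u x powr (- 2 * n' / (n' - 2))"
      by (simp_all add: powr_add[symmetric])
  qed
  have c2: "q * (q - 1) = 2 * n' / (n' - 2)\<^sup>2" and c3: "q * q / 2 = 2 / (n' - 2)\<^sup>2"
    using r(1) by (simp_all add: q_def r(2) field_simps power2_eq_square)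
  have "conf_matrix (u x powr q) (?G x) (?H x) =
    (q * (u x powr q * u x powr (q - 1))) *\<^sub>R hess u x
    + (q * (q - 1) * (u x powr q * u x powr (q - 2))) *\<^sub>R outer (grad u x) (grad u x)
    - (q * q / 2 * (u x powr (q - 1) * u x powr (q - 1)) * (grad u x \<bullet> grad u x)) *\<^sub>R mat 1"
    by (simp add: conf_matrix_def scaleR_add_right mult_ac)
  also have "\<dots> = conf_hess u x"
    unfolding e1 e2 e3 c2 c3
    by (simp add: conf_hess_def Let_def n'_def[symmetric] q_def power2_norm_eq_inner)
  finally show "conf_matrix (u x powr (- 2 / (real CARD('n) - 2))) (?G x) (?H x) = conf_hess u x"
    by (simp add: q_def n'_def)
qed

theorem corollary1:
  fixes \<Gamma> :: "(real ^ 'n) set"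
    and f u :: "real ^ 'n \<Rightarrow> real"
    and b :: real
    and k :: nat
  assumes n: "CARD('n) \<ge> 3"
    and cone: "open_convex_cone \<Gamma>"
    and sym: "symmetric_set \<Gamma>"
    and k: "(real CARD('n) + 1) / 2 < real k" "k \<le> CARD('n)"
    and sub: "pos_cone \<subseteq> \<Gamma>" "\<Gamma> \<subseteq> Gamma_cone k"
    and f_reg: "Ck_on 2 \<Gamma> f" "continuous_on (closure \<Gamma>) f"
    and f_concave: "concave_on \<Gamma> f"
    and f_sym: "symmetric_fun_on \<Gamma> f"
    and f_bd: "\<forall>l \<in> frontier \<Gamma>. f l = 0"
    and f_mono: "\<forall>l \<in> \<Gamma>. \<forall>i. partial_deriv i f l > 0"
    and f_lim: "\<forall>l \<in> \<Gamma>. filterlim (\<lambda>s. f (s *\<^sub>R l)) at_top at_top"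
    and b: "b > 0" "f (b *\<^sub>R 1) = 1"
    and u_reg: "Ck_on 4 UNIV u"
    and u_pos: "\<forall>x. u x > 0"
    and u_eq: "\<forall>x. \<exists>l. eigenvalues_of (conf_hess u x) l \<and> l \<in> \<Gamma> \<and> f l = 1"
  shows "\<exists>xb a. a > 0 \<and>
    (\<forall>x. u x = (a / (1 + 1 / 2 * a\<^sup>2 * b * (norm (x - xb))\<^sup>2)) powr ((real CARD('n) - 2) / 2))"
proof -
  have n2: "CARD('n) > 2" using n by simp
  have \<Gamma>: "open \<Gamma>" "convex \<Gamma>" using cone by (auto simp: open_convex_cone_def)
  \<comment> \<open>\<open>\<Gamma>\<close> must avoid the origin for the coordinate sums, hence the
    traces, to be positive.\<close>
  have "k \<noteq> 0" using k(1) by auto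
  then have \<Gamma>0: "0 \<notin> \<Gamma>" using zero_notin_Gamma_cone[of k] sub(2) by blast
  have f: "f differentiable_on \<Gamma>" "\<And>i. partial_deriv i f differentiable_on \<Gamma>"
    using f_reg(1) by (auto simp: numeral_2_eq_2)
  then have f': "\<And>i. continuous_on \<Gamma> (partial_deriv i f)" by (simp add: differentiable_imp_continuous_on)
  let ?E = "level_matrices \<Gamma> f"
  interpret elliptic_matrices ?E
    by (rule elliptic_level_matrices[OF \<Gamma> sym sub(1) \<Gamma>0 f_sym f(1) f']) (use f_mono in auto)
  have "Ck_on 2 UNIV u"
    using u_reg by (auto simp: numeral_2_eq_2 eval_nat_numeral differentiable_imp_continuous_on)
  then have data: "C2_data UNIV u (grad u) (hess u)" by (rule C2_data_Ck)
  have "transpose (conf_hess u x) = conf_hess u x" for x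
    using C2_data_symmetric[OF data, of x]
    by (simp add: conf_hess_def Let_def transpose_def vec_eq_iff outer_def mat_def mult.commute)
  then have E: "conf_hess u x \<in> ?E" for x using u_eq by (auto simp: level_matrices_def)
  define q where "q = - 2 / (real CARD('n) - 2)"
  obtain G H where w: "C2_data UNIV (\<lambda>x. u x powr q) G H"
    "\<And>x. conf_matrix (u x powr q) (G x) (H x) = conf_hess u x"
    using conf_hess_eq_conf_matrix[OF n2 data] u_pos unfolding q_def by blast
  then have "solution UNIV (\<lambda>x. u x powr q) G H"
    using u_pos E by (simp add: solution_def less_imp_neq[symmetric])
  from entire_solution_quadratic[OF n2 this]
  obtain \<alpha> p c where \<alpha>: "\<alpha> > 0" and wx: "\<And>x. u x powr q = \<alpha> * (x \<bullet> x) + p \<bullet> x + c"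
    and const: "(2 * \<alpha> * c - p \<bullet> p / 2) *\<^sub>R mat 1 \<in> ?E" by blast
  have b_eq: "2 * \<alpha> * c - p \<bullet> p / 2 = b"
    by (rule scalar_level_matrix_unique[OF \<Gamma> sub(1) f(1) _ const b]) (use f_mono in auto)
  \<comment> \<open>Completing the square turns \<open>w\<close> into
    \<open>\<alpha> |x - xb|^2 + b / (2 \<alpha>)\<close>. The constant term has to be
    \<open>1 / a\<close>, and then \<open>a b / 2 = \<alpha>\<close> as required.\<close>
  define a where "a = 2 * \<alpha> / b"
  define xb where "xb = (- 1 / (2 * \<alpha>)) *\<^sub>R p"
  have a: "a > 0" using \<alpha> b by (simp add: a_def)
  show ?thesis
  proof (intro exI conjI allI)
    show "a > 0" by (rule a)
    fix x
    have c: "c = b / (2 * \<alpha>) + p \<bullet> p / (4 * \<alpha>)" using b_eq \<alpha> by (simp add: field_simps)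
    have dx: "x - xb = x + (1 / (2 * \<alpha>)) *\<^sub>R p" by (simp add: xb_def)
    have "(norm (x - xb))\<^sup>2 = x \<bullet> x + (p \<bullet> x) / \<alpha> + p \<bullet> p / (4 * \<alpha>\<^sup>2)"
      unfolding power2_norm_eq_inner dx using \<alpha>
      by (simp add: inner_add_left inner_add_right inner_commute[of x p] power2_eq_square) (simp add: field_simps)
    moreover have "\<alpha> * X + s + (b / (2 * \<alpha>) + P / (4 * \<alpha>)) =
      (1 + 1 / 2 * a\<^sup>2 * b * (X + s / \<alpha> + P / (4 * \<alpha>\<^sup>2))) / a" for X s P
      using \<alpha> b(1) by (simp add: a_def field_simps power2_eq_square)
    ultimately have "u x powr q = (1 + 1 / 2 * a\<^sup>2 * b * (norm (x - xb))\<^sup>2) / a"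
      by (simp only: wx c)
    then have "a / (1 + 1 / 2 * a\<^sup>2 * b * (norm (x - xb))\<^sup>2) = u x powr (- q)"
      by (simp add: powr_minus)
    then have "(a / (1 + 1 / 2 * a\<^sup>2 * b * (norm (x - xb))\<^sup>2)) powr ((real CARD('n) - 2) / 2)
      = u x powr (- q * ((real CARD('n) - 2) / 2))" by (simp add: powr_powr)
    also have "- q * ((real CARD('n) - 2) / 2) = 1" using n2 by (simp add: q_def)
    finally show "u x = (a / (1 + 1 / 2 * a\<^sup>2 * b * (norm (x - xb))\<^sup>2)) powr ((real CARD('n) - 2) / 2)"
      using u_pos by (simp add: less_imp_le)
  qed
qed

end
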